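(* Let $k$ be a field of characteristic $0$ and let $\mathbb{A}=k(\!(M)\!)$ and $\mathbb{B}=k(\!(N)\!)$ be algebras of Noetherian series, where $M$ and $N$ are partially ordered monoids. Let $\Phi\colon\mathrm{Der}^+_{\prec}(\mathbb{A})\to\mathrm{Der}^+_{\prec}(\mathbb{B})$ be a strongly linear morphism of Lie algebras. Then there exists a unique group morphism $\Psi\colon 1\text{-}\mathrm{Aut}^+_k(\mathbb{A})\to 1\text{-}\mathrm{Aut}^+_k(\mathbb{B})$ with $$\Psi(\exp(\partial))=\exp(\Phi(\partial))$$ for all $\partial\in\mathrm{Der}^+_{\prec}(\mathbb{A})$.
   Context: Algebras are associative over the field $k$. A partially ordered set is Noetherian if it has no infinite antichain and every non-empty chain in it has a minimal element. A partially ordered monoid is a (not necessarily commutative) monoid $(M,+,0)$ with a partial (strict) ordering $<$ such that $f<g$ implies $f+h<g+h$ and $h+f<h+g$. Noetherian series. For a non-empty partially ordered set $(\Omega,<)$, $\mathbf{H}_\Omega k$ is the vector space of maps $v\colon\Omega\to k$ whose support $\mathrm{supp}\,v=\{p:v(p)\ne0\}$ is Noetherian. A family $\mathbf{f}\colon I\to\mathbf{H}_\Omega k$ is summable if $\bigcup_{i\in I}\mathrm{supp}\,\mathbf{f}(i)$ is Noetherian and for every $p\in\Omega$ the set $\{i\in I:p\in\mathrm{supp}\,\mathbf{f}(i)\}$ is finite; its sum is $p\mapsto\sum_{i\in I}\mathbf{f}(i)(p)$. $k(\!(M)\!)=\mathbf{H}_M k$, with Cauchy product $(a\cdot b)(m)=\sum_{m_1+m_2=m}a(m_1)b(m_2)$,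 is a unital algebra. For $v,w\in\mathbf{H}_\Omega k$, write $v\prec w$ if $w\neq0$ and for every $p\in\mathrm{supp}\,v$ there is $q\in\mathrm{supp}\,w$ with $p>q$. A linear map $\phi$ on $\mathbf{H}_\Omega k$ is contracting if $\phi(v)\prec v$ for all $v\ne0$. A linear map between spaces equipped with a notion of summable families and sums is strongly linear if it maps summable families to summable families and commutes with their sums. $\mathrm{Der}^+_\prec(\mathbb{A})$ is the set of contracting strongly linear maps $\partial\colon\mathbb{A}\to\mathbb{A}$ with $\partial(ab)=\partial(a)b+a\partial(b)$; it is a Lie algebra with bracket $[\partial_1,\partial_2]=\partial_1\circ\partial_2-\partial_2\circ\partial_1$. $1\text{-}\mathrm{Aut}^+_k(\mathbb{A})$ is the group (under composition) of bijective strongly linear algebra morphisms $\sigma\colon\mathbb{A}\to\mathbb{A}$ with $\sigma(a)-a\prec a$ for all $a\in\mathbb{A}\setminus\{0\}$. Sums of strongly linear maps: a family $(\phi_j)_{j\in J}$ of strongly linear maps $\mathbb{A}\to\mathbb{A}$ is $\mathrm{Lin}$-summable if for every summable family $(v_i)_{i\in I}$ in $\mathbb{A}$ the family $(\phi_j(v_i))_{(i,j)\in I\times J}$ is summable; its sum is $v\mapsto\sum_{j\in J}\phi_j(v)$. This is the notion of summability on $\mathrm{Der}^+_\prec(\mathbb{A})$ (which is closed under these sums) with respect to which strong linearity of $\Phi$ is understood. For $\partial\in\mathrm{Der}^+_\prec(\mathbb{A})$, $\exp(\partial)=\sum_{n\in\mathbb{N}}\frac{1}{n!}\partial^{[n]}\in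 1\text{-}\mathrm{Aut}^+_k(\mathbb{A})$, where $\partial^{[n]}$ is the $n$-th iterate. The same notation applies to $\mathbb{B}$. *)

theory Defs
  imports Complex_Main "HOL-Library.Ramsey" "HOL-Library.Infinite_Set" "HOL-Algebra.Group"
begin

definition noetherian :: "'a::order set \<Rightarrow> bool" where
  "noetherian A \<longleftrightarrow>
     (\<forall>B \<subseteq> A. pairwise (\<lambda>x y. \<not> x \<le> y) B \<longrightarrow> finite B) \<and>
     (\<forall>C \<subseteq> A. C \<noteq> {} \<and> Complete_Partial_Order.chain (\<le>) C \<longrightarrow> (\<exists>m\<in>C. \<forall>x\<in>C. \<not> x < m))"

lemma noetherian_subset:
  assumes N: "noetherian A" and BA: "B \<subseteq> A"
  shows "noetherian B"
  unfolding noetherian_def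
proof (intro conjI allI impI)
  fix D assume "D \<subseteq> B" "pairwise (\<lambda>x y. \<not> x \<le> y) D"
  then show "finite D" using N BA unfolding noetherian_def by (metis subset_trans)
next
  fix C assume "C \<subseteq> B" "C \<noteq> {} \<and> Complete_Partial_Order.chain (\<le>) C"
  then have "C \<subseteq> A" "C \<noteq> {} \<and> Complete_Partial_Order.chain (\<le>) C" using BA by (metis subset_trans)+
  then show "\<exists>m\<in>C. \<forall>x\<in>C. \<not> x < m" using N unfolding noetherian_def by simp
qed

lemma noetherian_good:
  fixes x :: "nat \<Rightarrow> 'a::order"
  assumes N: "noetherian A" and x: "range x \<subseteq> A"
  shows "\<exists>i j. i < j \<and> x i \<le> x j"
proof (rule ccontr)
  assume "\<not> ?thesis"
  then have bad: "\<And>i j. i < j \<Longrightarrow> \<not> x i \<le> x j" by blast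
  have ne: "x i \<noteq> x j" if "i \<noteq> j" for i j
    using that bad[of i j] bad[of j i] by (cases "i < j") auto
  define f :: "nat set \<Rightarrow> nat" where "f = (\<lambda>e. if x (Max e) < x (Min e) then 1 else 0)"
  have "\<exists>Y t. Y \<subseteq> (UNIV::nat set) \<and> infinite Y \<and> t < 2 \<and> (\<forall>i\<in>Y. \<forall>j\<in>Y. i \<noteq> j \<longrightarrow> f {i, j} = t)"
    by (rule Ramsey2[OF infinite_UNIV_nat]) (simp add: f_def)
  then obtain Y t where Y: "infinite Y" "t < 2"
    "\<And>i j. i \<in> Y \<Longrightarrow> j \<in> Y \<Longrightarrow> i \<noteq> j \<Longrightarrow> f {i, j} = t" by blast
  have fij: "f {i, j} = (if x j < x i then 1 else 0)" if "i < j" for i j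
    using that by (simp add: f_def max_def min_def)
  show False
  proof (cases "t = 1")
    case True
    have dec: "x j < x i" if "i \<in> Y" "j \<in> Y" "i < j" for i j
    proof -
      have "f {i, j} = 1" using Y(3)[of i j] that True by simp
      then show ?thesis unfolding fij[OF that(3)] by (metis zero_neq_one)
    qed
    have "Complete_Partial_Order.chain (\<le>) (x ` Y)"
    proof (rule Complete_Partial_Order.chainI)
      fix u w assume "u \<in> x ` Y" "w \<in> x ` Y"
      then obtain i j where "i \<in> Y" "u = x i" "j \<in> Y" "w = x j" by blast
      then show "u \<le> w \<or> w \<le> u"
        using dec[of i j] dec[of j i] less_linear[of i j] by (auto simp: le_less)
    qed
    moreover have "x ` Y \<noteq> {}" using Y(1) by auto
    moreover have "x ` Y \<subseteq> A" using x by auto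
    ultimately have "\<exists>m\<in>x ` Y. \<forall>y\<in>x ` Y. \<not> y < m"
      using N[unfolded noetherian_def, THEN conjunct2, THEN spec, of "x ` Y"] by metis
    then obtain i where i: "i \<in> Y" "\<And>j. j \<in> Y \<Longrightarrow> \<not> x j < x i" by auto
    obtain j where "j \<in> Y" "i < j" using Y(1) unfolding infinite_nat_iff_unbounded by blast
    then show False using i dec by blast
  next
    case False
    then have t: "t = 0" using Y(2) by simp
    have "\<not> x i \<le> x j" if "i \<in> Y" "j \<in> Y" "i \<noteq> j" for i j
    proof (cases "i < j")
      case True then show ?thesis using bad by blast
    next
      case False
      then have ji: "j < i" using that by simp
      have "f {j, i} = 0" using Y(3)[of j i] that t by simp
      then have "\<not> x i < x j" unfolding fij[OF ji] by (metis zero_neq_one)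
      then show ?thesis using ne[OF that(3)] by (simp add: less_le)
    qed
    then have "pairwise (\<lambda>x y. \<not> x \<le> y) (x ` Y)"
      unfolding pairwise_def by blast
    moreover have "x ` Y \<subseteq> A" using x by auto
    ultimately have "finite (x ` Y)" using N unfolding noetherian_def by simp
    moreover have "inj_on x Y" using ne by (auto simp: inj_on_def)
    ultimately show False using Y(1) finite_imageD by blast
  qed
qed

lemma noetherianI_good:
  fixes A :: "'a::order set"
  assumes good: "\<And>x::nat \<Rightarrow> 'a. range x \<subseteq> A \<Longrightarrow> \<exists>i j. i < j \<and> x i \<le> x j"
  shows "noetherian A"
  unfolding noetherian_def
proof (intro conjI allI impI)
  fix B assume B: "B \<subseteq> A" "pairwise (\<lambda>x y. \<not> x \<le> y) B"
  show "finite B"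
  proof (rule ccontr)
    assume "infinite B"
    then obtain x :: "nat \<Rightarrow> 'a" where x: "inj x" "range x \<subseteq> B"
      by (meson infinite_countable_subset)
    then obtain i j where ij: "i < j" "x i \<le> x j" using good B(1) by (meson subset_trans)
    then have "x i \<noteq> x j" using x(1) by (simp add: inj_eq)
    then show False using B(2) ij x(2) unfolding pairwise_def by blast
  qed
next
  fix C assume C: "C \<subseteq> A" "C \<noteq> {} \<and> Complete_Partial_Order.chain (\<le>) C"
  show "\<exists>m\<in>C. \<forall>x\<in>C. \<not> x < m"
  proof (rule ccontr)
    assume "\<not> ?thesis"
    then have "\<forall>m\<in>C. \<exists>y\<in>C. y < m" by blast
    then obtain p where p: "\<And>m. m \<in> C \<Longrightarrow> p m \<in> C \<and> p m < m" by metis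
    obtain c where c: "c \<in> C" using C by blast
    have inC: "(p ^^ n) c \<in> C" for n by (induction n) (auto simp: c p)
    have dec: "(p ^^ (i + Suc k)) c < (p ^^ i) c" for i k
    proof (induction k)
      case 0 then show ?case using p[OF inC[of i]] by simp
    next
      case (Suc k) then show ?case using p[OF inC[of "i + Suc k"]] by (simp, meson order.strict_trans)
    qed
    obtain i j where "i < j" "(p ^^ i) c \<le> (p ^^ j) c"
      using good[of "\<lambda>n. (p ^^ n) c"] inC C(1) by blast
    then show False using dec[of i "j - Suc i"] by simp
  qed
qed

lemma noetherian_mono_subseq:
  fixes x :: "nat \<Rightarrow> 'a::order"
  assumes N: "noetherian A" and x: "range x \<subseteq> A"
  obtains r :: "nat \<Rightarrow> nat" where "strict_mono r" "\<forall>i j. i \<le> j \<longrightarrow> x (r i) \<le> x (r j)"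
proof -
  define f :: "nat set \<Rightarrow> nat" where "f = (\<lambda>e. if x (Min e) \<le> x (Max e) then 1 else 0)"
  have "\<exists>Y t. Y \<subseteq> (UNIV::nat set) \<and> infinite Y \<and> t < 2 \<and> (\<forall>i\<in>Y. \<forall>j\<in>Y. i \<noteq> j \<longrightarrow> f {i, j} = t)"
    by (rule Ramsey2[OF infinite_UNIV_nat]) (simp add: f_def)
  then obtain Y t where Y: "infinite Y" "t < 2"
    "\<And>i j. i \<in> Y \<Longrightarrow> j \<in> Y \<Longrightarrow> i \<noteq> j \<Longrightarrow> f {i, j} = t" by blast
  have fij: "f {i, j} = (if x i \<le> x j then 1 else 0)" if "i < j" for i j
    using that by (simp add: f_def max_def min_def)
  define r where "r = enumerate Y"
  have r: "strict_mono r" unfolding r_def using Y(1) by (rule strict_mono_enumerate)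
  have rY: "r n \<in> Y" for n unfolding r_def using Y(1) by (rule enumerate_in_set)
  have "range (\<lambda>n. x (r n)) \<subseteq> A" using x by auto
  from noetherian_good[OF N this] obtain i j where ij: "i < j" "x (r i) \<le> x (r j)" by blast
  have rij: "r i < r j" if "i < j" for i j using r that by (simp add: strict_mono_less)
  have t: "t = 1" using Y(3)[OF rY rY, of i j] fij[OF rij[OF ij(1)]] rij[OF ij(1)] ij(2) by simp
  have "x (r i) \<le> x (r j)" if "i \<le> j" for i j
  proof (cases "i = j")
    case False
    then have l: "r i < r j" using that rij by simp
    then have "f {r i, r j} = 1" using Y(3)[OF rY rY, of i j] t by simp
    then show ?thesis unfolding fij[OF l] by (metis zero_neq_one)
  qed simp
  then have "\<forall>i j. i \<le> j \<longrightarrow> x (r i) \<le> x (r j)" by simp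
  with r show thesis by (rule that)
qed

lemma noetherian_finite: "finite A \<Longrightarrow> noetherian (A::'a::order set)"
proof (rule noetherianI_good)
  fix x :: "nat \<Rightarrow> 'a" assume "finite A" "range x \<subseteq> A"
  then have "\<not> inj x" using finite_subset range_inj_infinite by blast
  then obtain i j where "i \<noteq> j" "x i = x j" unfolding inj_def by blast
  then show "\<exists>i j. i < j \<and> x i \<le> x j" by (metis linorder_neqE_nat order_refl)
qed

lemma noetherian_Un:
  assumes "noetherian A" "noetherian B"
  shows "noetherian (A \<union> B)"
proof (rule noetherianI_good)
  fix x :: "nat \<Rightarrow> 'a" assume x: "range x \<subseteq> A \<union> B"
  have *: "\<exists>i j. i < j \<and> x i \<le> x j" if S: "noetherian S" "infinite {n. x n \<in> S}" for S
  proof -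
    have "range (\<lambda>n. x (enumerate {n. x n \<in> S} n)) \<subseteq> S"
      using enumerate_in_set[OF S(2)] by auto
    from noetherian_good[OF S(1) this] show ?thesis
      using enumerate_mono[OF _ S(2)] by blast
  qed
  have "UNIV = {n. x n \<in> A} \<union> {n. x n \<in> B}" using x by auto
  then have "infinite {n. x n \<in> A} \<or> infinite {n. x n \<in> B}"
    using infinite_UNIV_nat by (metis finite_UnI)
  then show "\<exists>i j. i < j \<and> x i \<le> x j" using * assms by blast
qed

class po_monoid = monoid_add + order +
  assumes po_add_less_right: "f < g \<Longrightarrow> f + h < g + h"
    and po_add_less_left: "f < g \<Longrightarrow> h + f < h + g"
begin

lemma po_add_mono: "a \<le> b \<Longrightarrow> c \<le> d \<Longrightarrow> a + c \<le> b + d"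
proof -
  assume "a \<le> b" "c \<le> d"
  then have "a + c \<le> b + c" "b + c \<le> b + d"
    using po_add_less_right[of a b c] po_add_less_left[of c d b] by (auto simp: le_less)
  then show ?thesis by (rule order.trans)
qed

lemma po_add_eqD: "a \<le> b \<Longrightarrow> c \<le> d \<Longrightarrow> a + c = b + d \<Longrightarrow> a = b \<and> c = d"
proof -
  assume le: "a \<le> b" "c \<le> d" and eq: "a + c = b + d"
  have "a + c \<le> b + c" "b + c \<le> b + d" using po_add_mono le by simp_all
  with eq have "a + c = b + c" "b + c = b + d" by simp_all
  then have "\<not> a < b" "\<not> c < d" using po_add_less_right[of a b c] po_add_less_left[of c d b] by auto
  then show ?thesis using le by (simp add: less_le)
qed

end

lemma noetherian_sum_set:
  fixes A B :: "'m::po_monoid set"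
  assumes "noetherian A" "noetherian B"
  shows "noetherian {a + b | a b. a \<in> A \<and> b \<in> B}"
proof (rule noetherianI_good)
  fix z :: "nat \<Rightarrow> 'm" assume "range z \<subseteq> {a + b | a b. a \<in> A \<and> b \<in> B}"
  then have "\<forall>n. \<exists>a b. z n = a + b \<and> a \<in> A \<and> b \<in> B" by blast
  then obtain x y where xy: "\<And>n. z n = x n + y n" "range x \<subseteq> A" "range y \<subseteq> B"
    by (metis image_subsetI)
  obtain r :: "nat \<Rightarrow> nat" where r: "strict_mono r" "\<forall>i j. i \<le> j \<longrightarrow> x (r i) \<le> x (r j)"
    by (rule noetherian_mono_subseq[OF assms(1) xy(2)]) (rule that)
  have "range (\<lambda>n. y (r n)) \<subseteq> B" using xy(3) by auto
  from noetherian_good[OF assms(2) this] obtain i j where ij: "i < j" "y (r i) \<le> y (r j)" by blast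
  then have "z (r i) \<le> z (r j)" using r(2) po_add_mono xy(1) by (metis less_imp_le)
  moreover have "r i < r j" using r(1) ij by (simp add: strict_mono_less)
  ultimately show "\<exists>i j. i < j \<and> z i \<le> z j" by blast
qed

lemma noetherian_finite_decompositions:
  fixes A B :: "'m::po_monoid set"
  assumes "noetherian A" "noetherian B"
  shows "finite {(a, b). a \<in> A \<and> b \<in> B \<and> a + b = m}" (is "finite ?S")
proof (rule ccontr)
  assume "infinite ?S"
  then obtain z :: "nat \<Rightarrow> 'm \<times> 'm" where z: "inj z" "range z \<subseteq> ?S"
    by (meson infinite_countable_subset)
  define x y where "x = fst \<circ> z" and "y = snd \<circ> z"
  have zS: "z n \<in> ?S" for n using z(2) by (rule subsetD) simp
  have xA: "range x \<subseteq> A" and yB: "range y \<subseteq> B" and xy: "\<And>n. x n + y n = m"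
    using zS by (fastforce simp: x_def y_def split_beta)+
  obtain r :: "nat \<Rightarrow> nat" where r: "strict_mono r" "\<forall>i j. i \<le> j \<longrightarrow> x (r i) \<le> x (r j)"
    by (rule noetherian_mono_subseq[OF assms(1) xA]) (rule that)
  have "range (\<lambda>n. y (r n)) \<subseteq> B" using yB by auto
  from noetherian_good[OF assms(2) this] obtain i j where ij: "i < j" "y (r i) \<le> y (r j)" by blast
  then have "x (r i) = x (r j) \<and> y (r i) = y (r j)"
    using r(2) xy by (intro po_add_eqD) auto
  then have "z (r i) = z (r j)" by (simp add: x_def y_def prod_eq_iff)
  then have "r i = r j" using z(1) by (simp add: inj_eq)
  then show False using r(1) ij(1) by (simp add: strict_mono_eq)
qed

typedef (overloaded) ('m::order, 'k::zero) series = "{v :: 'm \<Rightarrow> 'k. noetherian {p. v p \<noteq> 0}}"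
  morphisms coeff Abs_series
  by (rule exI[of _ "\<lambda>_. 0"]) (simp add: noetherian_finite)

setup_lifting type_definition_series

definition supp :: "('m::order, 'k::zero) series \<Rightarrow> 'm set" where
  "supp v = {p. coeff v p \<noteq> 0}"

lemma noetherian_supp: "noetherian (supp v)"
  using coeff[of v] by (simp add: supp_def)

lemma series_eqI: "(\<And>p. coeff v p = coeff w p) \<Longrightarrow> v = w"
  by (simp add: coeff_inject[symmetric] fun_eq_iff)

instantiation series :: (order, ab_group_add) ab_group_add
begin

lift_definition zero_series :: "('a, 'b) series" is "\<lambda>_. 0"
  by (simp add: noetherian_finite)

lift_definition plus_series :: "('a, 'b) series \<Rightarrow> ('a, 'b) series \<Rightarrow> ('a, 'b) series"
  is "\<lambda>v w p. v p + w p"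
  by (rule noetherian_subset, erule (1) noetherian_Un) auto

lift_definition uminus_series :: "('a, 'b) series \<Rightarrow> ('a, 'b) series"
  is "\<lambda>v p. - v p"
  by simp

lift_definition minus_series :: "('a, 'b) series \<Rightarrow> ('a, 'b) series \<Rightarrow> ('a, 'b) series"
  is "\<lambda>v w p. v p - w p"
  by (rule noetherian_subset, erule (1) noetherian_Un) auto

instance
  by standard (transfer; simp add: fun_eq_iff algebra_simps)+

end

lemma supp_0 [simp]: "supp 0 = {}"
  by (simp add: supp_def zero_series.rep_eq)

lift_definition scale :: "'k::field \<Rightarrow> ('m::order, 'k) series \<Rightarrow> ('m, 'k) series"
  is "\<lambda>c v p. c * v p"
  by (erule noetherian_subset) auto

interpretation series: vector_space "scale :: 'k::field \<Rightarrow> ('m::order, 'k) series \<Rightarrow> _"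
  by standard (transfer; simp add: fun_eq_iff algebra_simps)+

text \<open>Cauchy product. Only decompositions inside the supports are summed, so that the index set
  is finite (an infinite index set would silently make the sum zero).\<close>

lift_definition cauchy_product ::
    "('m::po_monoid, 'k::field) series \<Rightarrow> ('m, 'k) series \<Rightarrow> ('m, 'k) series"
  is "\<lambda>a b m. \<Sum>(m1, m2) \<in> {(m1, m2). a m1 \<noteq> 0 \<and> b m2 \<noteq> 0 \<and> m1 + m2 = m}. a m1 * b m2"
proof -
  fix a b :: "'m \<Rightarrow> 'k"
  assume N: "noetherian {p. a p \<noteq> 0}" "noetherian {p. b p \<noteq> 0}"
  show "noetherian {m. (\<Sum>(m1, m2) \<in> {(m1, m2). a m1 \<noteq> 0 \<and> b m2 \<noteq> 0 \<and> m1 + m2 = m}. a m1 * b m2) \<noteq> 0}"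
  proof (rule noetherian_subset[OF noetherian_sum_set[OF N]], safe)
    fix m assume "(\<Sum>(m1, m2) \<in> {(m1, m2). a m1 \<noteq> 0 \<and> b m2 \<noteq> 0 \<and> m1 + m2 = m}. a m1 * b m2) \<noteq> 0"
    then have "{(m1, m2). a m1 \<noteq> 0 \<and> b m2 \<noteq> 0 \<and> m1 + m2 = m} \<noteq> {}"
      by (metis (no_types, lifting) sum.empty)
    then show "\<exists>p q. m = p + q \<and> p \<in> {p. a p \<noteq> 0} \<and> q \<in> {p. b p \<noteq> 0}" by auto
  qed
qed

lemma coeff_cauchy_product:
  assumes "supp a \<subseteq> A" "supp b \<subseteq> B" "noetherian A" "noetherian B"
  shows "coeff (cauchy_product a b) m =
    (\<Sum>(x, y) \<in> {(x, y). x \<in> A \<and> y \<in> B \<and> x + y = m}. coeff a x * coeff b y)"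
  unfolding cauchy_product.rep_eq
  by (rule sum.mono_neutral_left[OF noetherian_finite_decompositions[OF assms(3,4)]])
    (use assms(1,2) in \<open>auto simp: supp_def\<close>)

lemma supp_cauchy_product:
  "supp (cauchy_product a b) \<subseteq> {x + y | x y. x \<in> supp a \<and> y \<in> supp b}"
proof
  fix m assume "m \<in> supp (cauchy_product a b)"
  then have "{(x, y). x \<in> supp a \<and> y \<in> supp b \<and> x + y = m} \<noteq> {}"
    unfolding supp_def[of "cauchy_product a b"]
    using coeff_cauchy_product[OF order_refl order_refl noetherian_supp noetherian_supp, of a b m]
    by (metis (mono_tags, lifting) mem_Collect_eq sum.empty)
  then show "m \<in> {x + y | x y. x \<in> supp a \<and> y \<in> supp b}" by blast
qed

lemma cauchy_product_assoc:
  fixes a b c :: "('m::po_monoid, 'k::field) series"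
  shows "cauchy_product (cauchy_product a b) c = cauchy_product a (cauchy_product b c)"
proof (rule series_eqI)
  fix m
  let ?A = "supp a" and ?B = "supp b" and ?C = "supp c"
  note N = noetherian_supp[of a] noetherian_supp[of b] noetherian_supp[of c]
  define S where "S = {x + y | x y. x \<in> ?A \<and> y \<in> ?B}"
  define T where "T = {x + y | x y. x \<in> ?B \<and> y \<in> ?C}"
  have NS: "noetherian S" "noetherian T" unfolding S_def T_def by (intro noetherian_sum_set N)+
  have "coeff (cauchy_product (cauchy_product a b) c) m =
    (\<Sum>(u, z) \<in> {(u, z). u \<in> S \<and> z \<in> ?C \<and> u + z = m}.
      (\<Sum>(x, y) \<in> {(x, y). x \<in> ?A \<and> y \<in> ?B \<and> x + y = u}. coeff a x * coeff b y) * coeff c z)"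
    by (subst coeff_cauchy_product[OF supp_cauchy_product[of a b, folded S_def] order_refl NS(1) N(3)],
        subst coeff_cauchy_product[OF order_refl order_refl N(1,2)]) rule
  also have "\<dots> = (\<Sum>w \<in> {(u, z). u \<in> S \<and> z \<in> ?C \<and> u + z = m}.
      \<Sum>v \<in> {(x, y). x \<in> ?A \<and> y \<in> ?B \<and> x + y = fst w}.
        coeff a (fst v) * coeff b (snd v) * coeff c (snd w))"
    by (simp add: split_beta sum_distrib_right)
  also have "\<dots> = (\<Sum>(w, v) \<in> (SIGMA w:{(u, z). u \<in> S \<and> z \<in> ?C \<and> u + z = m}.
        {(x, y). x \<in> ?A \<and> y \<in> ?B \<and> x + y = fst w}).
        coeff a (fst v) * coeff b (snd v) * coeff c (snd w))"
    by (rule sum.Sigma[OF noetherian_finite_decompositions[OF NS(1) N(3)]])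
      (simp add: noetherian_finite_decompositions[OF N(1,2)])
  also have "\<dots> = (\<Sum>(w, v) \<in> (SIGMA w:{(x, u). x \<in> ?A \<and> u \<in> T \<and> x + u = m}.
        {(y, z). y \<in> ?B \<and> z \<in> ?C \<and> y + z = snd w}).
        coeff a (fst w) * (coeff b (fst v) * coeff c (snd v)))"
    by (rule sum.reindex_bij_witness[where
        j = "\<lambda>(w, v). ((fst v, snd v + snd w), (snd v, snd w))" and
        i = "\<lambda>(w, v). ((fst w + fst v, snd v), (fst w, fst v))"])
      (auto simp: S_def T_def add.assoc mult.assoc, (blast | metis add.assoc)+)
  also have "\<dots> = (\<Sum>w \<in> {(x, u). x \<in> ?A \<and> u \<in> T \<and> x + u = m}.
      \<Sum>v \<in> {(y, z). y \<in> ?B \<and> z \<in> ?C \<and> y + z = snd w}.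
        coeff a (fst w) * (coeff b (fst v) * coeff c (snd v)))"
    by (rule sum.Sigma[symmetric, OF noetherian_finite_decompositions[OF N(1) NS(2)]])
      (simp add: noetherian_finite_decompositions[OF N(2,3)])
  also have "\<dots> = (\<Sum>(x, u) \<in> {(x, u). x \<in> ?A \<and> u \<in> T \<and> x + u = m}.
      coeff a x * (\<Sum>(y, z) \<in> {(y, z). y \<in> ?B \<and> z \<in> ?C \<and> y + z = u}. coeff b y * coeff c z))"
    by (simp add: split_beta sum_distrib_left)
  also have "\<dots> = coeff (cauchy_product a (cauchy_product b c)) m"
    by (subst coeff_cauchy_product[OF order_refl supp_cauchy_product[of b c, folded T_def] N(1) NS(2)],
        subst coeff_cauchy_product[OF order_refl order_refl N(2,3)]) rule
  finally show "coeff (cauchy_product (cauchy_product a b) c) m =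
    coeff (cauchy_product a (cauchy_product b c)) m" .
qed

lift_definition unit_series :: "('m::po_monoid, 'k::field) series"
  is "\<lambda>p. if p = 0 then 1 else 0"
  by (rule noetherian_finite) simp

lemma supp_unit_series: "supp unit_series = {0}"
  by (auto simp: supp_def unit_series.rep_eq)

lemma cauchy_product_unit_left: "cauchy_product unit_series a = a"
proof (rule series_eqI)
  fix m
  have "{(x, y). x \<in> {0} \<and> y \<in> insert m (supp a) \<and> x + y = m} = {(0, m)}" by auto
  then show "coeff (cauchy_product unit_series a) m = coeff a m"
    using coeff_cauchy_product[of unit_series "{0}" a "insert m (supp a)" m]
      noetherian_Un[OF noetherian_finite[of "{m}"] noetherian_supp[of a]]
    by (auto simp: supp_unit_series noetherian_finite unit_series.rep_eq)
qed

lemma cauchy_product_unit_right: "cauchy_product a unit_series = a"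
proof (rule series_eqI)
  fix m
  have "{(x, y). x \<in> insert m (supp a) \<and> y \<in> {0} \<and> x + y = m} = {(m, 0)}" by auto
  then show "coeff (cauchy_product a unit_series) m = coeff a m"
    using coeff_cauchy_product[of a "insert m (supp a)" unit_series "{0}" m]
      noetherian_Un[OF noetherian_finite[of "{m}"] noetherian_supp[of a]]
    by (auto simp: supp_unit_series noetherian_finite unit_series.rep_eq)
qed

lemma supp_add: "supp (a + b) \<subseteq> supp a \<union> supp (b :: ('m::order, 'k::ab_group_add) series)"
  by (auto simp: supp_def plus_series.rep_eq)

lemma cauchy_product_add_left:
  "cauchy_product (a + b) c = cauchy_product a c + cauchy_product b c"
proof (rule series_eqI)
  fix m
  note N = noetherian_Un[OF noetherian_supp[of a] noetherian_supp[of b]] noetherian_supp[of c]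
  show "coeff (cauchy_product (a + b) c) m = coeff (cauchy_product a c + cauchy_product b c) m"
    by (simp add: plus_series.rep_eq coeff_cauchy_product[OF supp_add order_refl N]
        coeff_cauchy_product[OF Un_upper1 order_refl N] coeff_cauchy_product[OF Un_upper2 order_refl N]
        sum.distrib[symmetric] split_beta algebra_simps)
qed

lemma cauchy_product_add_right:
  "cauchy_product c (a + b) = cauchy_product c a + cauchy_product c b"
proof (rule series_eqI)
  fix m
  note N = noetherian_supp[of c] noetherian_Un[OF noetherian_supp[of a] noetherian_supp[of b]]
  show "coeff (cauchy_product c (a + b)) m = coeff (cauchy_product c a + cauchy_product c b) m"
    by (simp add: plus_series.rep_eq coeff_cauchy_product[OF order_refl supp_add N]
        coeff_cauchy_product[OF order_refl Un_upper1 N] coeff_cauchy_product[OF order_refl Un_upper2 N]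
        sum.distrib[symmetric] split_beta algebra_simps)
qed

instantiation series :: (po_monoid, field) ring_1
begin

definition one_series :: "('a, 'b) series" where
  "1 = unit_series"

definition times_series :: "('a, 'b) series \<Rightarrow> ('a, 'b) series \<Rightarrow> ('a, 'b) series" where
  "a * b = cauchy_product a b"

instance
proof
  show "(0 :: ('a, 'b) series) \<noteq> 1"
    unfolding one_series_def by (metis insert_not_empty supp_0 supp_unit_series)
qed (simp_all add: times_series_def one_series_def cauchy_product_assoc cauchy_product_unit_left
    cauchy_product_unit_right cauchy_product_add_left cauchy_product_add_right)

end

lemma scale_mult_left: "scale c a * b = scale c (a * b)"
  and scale_mult_right: "a * scale c b = scale c (a * b)"
proof -
  have sub: "supp (scale c v) \<subseteq> supp v" for v :: "('a, 'b) series"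
    by (auto simp: supp_def scale.rep_eq)
  note N = noetherian_supp[of a] noetherian_supp[of b]
  show "scale c a * b = scale c (a * b)"
    by (rule series_eqI)
      (simp add: times_series_def scale.rep_eq coeff_cauchy_product[OF sub order_refl N]
        coeff_cauchy_product[OF order_refl order_refl N] sum_distrib_left split_beta mult_ac)
  show "a * scale c b = scale c (a * b)"
    by (rule series_eqI)
      (simp add: times_series_def scale.rep_eq coeff_cauchy_product[OF order_refl sub N]
        coeff_cauchy_product[OF order_refl order_refl N] sum_distrib_left split_beta mult_ac)
qed

definition summable_family :: "'i set \<Rightarrow> ('i \<Rightarrow> ('m::order, 'k::field) series) \<Rightarrow> bool" where
  "summable_family I f \<longleftrightarrow>
     noetherian (\<Union>i\<in>I. supp (f i)) \<and> (\<forall>p. finite {i \<in> I. p \<in> supp (f i)})"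

text \<open>Zero is a dummy value for non-summable families.\<close>

lift_definition family_sum :: "'i set \<Rightarrow> ('i \<Rightarrow> ('m::order, 'k::field) series) \<Rightarrow> ('m, 'k) series"
  is "\<lambda>I f p. if summable_family I f
        then \<Sum>i \<in> {i \<in> I. p \<in> supp (f i)}. coeff (f i) p else 0"
proof -
  fix I and f :: "'i \<Rightarrow> ('m, 'k) series"
  show "noetherian {p. (if summable_family I f
      then \<Sum>i \<in> {i \<in> I. p \<in> supp (f i)}. coeff (f i) p else 0) \<noteq> 0}"
  proof (cases "summable_family I f")
    case True
    have "{p. (\<Sum>i \<in> {i \<in> I. p \<in> supp (f i)}. coeff (f i) p) \<noteq> 0} \<subseteq> (\<Union>i\<in>I. supp (f i))"
    proof
      fix p assume "p \<in> {p. (\<Sum>i \<in> {i \<in> I. p \<in> supp (f i)}. coeff (f i) p) \<noteq> 0}"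
      then have "{i \<in> I. p \<in> supp (f i)} \<noteq> {}"
        by (intro notI) simp
      then show "p \<in> (\<Union>i\<in>I. supp (f i))" by blast
    qed
    with True show ?thesis by (auto simp: summable_family_def intro: noetherian_subset)
  qed (simp add: noetherian_finite)
qed

text \<open>Families are indexed by arbitrary sets, but a HOL definition cannot quantify over index types.
  Members equal to zero do not affect summability or sums, and in a summable family every
  non-zero member occurs only finitely often. Hence a family with values in a type \<open>'a\<close> can, after
  removing zeros, be reindexed by a set of pairs in \<open>'a \<times> nat\<close>. The definitions below therefore
  quantify over all index sets in such a type; that this covers families indexed by a set of any
  type is proved in \<open>strongly_linear_any_index\<close>, \<open>lin_summable_any_index\<close> and
  \<open>strongly_linear_lie_morphism_any_index\<close>.\<close>

definition strongly_linear :: "(('m::order, 'k::field) series \<Rightarrow> ('n::order, 'k) series) \<Rightarrow> bool" where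
  "strongly_linear \<phi> \<longleftrightarrow> Vector_Spaces.linear scale scale \<phi> \<and>
     (\<forall>(I :: (('m, 'k) series \<times> nat) set) v. summable_family I v \<longrightarrow>
        summable_family I (\<lambda>i. \<phi> (v i)) \<and> \<phi> (family_sum I v) = family_sum I (\<lambda>i. \<phi> (v i)))"

definition lin_summable :: "'j set \<Rightarrow> ('j \<Rightarrow> ('m::order, 'k::field) series \<Rightarrow> ('m, 'k) series) \<Rightarrow> bool" where
  "lin_summable J \<phi> \<longleftrightarrow> (\<forall>j\<in>J. strongly_linear (\<phi> j)) \<and>
     (\<forall>(I :: (('m, 'k) series \<times> nat) set) v. summable_family I v \<longrightarrow>
        summable_family (I \<times> J) (\<lambda>(i, j). \<phi> j (v i)))"

definition lin_sum :: "'j set \<Rightarrow> ('j \<Rightarrow> ('m::order, 'k::field) series \<Rightarrow> ('m, 'k) series)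
    \<Rightarrow> ('m, 'k) series \<Rightarrow> ('m, 'k) series" where
  "lin_sum J \<phi> = (\<lambda>v. family_sum J (\<lambda>j. \<phi> j v))"

definition prec :: "('m::order, 'k::field) series \<Rightarrow> ('m, 'k) series \<Rightarrow> bool"  (infix \<open>\<prec>\<close> 50) where
  "v \<prec> w \<longleftrightarrow> w \<noteq> 0 \<and> (\<forall>p \<in> supp v. \<exists>q \<in> supp w. p > q)"

definition contracting :: "(('m::order, 'k::field) series \<Rightarrow> ('m, 'k) series) \<Rightarrow> bool" where
  "contracting \<phi> \<longleftrightarrow> (\<forall>v. v \<noteq> 0 \<longrightarrow> \<phi> v \<prec> v)"

definition Der :: "(('m::po_monoid, 'k::field) series \<Rightarrow> ('m, 'k) series) set" where
  "Der = {\<delta>. strongly_linear \<delta> \<and> contracting \<delta> \<and> (\<forall>a b. \<delta> (a * b) = \<delta> a * b + a * \<delta> b)}"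

definition lie_bracket :: "(('m::order, 'k::field) series \<Rightarrow> ('m, 'k) series)
    \<Rightarrow> (('m, 'k) series \<Rightarrow> ('m, 'k) series) \<Rightarrow> ('m, 'k) series \<Rightarrow> ('m, 'k) series" where
  "lie_bracket \<delta>1 \<delta>2 = (\<lambda>v. \<delta>1 (\<delta>2 v) - \<delta>2 (\<delta>1 v))"

definition one_Aut :: "(('m::po_monoid, 'k::field) series \<Rightarrow> ('m, 'k) series) monoid" where
  "one_Aut = \<lparr>carrier = {\<sigma>. bij \<sigma> \<and> strongly_linear \<sigma> \<and> \<sigma> 1 = 1 \<and>
       (\<forall>a b. \<sigma> (a * b) = \<sigma> a * \<sigma> b) \<and> (\<forall>a. a \<noteq> 0 \<longrightarrow> \<sigma> a - a \<prec> a)},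
     mult = (\<circ>), one = id\<rparr>"

definition exp_der :: "(('m::po_monoid, 'k::field_char_0) series \<Rightarrow> ('m, 'k) series)
    \<Rightarrow> ('m, 'k) series \<Rightarrow> ('m, 'k) series" where
  "exp_der \<delta> = lin_sum UNIV (\<lambda>n v. scale (1 / fact n) ((\<delta> ^^ n) v))"

definition strongly_linear_lie_morphism ::
    "((('m::po_monoid, 'k::field) series \<Rightarrow> ('m, 'k) series)
       \<Rightarrow> (('n::po_monoid, 'k) series \<Rightarrow> ('n, 'k) series)) \<Rightarrow> bool" where
  "strongly_linear_lie_morphism \<Phi> \<longleftrightarrow>
     \<Phi> \<in> Der \<rightarrow> Der \<and>
     (\<forall>\<delta>1\<in>Der. \<forall>\<delta>2\<in>Der. \<Phi> (\<lambda>v. \<delta>1 v + \<delta>2 v) = (\<lambda>v. \<Phi> \<delta>1 v + \<Phi> \<delta>2 v)) \<and>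
     (\<forall>c. \<forall>\<delta>\<in>Der. \<Phi> (\<lambda>v. scale c (\<delta> v)) = (\<lambda>v. scale c (\<Phi> \<delta> v))) \<and>
     (\<forall>\<delta>1\<in>Der. \<forall>\<delta>2\<in>Der. \<Phi> (lie_bracket \<delta>1 \<delta>2) = lie_bracket (\<Phi> \<delta>1) (\<Phi> \<delta>2)) \<and>
     (\<forall>(J :: ((('m, 'k) series \<Rightarrow> ('m, 'k) series) \<times> nat) set) \<delta>.
        (\<forall>j\<in>J. \<delta> j \<in> Der) \<and> lin_summable J \<delta> \<longrightarrow>
        lin_summable J (\<lambda>j. \<Phi> (\<delta> j)) \<and> \<Phi> (lin_sum J \<delta>) = lin_sum J (\<lambda>j. \<Phi> (\<delta> j)))"

lemma summable_family_reindex: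
  assumes "inj_on g I"
  shows "summable_family (g ` I) f \<longleftrightarrow> summable_family I (\<lambda>i. f (g i))" (is "?L \<longleftrightarrow> ?R")
    and "family_sum (g ` I) f = family_sum I (\<lambda>i. f (g i))"
proof -
  have eq: "{j \<in> g ` I. p \<in> supp (f j)} = g ` {i \<in> I. p \<in> supp (f (g i))}" for p by auto
  have inj: "inj_on g {i \<in> I. p \<in> supp (f (g i))}" for p
    using assms by (rule inj_on_subset) auto
  show *: "?L \<longleftrightarrow> ?R"
    by (simp add: summable_family_def eq finite_image_iff[OF inj])
  show "family_sum (g ` I) f = family_sum I (\<lambda>i. f (g i))"
    by (rule series_eqI) (simp add: family_sum.rep_eq * eq sum.reindex[OF inj])
qed

lemma summable_family_cong:
  assumes "\<And>i. i \<in> I \<Longrightarrow> f i = g i"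
  shows "summable_family I f \<longleftrightarrow> summable_family I g" "family_sum I f = family_sum I g"
proof -
  have eq: "{i \<in> I. p \<in> supp (f i)} = {i \<in> I. p \<in> supp (g i)}" for p using assms by auto
  show *: "summable_family I f \<longleftrightarrow> summable_family I g"
    unfolding summable_family_def eq using assms by simp
  show "family_sum I f = family_sum I g"
    by (rule series_eqI) (simp add: family_sum.rep_eq * eq assms)
qed

lemma summable_family_drop_zero:
  assumes "I' \<subseteq> I" "\<And>i. i \<in> I - I' \<Longrightarrow> f i = 0"
  shows "summable_family I f \<longleftrightarrow> summable_family I' f" "family_sum I f = family_sum I' f"
proof -
  have eq: "{i \<in> I. p \<in> supp (f i)} = {i \<in> I'. p \<in> supp (f i)}" for p
    using assms by (auto, metis DiffI empty_iff supp_0)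
  have U: "(\<Union>i\<in>I. supp (f i)) = (\<Union>i\<in>I'. supp (f i))"
    using eq by auto
  show *: "summable_family I f \<longleftrightarrow> summable_family I' f"
    unfolding summable_family_def eq U ..
  show "family_sum I f = family_sum I' f"
    by (rule series_eqI) (simp add: family_sum.rep_eq * eq)
qed

lemma finite_fibres_reindex:
  fixes f :: "'i \<Rightarrow> 'a"
  assumes "\<And>i. i \<in> I \<Longrightarrow> finite {j \<in> I. f j = f i}"
  obtains g :: "'i \<Rightarrow> 'a \<times> nat" where "inj_on g I" "\<And>i. fst (g i) = f i"
proof -
  have "\<forall>a. \<exists>e :: 'i \<Rightarrow> nat. inj_on e {j \<in> I. f j = a}"
  proof
    fix a
    have "finite {j \<in> I. f j = a}"
    proof (cases "\<exists>i\<in>I. f i = a")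
      case True then show ?thesis using assms by auto
    next
      case False then have "{j \<in> I. f j = a} = {}" by auto
      then show ?thesis by (metis finite.emptyI)
    qed
    then show "\<exists>e :: 'i \<Rightarrow> nat. inj_on e {j \<in> I. f j = a}"
      using finite_imp_inj_to_nat_seg by blast
  qed
  then obtain e :: "'a \<Rightarrow> 'i \<Rightarrow> nat" where e: "\<And>a. inj_on (e a) {j \<in> I. f j = a}" by metis
  have "inj_on (\<lambda>i. (f i, e (f i) i)) I"
  proof (rule inj_onI)
    fix i j assume "i \<in> I" "j \<in> I" "(f i, e (f i) i) = (f j, e (f j) j)"
    then show "i = j" using e[of "f i"] by (auto simp: inj_on_def)
  qed
  then show thesis by (rule that) simp
qed

lemma supp_eq_empty_iff: "supp v = {} \<longleftrightarrow> v = (0 :: ('m::order, 'k::ab_group_add) series)"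
proof
  assume "supp v = {}"
  then show "v = 0" by (intro series_eqI) (auto simp: supp_def zero_series.rep_eq)
qed simp

lemma summable_family_finite_fibre:
  assumes "summable_family I f" "x \<noteq> 0"
  shows "finite {i \<in> I. f i = x}"
proof -
  obtain p where "p \<in> supp x" using assms(2) supp_eq_empty_iff by blast
  then have "{i \<in> I. f i = x} \<subseteq> {i \<in> I. p \<in> supp (f i)}" by auto
  then show ?thesis using assms(1) unfolding summable_family_def by (meson finite_subset)
qed

lemma summable_family_nonzero_reindex:
  assumes "summable_family I f"
  obtains g :: "'i \<Rightarrow> ('m::order, 'k::field) series \<times> nat"
  where "inj_on g {i \<in> I. f i \<noteq> 0}" "\<And>i. fst (g i) = f i"
    "summable_family (g ` {i \<in> I. f i \<noteq> 0}) fst" "family_sum (g ` {i \<in> I. f i \<noteq> 0}) fst = family_sum I f"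
proof -
  let ?I = "{i \<in> I. f i \<noteq> 0}"
  have fin: "finite {j \<in> ?I. f j = f i}" if "i \<in> ?I" for i
  proof (rule finite_subset)
    show "{j \<in> ?I. f j = f i} \<subseteq> {j \<in> I. f j = f i}" by auto
    show "finite {j \<in> I. f j = f i}" using summable_family_finite_fibre[OF assms, of "f i"] that by simp
  qed
  obtain g :: "'i \<Rightarrow> ('m, 'k) series \<times> nat" where g: "inj_on g ?I" "\<And>i. fst (g i) = f i"
    by (rule finite_fibres_reindex[OF fin]) (assumption, erule that, simp)
  have z: "summable_family I f \<longleftrightarrow> summable_family ?I f" "family_sum I f = family_sum ?I f"
    by (rule summable_family_drop_zero; auto)+
  show thesis
    by (rule that[of g]) (use g z assms summable_family_reindex[OF g(1), of fst] in auto)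
qed

lemma strongly_linear_zero: "strongly_linear \<phi> \<Longrightarrow> \<phi> 0 = 0"
  unfolding strongly_linear_def Vector_Spaces.linear_def by (blast intro: module_hom.zero)

lemma strongly_linear_any_index:
  fixes \<phi> :: "('m::order, 'k::field) series \<Rightarrow> ('n::order, 'k) series" and I :: "'i set"
  assumes "strongly_linear \<phi>" "summable_family I v"
  shows "summable_family I (\<lambda>i. \<phi> (v i))" "\<phi> (family_sum I v) = family_sum I (\<lambda>i. \<phi> (v i))"
proof -
  let ?I = "{i \<in> I. v i \<noteq> 0}"
  obtain g :: "'i \<Rightarrow> ('m, 'k) series \<times> nat" where g: "inj_on g ?I" "\<And>i. fst (g i) = v i"
    "summable_family (g ` ?I) fst" "family_sum (g ` ?I) fst = family_sum I v"
    using summable_family_nonzero_reindex[OF assms(2)] by blast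
  have *: "summable_family (g ` ?I) (\<lambda>x. \<phi> (fst x))"
    "\<phi> (family_sum (g ` ?I) fst) = family_sum (g ` ?I) (\<lambda>x. \<phi> (fst x))"
    using assms(1) g(3) unfolding strongly_linear_def by blast+
  have z: "summable_family I (\<lambda>i. \<phi> (v i)) \<longleftrightarrow> summable_family ?I (\<lambda>i. \<phi> (v i))"
    "family_sum I (\<lambda>i. \<phi> (v i)) = family_sum ?I (\<lambda>i. \<phi> (v i))"
    by (rule summable_family_drop_zero; auto simp: strongly_linear_zero[OF assms(1)])+
  show "summable_family I (\<lambda>i. \<phi> (v i))" "\<phi> (family_sum I v) = family_sum I (\<lambda>i. \<phi> (v i))"
    using * z summable_family_reindex[OF g(1), of "\<lambda>x. \<phi> (fst x)"] g(2,4) by simp_all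
qed

lemma lin_summable_any_index:
  fixes \<phi> :: "'j \<Rightarrow> ('m::order, 'k::field) series \<Rightarrow> ('m, 'k) series" and I :: "'i set"
  assumes "lin_summable J \<phi>" "summable_family I v"
  shows "summable_family (I \<times> J) (\<lambda>(i, j). \<phi> j (v i))"
proof -
  let ?I = "{i \<in> I. v i \<noteq> 0}"
  obtain g :: "'i \<Rightarrow> ('m, 'k) series \<times> nat" where g: "inj_on g ?I" "\<And>i. fst (g i) = v i"
    "summable_family (g ` ?I) fst"
    using summable_family_nonzero_reindex[OF assms(2)] by blast
  have "summable_family (g ` ?I \<times> J) (\<lambda>(x, j). \<phi> j (fst x))"
    using assms(1) g(3) unfolding lin_summable_def by blast
  moreover have "g ` ?I \<times> J = map_prod g id ` (?I \<times> J)" by force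
  moreover have "inj_on (map_prod g id) (?I \<times> J)" using g(1) by (auto simp: inj_on_def)
  ultimately have "summable_family (?I \<times> J) (\<lambda>(i, j). \<phi> j (v i))"
    by (simp add: summable_family_reindex(1) g(2) case_prod_unfold)
  moreover have "summable_family (I \<times> J) (\<lambda>(i, j). \<phi> j (v i)) \<longleftrightarrow>
      summable_family (?I \<times> J) (\<lambda>(i, j). \<phi> j (v i))"
    by (rule summable_family_drop_zero)
      (use assms(1) in \<open>auto simp: lin_summable_def strongly_linear_zero\<close>)
  ultimately show ?thesis by simp
qed

lemma lin_summable_pointwise:
  fixes \<phi> :: "'j \<Rightarrow> ('m::order, 'k::field) series \<Rightarrow> ('m, 'k) series"
  assumes "lin_summable J \<phi>"
  shows "summable_family J (\<lambda>j. \<phi> j v)"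
proof -
  have "summable_family {()} (\<lambda>_. v)"
    by (simp add: summable_family_def noetherian_supp)
  from lin_summable_any_index[OF assms this]
  have "summable_family (Pair () ` J) (\<lambda>(i, j). \<phi> j v)"
    by (rule back_subst[where P = "\<lambda>X. summable_family X (\<lambda>(i, j). \<phi> j v)"]) auto
  then show ?thesis by (subst (asm) summable_family_reindex(1)) (auto simp: inj_on_def)
qed

lemma lin_summable_reindex:
  assumes "inj_on g J"
  shows "lin_summable (g ` J) \<phi> \<longleftrightarrow> lin_summable J (\<lambda>j. \<phi> (g j))"
    and "lin_sum (g ` J) \<phi> = lin_sum J (\<lambda>j. \<phi> (g j))"
proof -
  have eq: "I \<times> g ` J = map_prod id g ` (I \<times> J)" for I by force
  have inj: "inj_on (map_prod id g) (I \<times> J)" for I using assms by (auto simp: inj_on_def)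
  show "lin_summable (g ` J) \<phi> \<longleftrightarrow> lin_summable J (\<lambda>j. \<phi> (g j))"
    unfolding lin_summable_def eq summable_family_reindex(1)[OF inj] by (simp add: case_prod_unfold)
  show "lin_sum (g ` J) \<phi> = lin_sum J (\<lambda>j. \<phi> (g j))"
    unfolding lin_sum_def summable_family_reindex(2)[OF assms] ..
qed

lemma zero_in_Der: "(\<lambda>_. 0) \<in> Der"
proof -
  have "strongly_linear (\<lambda>_ :: ('a, 'b) series. 0 :: ('a, 'b) series)"
    unfolding strongly_linear_def
  proof (intro conjI allI impI)
    show "Vector_Spaces.linear scale scale (\<lambda>_ :: ('a, 'b) series. 0 :: ('a, 'b) series)"
      by unfold_locales (simp_all add: series.scale_zero_right)
    show "summable_family I (\<lambda>i. 0)" for I :: "(('a, 'b) series \<times> nat) set"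
      by (simp add: summable_family_def noetherian_finite)
    show "0 = family_sum I (\<lambda>i. 0)" for I :: "(('a, 'b) series \<times> nat) set"
      by (rule series_eqI) (simp add: family_sum.rep_eq zero_series.rep_eq)
  qed
  then show ?thesis by (simp add: Der_def contracting_def prec_def)
qed

lemma lin_summable_drop_zero:
  assumes "J' \<subseteq> J" "\<And>j. j \<in> J - J' \<Longrightarrow> \<phi> j = (\<lambda>_. 0)"
  shows "lin_summable J \<phi> \<longleftrightarrow> lin_summable J' (\<phi> :: 'j \<Rightarrow> ('m::po_monoid, 'k::field) series \<Rightarrow> _)"
    and "lin_sum J \<phi> = lin_sum J' \<phi>"
proof -
  have z: "\<phi> j v = 0" if "j \<in> J" "j \<notin> J'" for j v using assms(2)[of j] that by simp
  have "(\<forall>j\<in>J. strongly_linear (\<phi> j)) \<longleftrightarrow> (\<forall>j\<in>J'. strongly_linear (\<phi> j))"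
    using assms zero_in_Der by (auto simp: Der_def)
  moreover have "summable_family (I \<times> J) (\<lambda>(i, j). \<phi> j (v i)) \<longleftrightarrow>
      summable_family (I \<times> J') (\<lambda>(i, j). \<phi> j (v i))" for I :: "(('m, 'k) series \<times> nat) set" and v
    by (rule summable_family_drop_zero) (use assms(1) z in auto)
  ultimately show "lin_summable J \<phi> \<longleftrightarrow> lin_summable J' \<phi>" unfolding lin_summable_def by simp
  show "lin_sum J \<phi> = lin_sum J' \<phi>"
    unfolding lin_sum_def by (rule ext, rule summable_family_drop_zero) (use assms in auto)
qed

lemma strongly_linear_lie_morphism_any_index:
  fixes \<Phi> :: "(('m::po_monoid, 'k::field) series \<Rightarrow> ('m, 'k) series)
       \<Rightarrow> (('n::po_monoid, 'k) series \<Rightarrow> ('n, 'k) series)" and J :: "'j set"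
  assumes \<Phi>: "strongly_linear_lie_morphism \<Phi>"
    and \<delta>: "\<forall>j\<in>J. \<delta> j \<in> Der" "lin_summable J \<delta>"
  shows "lin_summable J (\<lambda>j. \<Phi> (\<delta> j))" "\<Phi> (lin_sum J \<delta>) = lin_sum J (\<lambda>j. \<Phi> (\<delta> j))"
proof -
  let ?J = "{j \<in> J. \<delta> j \<noteq> (\<lambda>_. 0)}"
  have fin: "finite {j \<in> ?J. \<delta> j = \<delta> i}" if i: "i \<in> ?J" for i
  proof -
    obtain v where v: "\<delta> i v \<noteq> 0" using i by fastforce
    have "{j \<in> ?J. \<delta> j = \<delta> i} \<subseteq> {j \<in> J. \<delta> j v = \<delta> i v}" by auto
    then show ?thesis
      using summable_family_finite_fibre[OF lin_summable_pointwise[OF \<delta>(2)] v] finite_subset by blast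
  qed
  obtain g :: "'j \<Rightarrow> (('m, 'k) series \<Rightarrow> ('m, 'k) series) \<times> nat"
    where g: "inj_on g ?J" "\<And>j. fst (g j) = \<delta> j"
    by (rule finite_fibres_reindex[OF fin]) (assumption, erule that, simp)
  have z: "lin_summable J \<delta> \<longleftrightarrow> lin_summable ?J \<delta>" "lin_sum J \<delta> = lin_sum ?J \<delta>"
    by (rule lin_summable_drop_zero; auto)+
  have s: "lin_summable (g ` ?J) fst" "lin_sum (g ` ?J) fst = lin_sum J \<delta>"
    using \<delta>(2) z lin_summable_reindex[OF g(1), of fst] g(2) by simp_all
  have d: "\<forall>x \<in> g ` ?J. fst x \<in> Der" using \<delta>(1) g(2) by auto
  note \<Phi>' = \<Phi>[unfolded strongly_linear_lie_morphism_def, THEN conjunct2, THEN conjunct2]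
  have *: "lin_summable (g ` ?J) (\<lambda>x. \<Phi> (fst x))"
    "\<Phi> (lin_sum (g ` ?J) fst) = lin_sum (g ` ?J) (\<lambda>x. \<Phi> (fst x))"
    using \<Phi>'[THEN conjunct2, THEN conjunct2, THEN spec, THEN spec, THEN mp, OF conjI[OF d s(1)]]
    by simp_all
  have "\<Phi> (\<lambda>v. scale 0 ((\<lambda>_. 0) v)) = (\<lambda>v. scale 0 (\<Phi> (\<lambda>_. 0) v))"
    using \<Phi>'[THEN conjunct1, THEN spec, THEN bspec, OF zero_in_Der] .
  then have \<Phi>0: "\<Phi> (\<lambda>_. 0) = (\<lambda>_. 0)" by simp
  have z': "lin_summable J (\<lambda>j. \<Phi> (\<delta> j)) \<longleftrightarrow> lin_summable ?J (\<lambda>j. \<Phi> (\<delta> j))"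
    "lin_sum J (\<lambda>j. \<Phi> (\<delta> j)) = lin_sum ?J (\<lambda>j. \<Phi> (\<delta> j))"
    by (rule lin_summable_drop_zero; auto simp: \<Phi>0)+
  show "lin_summable J (\<lambda>j. \<Phi> (\<delta> j))" "\<Phi> (lin_sum J \<delta>) = lin_sum J (\<lambda>j. \<Phi> (\<delta> j))"
    using * z' s(2) lin_summable_reindex[OF g(1), of "\<lambda>x. \<Phi> (fst x)"] g(2) by simp_all
qed

end

theory Submission
  imports Defs "HOL-Computational_Algebra.Formal_Power_Series" "HOL-Computational_Algebra.Polynomial"
begin

text \<open>A contracting strongly linear map \<open>D\<close> may be substituted into any power series with coefficients in
the field, and substitution respects products and composition of power series. Hence the series of
\<open>exp\<close> and \<open>log(1 + x)\<close> give mutually inverse maps between the contracting derivations and the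
group of automorphisms (\<open>log_exp_op\<close>, \<open>exp_log_op\<close>, \<open>derivation_log_op\<close>, \<open>exp_op_in_one_Aut\<close>).
A map with the required property can therefore only be \<open>\<Psi> \<sigma> = exp (\<Phi> (log \<sigma>))\<close>. This map is
multiplicative by the Baker-Campbell-Hausdorff theorem: \<open>exp X * exp Y = exp (Z\<^sub>1 + Z\<^sub>2 + \<dots>)\<close>, where
\<open>Z\<^sub>n\<close> is a Lie polynomial in \<open>X\<close> and \<open>Y\<close>, the same one in every Lie algebra; \<open>\<Phi>\<close> commutes with Lie
polynomials, and by strong linearity with the infinite sum.

Two things have to be made precise: convergence and the Lie property of \<open>Z\<^sub>n\<close>.

Convergence rests on one combinatorial fact. If \<open>(U\<^sub>n)\<close> is a summable family of contracting maps, then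
the products \<open>U\<^sub>i U\<^sub>j \<dots> U\<^sub>l\<close> of any length form a summable family as well
(\<open>noetherian_walks\<close>, \<open>finite_walks\<close>, \<open>esummable_fps_powers\<close>). The reason is that a strongly linear map
sends a monomial to a Noetherian set of monomials, strictly larger ones if the map is contracting;
the monomials reachable in finitely many such steps from a Noetherian set still form a Noetherian
set, by a minimal bad sequence argument. Given this, all identities are proved for formal power
series in a central variable \<open>t\<close> over the ring of strongly linear maps, where sums are locally
finite, and transported by the evaluation \<open>t = 1\<close> (\<open>eval_mult\<close>, \<open>eval_subst\<close>).

Lie polynomials never appear explicitly. The series \<open>Z = log (exp (t X) exp (t Y))\<close> converges
at \<open>t = 1\<close> because it is obtained by substitution. Differentiating \<open>exp Z = exp (t X) exp (t Y)\<close> with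
respect to \<open>t\<close> gives a recursion that expresses the coefficients of \<open>Z\<close> by scalars and iterated
brackets (\<open>bch_recursion\<close>). It shows by induction that the coefficients for \<open>(X, Y)\<close> and for
\<open>(X', Y')\<close> are related by every relation that relates \<open>X\<close> to \<open>X'\<close> and \<open>Y\<close> to \<open>Y'\<close> and is compatible
with the Lie algebra operations (\<open>lie_relation.bch_nth\<close>). The graph of \<open>\<Phi>\<close> is such a relation.\<close>

hide_const (open) Polynomial.coeff

unbundle fps_syntax

section \<open>Summable families of series\<close>

lemma coeff_zero_series [simp]: "coeff 0 p = 0"
  by (simp add: zero_series.rep_eq)

lemma coeff_sum: "coeff (sum f K) p = (\<Sum>i\<in>K. coeff (f i) p)"
  by (induction K rule: infinite_finite_induct) (simp_all add: plus_series.rep_eq)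

lemma coeff_eq_0_iff: "coeff v p = 0 \<longleftrightarrow> p \<notin> supp v"
  by (simp add: supp_def)

lemma supp_sum: "supp (sum f K) \<subseteq> (\<Union>i\<in>K. supp (f i))"
  by (auto simp: supp_def coeff_sum elim: sum.not_neutral_contains_not_neutral)

lemma supp_scale: "supp (scale c v) \<subseteq> supp v"
  by (auto simp: supp_def scale.rep_eq)

lemma summable_familyI:
  assumes "noetherian P" "\<And>i. i \<in> I \<Longrightarrow> supp (f i) \<subseteq> P" "\<And>p. p \<in> P \<Longrightarrow> finite {i \<in> I. p \<in> supp (f i)}"
  shows "summable_family I f"
proof -
  have "finite {i \<in> I. p \<in> supp (f i)}" for p
  proof (cases "p \<in> P")
    case False
    then have "{i \<in> I. p \<in> supp (f i)} = {}" using assms(2) by auto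
    then show ?thesis by (simp only: finite.emptyI)
  qed (rule assms(3))
  moreover have "noetherian (\<Union>i\<in>I. supp (f i))"
    by (rule noetherian_subset[OF assms(1)]) (use assms(2) in auto)
  ultimately show ?thesis by (simp add: summable_family_def)
qed

lemma summable_family_finite_at:
  "summable_family I f \<Longrightarrow> finite {i \<in> I. p \<in> supp (f i)}"
  by (simp add: summable_family_def)

lemma coeff_family_sum:
  assumes "summable_family I f" "finite K" "K \<subseteq> I" "{i \<in> I. p \<in> supp (f i)} \<subseteq> K"
  shows "coeff (family_sum I f) p = (\<Sum>i\<in>K. coeff (f i) p)"
proof -
  have "coeff (family_sum I f) p = (\<Sum>i \<in> {i \<in> I. p \<in> supp (f i)}. coeff (f i) p)"
    using assms(1) by (simp add: family_sum.rep_eq)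
  also have "\<dots> = (\<Sum>i\<in>K. coeff (f i) p)"
    by (rule sum.mono_neutral_left) (use assms(2-4) in \<open>auto simp: coeff_eq_0_iff\<close>)
  finally show ?thesis .
qed

lemma supp_family_sum: "supp (family_sum I f) \<subseteq> (\<Union>i\<in>I. supp (f i))"
proof
  fix p assume p: "p \<in> supp (family_sum I f)"
  then have "(\<Sum>i \<in> {i \<in> I. p \<in> supp (f i)}. coeff (f i) p) \<noteq> 0"
    by (auto simp: supp_def family_sum.rep_eq split: if_splits)
  then have "{i \<in> I. p \<in> supp (f i)} \<noteq> {}" by (metis sum.empty)
  then show "p \<in> (\<Union>i\<in>I. supp (f i))" by blast
qed

lemma summable_family_finite: "finite I \<Longrightarrow> summable_family I f"
proof (rule summable_familyI)
  assume "finite I"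
  then show "noetherian (\<Union>i\<in>I. supp (f i))"
    by (induction I) (auto simp: noetherian_finite intro: noetherian_Un noetherian_supp)
qed auto

lemma family_sum_finite: "finite I \<Longrightarrow> family_sum I f = sum f I"
  by (rule series_eqI) (auto simp: coeff_sum intro!: coeff_family_sum summable_family_finite)

lemma summable_family_dominated:
  assumes "summable_family I f" "J \<subseteq> I" "\<And>i. i \<in> J \<Longrightarrow> supp (g i) \<subseteq> supp (f i)"
  shows "summable_family J g"
proof (rule summable_familyI)
  show "noetherian (\<Union>i\<in>I. supp (f i))" using assms(1) by (simp add: summable_family_def)
  show "supp (g i) \<subseteq> (\<Union>i\<in>I. supp (f i))" if "i \<in> J" for i using assms that by auto
  show "finite {i \<in> J. p \<in> supp (g i)}" for p
    by (rule finite_subset[OF _ summable_family_finite_at[OF assms(1), of p]]) (use assms(2,3) in auto)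
qed

lemma summable_family_subset: "summable_family I f \<Longrightarrow> J \<subseteq> I \<Longrightarrow> summable_family J f"
  by (rule summable_family_dominated) auto

lemma summable_family_add:
  assumes "summable_family I f" "summable_family I g"
  shows "summable_family I (\<lambda>i. f i + g i)"
    and "family_sum I (\<lambda>i. f i + g i) = family_sum I f + family_sum I g"
proof -
  have sub: "{i \<in> I. p \<in> supp (f i + g i)} \<subseteq> {i \<in> I. p \<in> supp (f i)} \<union> {i \<in> I. p \<in> supp (g i)}" for p
    using supp_add by blast
  note fin = finite_UnI[OF summable_family_finite_at[OF assms(1)] summable_family_finite_at[OF assms(2)]]
  show *: "summable_family I (\<lambda>i. f i + g i)"
  proof (rule summable_familyI)
    show "noetherian ((\<Union>i\<in>I. supp (f i)) \<union> (\<Union>i\<in>I. supp (g i)))"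
      using assms by (auto simp: summable_family_def intro: noetherian_Un)
    show "supp (f i + g i) \<subseteq> (\<Union>i\<in>I. supp (f i)) \<union> (\<Union>i\<in>I. supp (g i))" if "i \<in> I" for i
      using supp_add[of "f i" "g i"] that by auto
    show "finite {i \<in> I. p \<in> supp (f i + g i)}" for p
      by (rule finite_subset[OF sub fin])
  qed
  show "family_sum I (\<lambda>i. f i + g i) = family_sum I f + family_sum I g"
  proof (rule series_eqI)
    fix p
    let ?K = "{i \<in> I. p \<in> supp (f i)} \<union> {i \<in> I. p \<in> supp (g i)}"
    have "coeff (family_sum I h) p = (\<Sum>i\<in>?K. coeff (h i) p)"
      if "summable_family I h" "{i \<in> I. p \<in> supp (h i)} \<subseteq> ?K" for h :: "'a \<Rightarrow> ('b, 'c) series"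
      using that by (intro coeff_family_sum fin) auto
    from this[OF * sub] this[OF assms(1)] this[OF assms(2)]
    show "coeff (family_sum I (\<lambda>i. f i + g i)) p = coeff (family_sum I f + family_sum I g) p"
      by (simp add: plus_series.rep_eq sum.distrib)
  qed
qed

lemma family_sum_scale:
  assumes "summable_family I f"
  shows "family_sum I (\<lambda>i. scale c (f i)) = scale c (family_sum I f)"
proof (rule series_eqI)
  fix p
  let ?K = "{i \<in> I. p \<in> supp (f i)}"
  note fin = summable_family_finite_at[OF assms, of p]
  have "summable_family I (\<lambda>i. scale c (f i))"
    by (rule summable_family_dominated[OF assms]) (simp_all add: supp_scale)
  then have "coeff (family_sum I (\<lambda>i. scale c (f i))) p = (\<Sum>i\<in>?K. coeff (scale c (f i)) p)"
    by (rule coeff_family_sum) (use fin supp_scale in blast)+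
  also have "\<dots> = coeff (scale c (family_sum I f)) p"
    by (simp add: scale.rep_eq coeff_family_sum[OF assms fin] sum_distrib_left)
  finally show "coeff (family_sum I (\<lambda>i. scale c (f i))) p = coeff (scale c (family_sum I f)) p" .
qed

text \<open>Associativity of summation, for an arbitrary partition of the index set into the fibres of a
  map. Fubini's theorem for families over a product is the case of the two projections.\<close>

lemma family_sum_group:
  assumes "summable_family K f" "g ` K \<subseteq> L"
  shows "summable_family {k \<in> K. g k = l} f"
    and "summable_family L (\<lambda>l. family_sum {k \<in> K. g k = l} f)"
    and "family_sum L (\<lambda>l. family_sum {k \<in> K. g k = l} f) = family_sum K f"
proof -
  show fib: "summable_family {k \<in> K. g k = l} f" for l
    by (rule summable_family_subset[OF assms(1)]) auto
  let ?K = "\<lambda>p. {k \<in> K. p \<in> supp (f k)}"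
  have fin: "finite (?K p)" for p by (rule summable_family_finite_at[OF assms(1)])
  have sub: "{l \<in> L. p \<in> supp (family_sum {k \<in> K. g k = l} f)} \<subseteq> g ` ?K p" for p
    using supp_family_sum[of "{k \<in> K. g k = l}" f for l] by blast
  show *: "summable_family L (\<lambda>l. family_sum {k \<in> K. g k = l} f)"
  proof (rule summable_familyI)
    show "noetherian (\<Union>k\<in>K. supp (f k))" using assms(1) by (simp add: summable_family_def)
    show "supp (family_sum {k \<in> K. g k = l} f) \<subseteq> (\<Union>k\<in>K. supp (f k))" for l
      using supp_family_sum[of "{k \<in> K. g k = l}" f] by blast
    show "finite {l \<in> L. p \<in> supp (family_sum {k \<in> K. g k = l} f)}" for p
      by (rule finite_subset[OF sub]) (simp add: fin)
  qed
  show "family_sum L (\<lambda>l. family_sum {k \<in> K. g k = l} f) = family_sum K f"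
  proof (rule series_eqI)
    fix p
    have inner: "coeff (family_sum {k \<in> K. g k = l} f) p = (\<Sum>k\<in>{k \<in> ?K p. g k = l}. coeff (f k) p)" for l
      by (rule coeff_family_sum[OF fib]) (auto intro: finite_subset[OF _ fin[of p]])
    have "coeff (family_sum L (\<lambda>l. family_sum {k \<in> K. g k = l} f)) p =
        (\<Sum>l\<in>g ` ?K p. \<Sum>k\<in>{k \<in> ?K p. g k = l}. coeff (f k) p)"
      by (subst coeff_family_sum[OF * _ _ sub]) (use fin assms(2) in \<open>auto simp: inner\<close>)
    also have "\<dots> = (\<Sum>k\<in>?K p. coeff (f k) p)"
      by (rule sum.group) (simp_all add: fin)
    also have "\<dots> = coeff (family_sum K f) p"
      using fin[of p] by (intro coeff_family_sum[OF assms(1), symmetric]) auto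
    finally show "coeff (family_sum L (\<lambda>l. family_sum {k \<in> K. g k = l} f)) p = coeff (family_sum K f) p" .
  qed
qed

lemma family_sum_Times:
  assumes "summable_family (I \<times> J) f"
  shows "summable_family I (\<lambda>i. family_sum J (\<lambda>j. f (i, j)))"
    and "family_sum I (\<lambda>i. family_sum J (\<lambda>j. f (i, j))) = family_sum (I \<times> J) f"
proof -
  have "family_sum {k \<in> I \<times> J. fst k = i} f = family_sum J (\<lambda>j. f (i, j))" if "i \<in> I" for i
  proof -
    have "{k \<in> I \<times> J. fst k = i} = Pair i ` J" using that by auto
    then show ?thesis by (simp add: summable_family_reindex(2) inj_on_def)
  qed
  note eq = summable_family_cong[OF this, of I "\<lambda>i. i"]
  have "fst ` (I \<times> J) \<subseteq> I" by auto
  note g = family_sum_group(2,3)[OF assms this]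
  show "summable_family I (\<lambda>i. family_sum J (\<lambda>j. f (i, j)))"
    "family_sum I (\<lambda>i. family_sum J (\<lambda>j. f (i, j))) = family_sum (I \<times> J) f"
    using g by (simp_all add: eq)
qed

lemma summable_family_swap:
  "summable_family (I \<times> J) f \<longleftrightarrow> summable_family (J \<times> I) (\<lambda>(j, i). f (i, j))"
  "family_sum (I \<times> J) f = family_sum (J \<times> I) (\<lambda>(j, i). f (i, j))"
proof -
  have "I \<times> J = prod.swap ` (J \<times> I)" by auto
  moreover have "inj_on prod.swap (J \<times> I)" by simp
  ultimately show "summable_family (I \<times> J) f \<longleftrightarrow> summable_family (J \<times> I) (\<lambda>(j, i). f (i, j))"
    "family_sum (I \<times> J) f = family_sum (J \<times> I) (\<lambda>(j, i). f (i, j))"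
    using summable_family_reindex[of prod.swap "J \<times> I" f] by (simp_all add: case_prod_unfold prod.swap_def)
qed

text \<open>A given exponent has finitely many decompositions into a member of one Noetherian set and a member
of another, so every coefficient of the double family is a finite computation.\<close>

lemma summable_family_mult:
  fixes f :: "'i \<Rightarrow> ('m::po_monoid, 'k::field) series"
  assumes "summable_family I f" "summable_family J g"
  shows "summable_family (I \<times> J) (\<lambda>(i, j). f i * g j)"
    and "family_sum (I \<times> J) (\<lambda>(i, j). f i * g j) = family_sum I f * family_sum J g"
proof -
  define P Q where "P = (\<Union>i\<in>I. supp (f i))" and "Q = (\<Union>j\<in>J. supp (g j))"
  have N: "noetherian P" "noetherian Q" using assms by (simp_all add: P_def Q_def summable_family_def)
  define D where "D m = {(x, y). x \<in> P \<and> y \<in> Q \<and> x + y = m}" for m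
  have finD: "finite (D m)" for m unfolding D_def by (rule noetherian_finite_decompositions[OF N])
  define If where "If m = (\<Union>(x, y)\<in>D m. {i \<in> I. x \<in> supp (f i)})" for m
  define Jf where "Jf m = (\<Union>(x, y)\<in>D m. {j \<in> J. y \<in> supp (g j)})" for m
  have fin: "finite (If m)" "finite (Jf m)" for m
    unfolding If_def Jf_def using finD assms by (auto simp: summable_family_def)
  have sI: "supp (f i) \<subseteq> P" if "i \<in> I" for i using that by (auto simp: P_def)
  have sJ: "supp (g j) \<subseteq> Q" if "j \<in> J" for j using that by (auto simp: Q_def)
  have prod: "supp (a * b) \<subseteq> {x + y | x y. x \<in> supp a \<and> y \<in> supp b}" for a b :: "('m, 'k) series"
    unfolding times_series_def by (rule supp_cauchy_product)
  have sub: "{k \<in> I \<times> J. m \<in> supp (case k of (i, j) \<Rightarrow> f i * g j)} \<subseteq> If m \<times> Jf m" for m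
  proof clarify
    fix i j assume ij: "i \<in> I" "j \<in> J" "m \<in> supp (f i * g j)"
    then obtain x y where "m = x + y" "x \<in> supp (f i)" "y \<in> supp (g j)"
      using prod by blast
    then have "(x, y) \<in> D m" "x \<in> supp (f i)" "y \<in> supp (g j)" using sI sJ ij by (auto simp: D_def)
    then show "i \<in> If m \<and> j \<in> Jf m" using ij by (auto simp: If_def Jf_def)
  qed
  show *: "summable_family (I \<times> J) (\<lambda>(i, j). f i * g j)"
  proof (rule summable_familyI)
    show "noetherian {x + y | x y. x \<in> P \<and> y \<in> Q}" by (rule noetherian_sum_set[OF N])
    show "supp (case k of (i, j) \<Rightarrow> f i * g j) \<subseteq> {x + y | x y. x \<in> P \<and> y \<in> Q}" if "k \<in> I \<times> J" for k
      using that prod sI sJ by fastforce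
    show "finite {k \<in> I \<times> J. m \<in> supp (case k of (i, j) \<Rightarrow> f i * g j)}" for m
      by (rule finite_subset[OF sub]) (simp add: fin)
  qed
  show "family_sum (I \<times> J) (\<lambda>(i, j). f i * g j) = family_sum I f * family_sum J g"
  proof (rule series_eqI)
    fix m
    have IJ: "If m \<subseteq> I" "Jf m \<subseteq> J" by (auto simp: If_def Jf_def)
    have cf: "coeff (family_sum I f) x = (\<Sum>i\<in>If m. coeff (f i) x)"
      and cg: "coeff (family_sum J g) y = (\<Sum>j\<in>Jf m. coeff (g j) y)" if "(x, y) \<in> D m" for x y
      using that by (auto intro!: coeff_family_sum assms fin IJ) (auto simp: If_def Jf_def)
    have coeff_mult: "coeff (f i * g j) m = (\<Sum>(x, y)\<in>D m. coeff (f i) x * coeff (g j) y)"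
      if "i \<in> If m" "j \<in> Jf m" for i j
      unfolding times_series_def D_def
      by (rule coeff_cauchy_product[OF sI sJ N]) (use that IJ in blast)+
    have "coeff (family_sum I f * family_sum J g) m =
        (\<Sum>(x, y)\<in>D m. coeff (family_sum I f) x * coeff (family_sum J g) y)"
      unfolding times_series_def D_def using supp_family_sum[of I f] supp_family_sum[of J g]
      by (intro coeff_cauchy_product N) (simp_all add: P_def Q_def)
    also have "\<dots> = (\<Sum>(x, y)\<in>D m. \<Sum>(i, j)\<in>If m \<times> Jf m. coeff (f i) x * coeff (g j) y)"
      by (rule sum.cong) (auto simp: cf cg sum_product sum.cartesian_product)
    also have "\<dots> = (\<Sum>(i, j)\<in>If m \<times> Jf m. \<Sum>(x, y)\<in>D m. coeff (f i) x * coeff (g j) y)"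
      unfolding case_prod_unfold by (rule sum.swap)
    also have "\<dots> = (\<Sum>(i, j)\<in>If m \<times> Jf m. coeff (f i * g j) m)"
      by (intro sum.cong refl) (auto simp: coeff_mult)
    also have "\<dots> = coeff (family_sum (I \<times> J) (\<lambda>(i, j). f i * g j)) m"
      using IJ by (subst coeff_family_sum[OF * _ _ sub]) (auto simp: fin case_prod_unfold)
    finally show "coeff (family_sum (I \<times> J) (\<lambda>(i, j). f i * g j)) m = coeff (family_sum I f * family_sum J g) m"
      by simp
  qed
qed

section \<open>The ring of strongly linear endomorphisms\<close>

lemma strongly_linearI:
  assumes "\<And>v w. \<phi> (v + w) = \<phi> v + \<phi> w" "\<And>c v. \<phi> (scale c v) = scale c (\<phi> v)"
    and "\<And>(I :: (('m::order, 'k::field) series \<times> nat) set) v. summable_family I v \<Longrightarrow>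
      summable_family I (\<lambda>i. \<phi> (v i)) \<and> \<phi> (family_sum I v) = family_sum I (\<lambda>i. \<phi> (v i))"
  shows "strongly_linear (\<phi> :: ('m, 'k) series \<Rightarrow> ('n::order, 'k) series)"
proof -
  have "Vector_Spaces.linear scale scale \<phi>" by unfold_locales (rule assms)+
  then show ?thesis using assms(3) unfolding strongly_linear_def by blast
qed

lemma strongly_linear_add: "strongly_linear \<phi> \<Longrightarrow> \<phi> (v + w) = \<phi> v + \<phi> w"
  and strongly_linear_scale: "strongly_linear \<phi> \<Longrightarrow> \<phi> (scale c v) = scale c (\<phi> v)"
  unfolding strongly_linear_def Vector_Spaces.linear_def
  by (blast intro: module_hom.add module_hom.scale)+

text \<open>A type of its own makes power series over this noncommutative ring available.\<close>

typedef (overloaded) ('m::order, 'k::field) endo =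
    "{\<phi> :: ('m, 'k) series \<Rightarrow> ('m, 'k) series. strongly_linear \<phi>}"
  morphisms app Endo
  by (rule exI[of _ id], simp, rule strongly_linearI) auto

setup_lifting type_definition_endo

lemma strongly_linear_app: "strongly_linear (app f)"
  using app[of f] by simp

lemmas app_add = strongly_linear_add[OF strongly_linear_app]
  and app_scale = strongly_linear_scale[OF strongly_linear_app]
  and app_0 [simp] = strongly_linear_zero[OF strongly_linear_app]
  and summable_family_app = strongly_linear_any_index(1)[OF strongly_linear_app]
  and app_family_sum = strongly_linear_any_index(2)[OF strongly_linear_app]

lemma endo_eqI: "(\<And>v. app f v = app g v) \<Longrightarrow> f = g"
  by (simp add: app_inject[symmetric] fun_eq_iff)

lift_definition scalar :: "'k::field \<Rightarrow> ('m::order, 'k) endo" is scale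
proof (rule strongly_linearI)
  fix c :: 'k and I :: "(('m, 'k) series \<times> nat) set" and v :: "_ \<Rightarrow> ('m, 'k) series"
  assume "summable_family I v"
  then show "summable_family I (\<lambda>i. scale c (v i)) \<and> scale c (family_sum I v) = family_sum I (\<lambda>i. scale c (v i))"
    using family_sum_scale[of I v c] summable_family_dominated[of I v I "\<lambda>i. scale c (v i)"] supp_scale by auto
qed (simp_all add: series.scale_right_distrib mult.commute)

instantiation endo :: (order, field) ring_1
begin

lift_definition plus_endo :: "('a, 'b) endo \<Rightarrow> ('a, 'b) endo \<Rightarrow> ('a, 'b) endo" is "\<lambda>f g v. f v + g v"
  by (rule strongly_linearI)
    (simp_all add: strongly_linear_add strongly_linear_scale strongly_linear_any_index
      summable_family_add series.scale_right_distrib)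

lift_definition times_endo :: "('a, 'b) endo \<Rightarrow> ('a, 'b) endo \<Rightarrow> ('a, 'b) endo" is "\<lambda>f g v. f (g v)"
proof (rule strongly_linearI)
  fix f g :: "('a, 'b) series \<Rightarrow> ('a, 'b) series" and I :: "(('a, 'b) series \<times> nat) set" and v :: "_ \<Rightarrow> ('a, 'b) series"
  assume f: "strongly_linear f" and g: "strongly_linear g" and v: "summable_family I v"
  show "summable_family I (\<lambda>i. f (g (v i))) \<and> f (g (family_sum I v)) = family_sum I (\<lambda>i. f (g (v i)))"
    using strongly_linear_any_index[OF g v] strongly_linear_any_index[OF f, of I "\<lambda>i. g (v i)"] by simp
qed (simp_all add: strongly_linear_add strongly_linear_scale)

lift_definition one_endo :: "('a, 'b) endo" is "\<lambda>v. v"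
  by (rule strongly_linearI) simp_all

definition zero_endo :: "('a, 'b) endo" where "0 = scalar 0"

definition uminus_endo :: "('a, 'b) endo \<Rightarrow> ('a, 'b) endo" where "- f = scalar (- 1) * f"

definition minus_endo :: "('a, 'b) endo \<Rightarrow> ('a, 'b) endo \<Rightarrow> ('a, 'b) endo" where "f - g = f + scalar (- 1) * g"

instance
proof
  fix f g h :: "('a, 'b) endo"
  show "f - g = f + - g" by (simp add: minus_endo_def uminus_endo_def)
  show "f + g + h = f + (g + h)" "f + g = g + f" "f * g * h = f * (g * h)" "(f + g) * h = f * h + g * h"
    "1 * f = f" "f * 1 = f"
    by (rule endo_eqI; simp add: plus_endo.rep_eq times_endo.rep_eq one_endo.rep_eq add_ac)+
  show "0 + f = f" "- f + f = 0"
    unfolding zero_endo_def uminus_endo_def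
    by (rule endo_eqI; simp add: plus_endo.rep_eq times_endo.rep_eq scalar.rep_eq)+
  show "f * (g + h) = f * g + f * h"
    by (rule endo_eqI) (simp add: plus_endo.rep_eq times_endo.rep_eq app_add)
  show "(0 :: ('a, 'b) endo) \<noteq> 1"
  proof
    fix p :: 'a
    define v where "v = (Abs_series (\<lambda>q. if q = p then 1 else 0) :: ('a, 'b) series)"
    have "coeff v p = 1" unfolding v_def by (subst Abs_series_inverse) (simp_all add: noetherian_finite)
    moreover assume "(0 :: ('a, 'b) endo) = 1"
    then have "app (scalar 0) v = app 1 v" by (simp only: zero_endo_def)
    then have "scale 0 v = v" by (simp only: scalar.rep_eq one_endo.rep_eq)
    ultimately show False by (metis coeff_zero_series series.scale_zero_left zero_neq_one)
  qed
qed

end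

lemma app_plus: "app (f + g) v = app f v + app g v"
  and app_times: "app (f * g) v = app f (app g v)"
  and app_one: "app 1 v = v"
  and app_scalar: "app (scalar c) v = scale c v"
  by (simp_all add: plus_endo.rep_eq times_endo.rep_eq one_endo.rep_eq scalar.rep_eq)

lemma app_zero_endo: "app 0 v = 0"
  by (simp add: zero_endo_def app_scalar)

lemma app_minus_endo: "app (f - g) v = app f v - app g v"
  by (simp add: minus_endo_def uminus_endo_def app_plus app_times app_scalar)

lemma app_sum: "app (sum f K) v = (\<Sum>i\<in>K. app (f i) v)"
  by (induction K rule: infinite_finite_induct) (simp_all add: app_plus app_zero_endo)

lemma app_power: "app (f ^ n) v = (app f ^^ n) v"
  by (induction n) (simp_all add: app_times app_one)

lemma scalar_commute: "scalar c * f = f * scalar c"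
  by (rule endo_eqI) (simp add: app_times app_scalar app_scale)

section \<open>Summable families of endomorphisms\<close>

definition esummable :: "'j set \<Rightarrow> ('j \<Rightarrow> ('m::order, 'k::field) endo) \<Rightarrow> bool" where
  "esummable J f \<longleftrightarrow> lin_summable J (\<lambda>j. app (f j))"

lemma esummableI:
  assumes "\<And>(I :: (('m::order, 'k::field) series \<times> nat) set) v. summable_family I v \<Longrightarrow>
    summable_family (I \<times> J) (\<lambda>(i, j). app (f j) (v i))"
  shows "esummable J (f :: 'j \<Rightarrow> ('m, 'k) endo)"
  using assms by (auto simp: esummable_def lin_summable_def strongly_linear_app)

lemma esummable_family:
  "esummable J f \<Longrightarrow> summable_family I v \<Longrightarrow> summable_family (I \<times> J) (\<lambda>(i, j). app (f j) (v i))"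
  unfolding esummable_def by (rule lin_summable_any_index)

lemma esummable_pointwise: "esummable J f \<Longrightarrow> summable_family J (\<lambda>j. app (f j) v)"
  unfolding esummable_def by (rule lin_summable_pointwise)

lemma strongly_linear_lin_sum:
  fixes f :: "'j \<Rightarrow> ('m::order, 'k::field) endo"
  assumes "esummable J f"
  shows "strongly_linear (lin_sum J (\<lambda>j. app (f j)))"
proof (rule strongly_linearI)
  note s = esummable_pointwise[OF assms]
  show "lin_sum J (\<lambda>j. app (f j)) (v + w) = lin_sum J (\<lambda>j. app (f j)) v + lin_sum J (\<lambda>j. app (f j)) w" for v w
    by (simp add: lin_sum_def app_add summable_family_add(2) s)
  show "lin_sum J (\<lambda>j. app (f j)) (scale c v) = scale c (lin_sum J (\<lambda>j. app (f j)) v)" for c v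
    by (simp add: lin_sum_def app_scale family_sum_scale s)
next
  fix I :: "(('m, 'k) series \<times> nat) set" and v :: "_ \<Rightarrow> ('m, 'k) series"
  assume v: "summable_family I v"
  note IJ = esummable_family[OF assms v]
  note JI = IJ[unfolded summable_family_swap(1)[of I J]]
  have "lin_sum J (\<lambda>j. app (f j)) (family_sum I v) = family_sum J (\<lambda>j. family_sum I (\<lambda>i. app (f j) (v i)))"
    by (simp add: lin_sum_def app_family_sum[OF v])
  also have "\<dots> = family_sum I (\<lambda>i. family_sum J (\<lambda>j. app (f j) (v i)))"
    using family_sum_Times(2)[OF IJ] family_sum_Times(2)[OF JI]
      summable_family_swap(2)[of I J "\<lambda>(i, j). app (f j) (v i)"] by simp
  finally show "summable_family I (\<lambda>i. lin_sum J (\<lambda>j. app (f j)) (v i)) \<and>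
      lin_sum J (\<lambda>j. app (f j)) (family_sum I v) = family_sum I (\<lambda>i. lin_sum J (\<lambda>j. app (f j)) (v i))"
    using family_sum_Times(1)[OF IJ] by (simp add: lin_sum_def)
qed

definition esum :: "'j set \<Rightarrow> ('j \<Rightarrow> ('m::order, 'k::field) endo) \<Rightarrow> ('m, 'k) endo" where
  "esum J f = Endo (lin_sum J (\<lambda>j. app (f j)))"

lemma app_esum_fun: "esummable J f \<Longrightarrow> app (esum J f) = lin_sum J (\<lambda>j. app (f j))"
  unfolding esum_def by (rule Endo_inverse) (simp add: strongly_linear_lin_sum)

lemma app_esum: "esummable J f \<Longrightarrow> app (esum J f) v = family_sum J (\<lambda>j. app (f j) v)"
  by (simp add: app_esum_fun lin_sum_def)

lemma esummable_scalar:
  fixes f :: "'j \<Rightarrow> ('m::order, 'k::field) endo"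
  assumes "esummable J f"
  shows "esummable J (\<lambda>j. scalar (c j) * f j)"
proof (rule esummableI)
  fix I :: "(('m, 'k) series \<times> nat) set" and v :: "_ \<Rightarrow> ('m, 'k) series"
  assume "summable_family I v"
  from esummable_family[OF assms this]
  show "summable_family (I \<times> J) (\<lambda>(i, j). app (scalar (c j) * f j) (v i))"
    by (rule summable_family_dominated) (auto simp: app_times app_scalar dest: subsetD[OF supp_scale])
qed

lemma esum_scalar: "esummable J f \<Longrightarrow> esum J (\<lambda>j. scalar c * f j) = scalar c * esum J f"
  by (rule endo_eqI)
    (simp add: app_esum esummable_scalar app_times app_scalar family_sum_scale esummable_pointwise)

lemma esummable_subset:
  fixes f :: "'j \<Rightarrow> ('m::order, 'k::field) endo"
  assumes "esummable J f" "J' \<subseteq> J"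
  shows "esummable J' f"
proof (rule esummableI)
  fix I :: "(('m, 'k) series \<times> nat) set" and v :: "_ \<Rightarrow> ('m, 'k) series"
  assume "summable_family I v"
  from esummable_family[OF assms(1) this]
  show "summable_family (I \<times> J') (\<lambda>(i, j). app (f j) (v i))"
    by (rule summable_family_subset) (use assms(2) in auto)
qed

lemma esummable_add:
  fixes f :: "'j \<Rightarrow> ('m::order, 'k::field) endo"
  assumes "esummable J f" "esummable J g"
  shows "esummable J (\<lambda>j. f j + g j)" and "esum J (\<lambda>j. f j + g j) = esum J f + esum J g"
proof -
  show *: "esummable J (\<lambda>j. f j + g j)"
  proof (rule esummableI)
    fix I :: "(('m, 'k) series \<times> nat) set" and v :: "_ \<Rightarrow> ('m, 'k) series"
    assume v: "summable_family I v"
    show "summable_family (I \<times> J) (\<lambda>(i, j). app (f j + g j) (v i))"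
      using summable_family_add(1)[OF esummable_family[OF assms(1) v] esummable_family[OF assms(2) v]]
      by (simp add: app_plus case_prod_unfold)
  qed
  show "esum J (\<lambda>j. f j + g j) = esum J f + esum J g"
    by (rule endo_eqI)
      (simp add: app_esum * assms app_plus summable_family_add(2) esummable_pointwise)
qed

lemma esummable_finite_support:
  fixes f :: "'j \<Rightarrow> ('m::order, 'k::field) endo"
  assumes "finite K" "K \<subseteq> J" "\<And>j. j \<in> J - K \<Longrightarrow> f j = 0"
  shows "esummable J f" and "esum J f = sum f K"
proof -
  have z: "app (f j) v = 0" if "j \<in> J" "j \<notin> K" for j v
    using assms(3) that by (simp add: app_zero_endo)
  show *: "esummable J f"
  proof (rule esummableI)
    fix I :: "(('m, 'k) series \<times> nat) set" and v :: "_ \<Rightarrow> ('m, 'k) series"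
    assume v: "summable_family I v"
    have sj: "summable_family I (\<lambda>i. app (f j) (v i))" for j by (rule summable_family_app[OF v])
    have "summable_family (I \<times> K) (\<lambda>(i, j). app (f j) (v i))"
    proof (rule summable_familyI)
      show "noetherian (\<Union>j\<in>K. \<Union>i\<in>I. supp (app (f j) (v i)))"
        using assms(1)
      proof (induction K)
        case (insert j K)
        then show ?case using sj[of j] by (auto simp: summable_family_def intro!: noetherian_Un)
      qed (simp add: noetherian_finite)
      show "finite {k \<in> I \<times> K. p \<in> supp (case k of (i, j) \<Rightarrow> app (f j) (v i))}" for p
      proof (rule finite_subset)
        show "{k \<in> I \<times> K. p \<in> supp (case k of (i, j) \<Rightarrow> app (f j) (v i))} \<subseteq>
            (\<Union>j\<in>K. (\<lambda>i. (i, j)) ` {i \<in> I. p \<in> supp (app (f j) (v i))})" by auto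
        show "finite (\<Union>j\<in>K. (\<lambda>i. (i, j)) ` {i \<in> I. p \<in> supp (app (f j) (v i))})"
          using assms(1) summable_family_finite_at[OF sj] by auto
      qed
    qed auto
    moreover have "summable_family (I \<times> J) (\<lambda>(i, j). app (f j) (v i)) \<longleftrightarrow>
        summable_family (I \<times> K) (\<lambda>(i, j). app (f j) (v i))"
      by (rule summable_family_drop_zero) (use assms(2) z in auto)
    ultimately show "summable_family (I \<times> J) (\<lambda>(i, j). app (f j) (v i))" by simp
  qed
  have "family_sum J (\<lambda>j. app (f j) v) = family_sum K (\<lambda>j. app (f j) v)" for v
    by (rule summable_family_drop_zero) (use assms(2) z in auto)
  then show "esum J f = sum f K"
    by (intro endo_eqI) (simp add: app_esum[OF *] family_sum_finite assms(1) app_sum)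
qed

lemma esum_group:
  fixes f :: "'i \<Rightarrow> ('m::order, 'k::field) endo" and g :: "'i \<Rightarrow> 'j"
  assumes "esummable K f" "g ` K \<subseteq> L"
  shows "esummable L (\<lambda>l. esum {k \<in> K. g k = l} f)"
    and "esum L (\<lambda>l. esum {k \<in> K. g k = l} f) = esum K f"
proof -
  have sub: "esummable {k \<in> K. g k = l} f" for l by (rule esummable_subset[OF assms(1)]) auto
  show *: "esummable L (\<lambda>l. esum {k \<in> K. g k = l} f)"
  proof (rule esummableI)
    fix I :: "(('m, 'k) series \<times> nat) set" and v :: "_ \<Rightarrow> ('m, 'k) series"
    assume v: "summable_family I v"
    let ?F = "\<lambda>(i, k). app (f k) (v i)"
    have "summable_family (I \<times> L) (\<lambda>l. family_sum {k \<in> I \<times> K. map_prod id g k = l} ?F)"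
      by (rule family_sum_group(2)[OF esummable_family[OF assms(1) v]]) (use assms(2) in auto)
    also have "?this \<longleftrightarrow> summable_family (I \<times> L) (\<lambda>(i, l). app (esum {k \<in> K. g k = l} f) (v i))"
    proof (rule summable_family_cong)
      fix il assume "il \<in> I \<times> L"
      then obtain i l where il: "il = (i, l)" "i \<in> I" "l \<in> L" by auto
      then have "{k \<in> I \<times> K. map_prod id g k = il} = Pair i ` {k \<in> K. g k = l}" by auto
      then show "family_sum {k \<in> I \<times> K. map_prod id g k = il} ?F =
          (case il of (i, l) \<Rightarrow> app (esum {k \<in> K. g k = l} f) (v i))"
        by (simp add: il(1) app_esum[OF sub] summable_family_reindex(2) inj_on_def)
    qed
    finally show "summable_family (I \<times> L) (\<lambda>(i, l). app (esum {k \<in> K. g k = l} f) (v i))" .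
  qed
  show "esum L (\<lambda>l. esum {k \<in> K. g k = l} f) = esum K f"
    by (rule endo_eqI) (simp add: app_esum[OF *] app_esum[OF sub] app_esum[OF assms(1)]
      family_sum_group(3)[OF esummable_pointwise[OF assms(1)] assms(2)])
qed

text \<open>Strong linearity of the \<open>f i\<close> moves them inside the sum of the \<open>g j\<close>; what remains is Fubini's
theorem.\<close>

lemma esum_mult:
  fixes f :: "'i \<Rightarrow> ('m::order, 'k::field) endo" and g :: "'j \<Rightarrow> ('m, 'k) endo"
  assumes "esummable I f" "esummable J g"
  shows "esummable (I \<times> J) (\<lambda>(i, j). f i * g j)"
    and "esum (I \<times> J) (\<lambda>(i, j). f i * g j) = esum I f * esum J g"
proof -
  show *: "esummable (I \<times> J) (\<lambda>(i, j). f i * g j)"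
  proof (rule esummableI)
    fix L :: "(('m, 'k) series \<times> nat) set" and v :: "_ \<Rightarrow> ('m, 'k) series"
    assume v: "summable_family L v"
    have "summable_family ((L \<times> J) \<times> I) (\<lambda>(lj, i). app (f i) ((\<lambda>(l, j). app (g j) (v l)) lj))"
      by (rule esummable_family[OF assms(1) esummable_family[OF assms(2) v]])
    moreover have "(L \<times> J) \<times> I = (\<lambda>(l, i, j). ((l, j), i)) ` (L \<times> (I \<times> J))" by force
    moreover have "inj_on (\<lambda>(l, i, j). ((l, j), i)) (L \<times> (I \<times> J))" by (auto simp: inj_on_def)
    ultimately show "summable_family (L \<times> (I \<times> J)) (\<lambda>(l, ij). app (case ij of (i, j) \<Rightarrow> f i * g j) (v l))"
      by (simp add: summable_family_reindex(1) case_prod_unfold app_times)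
  qed
  show "esum (I \<times> J) (\<lambda>(i, j). f i * g j) = esum I f * esum J g"
  proof (rule endo_eqI)
    fix v
    have "summable_family (I \<times> J) (\<lambda>(i, j). app (f i) (app (g j) v))"
      using esummable_pointwise[OF *, of v] by (simp add: case_prod_unfold app_times)
    note family_sum_Times(2)[OF this[unfolded summable_family_swap(1)[of I J]]]
      summable_family_swap(2)[of I J "\<lambda>(i, j). app (f i) (app (g j) v)"]
    then have "family_sum (I \<times> J) (\<lambda>(i, j). app (f i) (app (g j) v)) = app (esum I f) (app (esum J g) v)"
      by (simp add: app_esum assms app_family_sum[OF esummable_pointwise[OF assms(2)]])
    then show "app (esum (I \<times> J) (\<lambda>(i, j). f i * g j)) v = app (esum I f * esum J g) v"
      unfolding app_esum[OF *] by (simp add: app_times case_prod_unfold)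
  qed
qed

lemma esum_reindex:
  fixes f :: "'j \<Rightarrow> ('m::order, 'k::field) endo"
  assumes "inj_on h K"
  shows "esummable (h ` K) f \<longleftrightarrow> esummable K (\<lambda>k. f (h k))"
    and "esum (h ` K) f = esum K (\<lambda>k. f (h k))"
proof -
  have *: "lin_sum (h ` K) (\<lambda>j. app (f j)) = lin_sum K (\<lambda>k. app (f (h k)))"
    by (simp add: lin_sum_def summable_family_reindex(2)[OF assms])
  have "summable_family (I \<times> h ` K) (\<lambda>(i, j). app (f j) (v i)) \<longleftrightarrow>
      summable_family (I \<times> K) (\<lambda>(i, k). app (f (h k)) (v i))" for I :: "(('m, 'k) series \<times> nat) set" and v
  proof -
    have "I \<times> h ` K = map_prod id h ` (I \<times> K)" by force
    moreover have "inj_on (map_prod id h) (I \<times> K)" using assms by (auto simp: inj_on_def)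
    ultimately show ?thesis by (simp add: summable_family_reindex(1) case_prod_unfold)
  qed
  then show "esummable (h ` K) f \<longleftrightarrow> esummable K (\<lambda>k. f (h k))"
    by (simp add: esummable_def lin_summable_def strongly_linear_app)
  show "esum (h ` K) f = esum K (\<lambda>k. f (h k))" by (simp add: esum_def *)
qed

section \<open>Orbits of strictly increasing relations\<close>

text \<open>Nash-Williams' minimal bad sequence argument. A bad sequence is one without indices \<open>i < j\<close> such
  that \<open>x i \<le> x j\<close>; a set is Noetherian if and only if it contains no bad sequence.\<close>

lemma noetherian_orbit:
  fixes T :: "'a::order \<Rightarrow> 'a \<Rightarrow> bool"
  assumes P: "noetherian P"
    and incr: "\<And>p q. T p q \<Longrightarrow> p < q"
    and img: "\<And>Q. noetherian Q \<Longrightarrow> noetherian {q. \<exists>p\<in>Q. T p q}"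
  shows "noetherian {q. \<exists>p\<in>P. T\<^sup>*\<^sup>* p q}" (is "noetherian ?R")
proof (rule noetherianI_good, rule ccontr)
  fix x0 :: "nat \<Rightarrow> 'a"
  assume x0: "range x0 \<subseteq> ?R" "\<nexists>i j. i < j \<and> x0 i \<le> x0 j"
  define bad where "bad x \<longleftrightarrow> range x \<subseteq> ?R \<and> (\<forall>i j. i < j \<longrightarrow> \<not> x i \<le> x j)" for x :: "nat \<Rightarrow> 'a"
  define len where "len q = (LEAST k. \<exists>p\<in>P. (T ^^ k) p q)" for q
  define agree where "agree n x y \<longleftrightarrow> (\<forall>i<n. x i = y i)" for n and x y :: "nat \<Rightarrow> 'a"
  \<comment> \<open>\<open>X (Suc n)\<close> is a bad sequence that agrees with \<open>X n\<close> before position \<open>n\<close> and whose \<open>n\<close>-th entry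
    has the shortest possible path from \<open>P\<close>; the diagonal sequence is a minimal bad sequence.\<close>
  have "\<exists>X. \<forall>n. bad (X n) \<and> (agree n (X (Suc n)) (X n) \<and>
      (\<forall>y. bad y \<and> agree n y (X n) \<longrightarrow> len (X (Suc n) n) \<le> len (y n)))"
  proof (rule dependent_nat_choice)
    show "\<exists>x. bad x" using x0 by (auto simp: bad_def)
  next
    fix x n assume "bad x"
    then have "bad x \<and> agree n x x" by (simp add: agree_def)
    from ex_has_least_nat[of "\<lambda>y. bad y \<and> agree n y x", OF this, of "\<lambda>y. len (y n)"]
    show "\<exists>y. bad y \<and> agree n y x \<and> (\<forall>y'. bad y' \<and> agree n y' x \<longrightarrow> len (y n) \<le> len (y' n))"
      by blast
  qed
  then obtain X where X: "\<And>n. bad (X n)" "\<And>n. agree n (X (Suc n)) (X n)"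
    "\<And>n y. bad y \<Longrightarrow> agree n y (X n) \<Longrightarrow> len (X (Suc n) n) \<le> len (y n)" by blast
  define z where "z n = X (Suc n) n" for n
  have Xz: "X m i = z i" if "i < m" for m i
    using that
  proof (induction m)
    case (Suc m)
    then show ?case using X(2)[of m] by (cases "i = m") (auto simp: z_def agree_def)
  qed simp
  have zbad: "\<not> z i \<le> z j" if "i < j" for i j
    using X(1)[of "Suc j"] that Xz[of i "Suc j"] Xz[of j "Suc j"]
    unfolding bad_def by (metis less_Suc_eq)
  have zR: "z i \<in> ?R" for i using X(1)[of "Suc i"] unfolding bad_def z_def by (blast intro: range_subsetD)
  have zmin: "len (z n) \<le> len (y n)" if "bad y" "agree n y z" for y n
    using X(3)[OF that(1), of n] that(2) by (auto simp: agree_def Xz z_def[symmetric])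
  have "\<exists>r. r \<in> ?R \<and> T r (z i) \<and> len r < len (z i)" if zi: "z i \<notin> P" for i
  proof -
    have "\<exists>k. \<exists>p\<in>P. (T ^^ k) p (z i)" using zR[of i] by (auto simp: rtranclp_power)
    then have "\<exists>p\<in>P. (T ^^ len (z i)) p (z i)" unfolding len_def by (rule LeastI_ex)
    then obtain p where p: "p \<in> P" "(T ^^ len (z i)) p (z i)" by blast
    then obtain l where l: "len (z i) = Suc l" using zi by (cases "len (z i)") auto
    then obtain r where r: "(T ^^ l) p r" "T r (z i)" using p(2) by auto
    have "len r \<le> l" unfolding len_def by (rule Least_le) (use p(1) r(1) in blast)
    then show ?thesis using r p(1) l by (intro exI[of _ r]) (auto simp: rtranclp_power)
  qed
  then obtain r where r: "\<And>i. z i \<notin> P \<Longrightarrow> r i \<in> ?R \<and> T (r i) (z i) \<and> len (r i) < len (z i)" by metis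
  \<comment> \<open>The predecessors \<open>r i\<close> of the entries outside \<open>P\<close> form a Noetherian set: a bad sequence of
    predecessors, put behind an initial part of \<open>z\<close>, would be a bad sequence with a shorter path.\<close>
  define Q where "Q = r ` {i. z i \<notin> P}"
  have "noetherian Q"
  proof (rule noetherianI_good, rule ccontr)
    fix y :: "nat \<Rightarrow> 'a" assume y: "range y \<subseteq> Q" "\<nexists>i j. i < j \<and> y i \<le> y j"
    have "\<forall>m. \<exists>i. z i \<notin> P \<and> y m = r i" using y(1) by (auto simp: Q_def)
    then obtain f where f: "\<And>m. z (f m) \<notin> P" "\<And>m. y m = r (f m)" by metis
    obtain m0 where m0: "\<And>m. f m0 \<le> f m" using ex_has_least_nat[of "\<lambda>_. True" 0 f] by auto
    define n0 where "n0 = f m0"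
    define w where "w i = (if i < n0 then z i else y (m0 + (i - n0)))" for i
    have cross: "\<not> z i \<le> y m" if "i < n0" for i m
    proof
      assume "z i \<le> y m"
      also have "y m < z (f m)" using f(2)[of m] r[OF f(1)[of m]] incr by simp
      finally have "z i \<le> z (f m)" by simp
      then show False using zbad[of i "f m"] that m0[of m] by (simp add: n0_def)
    qed
    have "bad w"
      unfolding bad_def
    proof (intro conjI allI impI)
      show "range w \<subseteq> ?R" using zR f r by (auto simp: w_def)
      show "\<not> w i \<le> w j" if "i < j" for i j
        using that zbad[of i j] cross y(2) by (auto simp: w_def)
    qed
    moreover have "agree n0 w z" by (simp add: agree_def w_def)
    ultimately have "len (z n0) \<le> len (w n0)" by (rule zmin)
    then show False using r[OF f(1)[of m0]] f(2)[of m0] by (simp add: w_def n0_def)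
  qed
  \<comment> \<open>All entries of the bad sequence \<open>z\<close> thus lie in a Noetherian set.\<close>
  from noetherian_Un[OF P img[OF this]]
  have N: "noetherian (P \<union> {q. \<exists>p\<in>Q. T p q})" .
  have "range z \<subseteq> P \<union> {q. \<exists>p\<in>Q. T p q}" using r by (auto simp: Q_def)
  from noetherian_good[OF N this] show False using zbad by blast
qed

lemma noetherian_induct [consumes 2, case_names less]:
  assumes N: "noetherian R" and q: "q \<in> R"
    and step: "\<And>q. q \<in> R \<Longrightarrow> (\<And>p. p \<in> R \<Longrightarrow> p < q \<Longrightarrow> B p) \<Longrightarrow> B q"
  shows "B (q :: 'a::order)"
proof -
  have "wf {(x, y). x \<in> R \<and> y \<in> R \<and> x < y}"
    unfolding wf_iff_no_infinite_down_chain
  proof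
    assume "\<exists>f. \<forall>i. (f (Suc i), f i) \<in> {(x, y). x \<in> R \<and> y \<in> R \<and> x < y}"
    then obtain f where f: "\<And>i. f i \<in> R" "\<And>i. f (Suc i) < f i" by auto
    have "range f \<subseteq> R" using f(1) by auto
    then obtain i j where "i < j" "f i \<le> f j" using noetherian_good[OF N] by blast
    moreover have "f j < f i" using \<open>i < j\<close> by (rule less_Suc_induct) (rule f(2), blast intro: less_trans)
    ultimately show False by simp
  qed
  then show ?thesis using q
  proof (induction q)
    case (less q)
    then show ?case using step[of q] by blast
  qed
qed

text \<open>\<open>walk S w p\<close> collects the endpoints of the paths that start at \<open>p\<close> and make one step for each
letter of \<open>w\<close>. The last letter acts first, as in a composition of maps.\<close>

fun walk :: "('j \<Rightarrow> 'a \<Rightarrow> 'a set) \<Rightarrow> 'j list \<Rightarrow> 'a \<Rightarrow> 'a set" where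
  "walk S [] p = {p}"
| "walk S (j # w) p = (\<Union>r\<in>walk S w p. S j r)"

text \<open>The set of all endpoints is an orbit, hence Noetherian. Finiteness follows by well-founded
induction on the endpoint \<open>q\<close>: the last step into \<open>q\<close> starts at a smaller endpoint \<open>r\<close>, there are
finitely many such last steps, and finitely many paths into each \<open>r\<close>.\<close>

lemma walks:
  fixes S :: "'j \<Rightarrow> 'a::order \<Rightarrow> 'a set"
  assumes P: "noetherian P"
    and incr: "\<And>j p q. q \<in> S j p \<Longrightarrow> p < q"
    and img: "\<And>Q. noetherian Q \<Longrightarrow> noetherian (\<Union>p\<in>Q. \<Union>j. S j p)"
    and fin: "\<And>Q q. noetherian Q \<Longrightarrow> finite {(p, j). p \<in> Q \<and> q \<in> S j p}"
  shows noetherian_walks: "noetherian (\<Union>p\<in>P. \<Union>w. walk S w p)"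
    and finite_walks: "finite {(p, w). p \<in> P \<and> q \<in> walk S w p}"
proof -
  let ?T = "\<lambda>p q. \<exists>j. q \<in> S j p"
  define R where "R = (\<Union>p\<in>P. \<Union>w. walk S w p)"
  have walk: "?T\<^sup>*\<^sup>* p q" if "q \<in> walk S w p" for w p q
    using that by (induction w arbitrary: q) (auto intro: rtranclp.rtrancl_into_rtrancl)
  have "noetherian {q. \<exists>p\<in>P. ?T\<^sup>*\<^sup>* p q}"
  proof (rule noetherian_orbit[OF P])
    fix Q :: "'a set" assume "noetherian Q"
    from img[OF this] show "noetherian {q. \<exists>p\<in>Q. ?T p q}"
      by (rule noetherian_subset) auto
  qed (use incr in blast)
  then show N: "noetherian (\<Union>p\<in>P. \<Union>w. walk S w p)"
    by (rule noetherian_subset) (use walk in blast)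
  show "finite {(p, w). p \<in> P \<and> q \<in> walk S w p}"
  proof (cases "q \<in> R")
    case False
    then have "{(p, w). p \<in> P \<and> q \<in> walk S w p} = {}" by (auto simp: R_def)
    then show ?thesis by (simp only: finite.emptyI)
  next
    case True
    with N[folded R_def] show ?thesis
    proof (induction q rule: noetherian_induct)
      case (less q)
      let ?D = "{(r, j). r \<in> R \<and> q \<in> S j r}"
      have "{(p, w). p \<in> P \<and> q \<in> walk S w p} \<subseteq>
          {(q, [])} \<union> (\<Union>(r, j)\<in>?D. (\<lambda>(p, w). (p, j # w)) ` {(p, w). p \<in> P \<and> r \<in> walk S w p})"
      proof clarify
        fix p w assume *: "p \<in> P" "q \<in> walk S w p"
          "(p, w) \<notin> (\<Union>(r, j)\<in>?D. (\<lambda>(p, w). (p, j # w)) ` {(p, w). p \<in> P \<and> r \<in> walk S w p})"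
        show "p = q \<and> w = []"
        proof (cases w)
          case (Cons j w')
          then obtain r where r: "r \<in> walk S w' p" "q \<in> S j r" using *(2) by auto
          moreover have "r \<in> R" using r(1) *(1) by (auto simp: R_def)
          ultimately show ?thesis using *(1,3) Cons by force
        qed (use * in auto)
      qed
      moreover have "finite ((\<lambda>(p, w). (p, j # w)) ` {(p, w). p \<in> P \<and> r \<in> walk S w p})"
        if "(r, j) \<in> ?D" for r j using that less(2)[of r] incr by auto
      ultimately show ?case
        using fin[OF N[folded R_def], of q] by (auto elim!: finite_subset)
    qed
  qed
qed

section \<open>Powers of summable families of contracting maps\<close>

lift_definition monomial :: "'m::order \<Rightarrow> ('m, 'k::field) series" is "\<lambda>p q. if q = p then 1 else 0"
  by (simp add: noetherian_finite)

lemma supp_monomial: "supp (monomial p) = {p}"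
  by (auto simp: supp_def monomial.rep_eq)

lemma summable_monomials:
  assumes "noetherian P"
  shows "summable_family P (\<lambda>p. monomial p :: ('m::order, 'k::field) series)"
proof (rule summable_familyI[OF assms])
  show "finite {i \<in> P. p \<in> supp (monomial i :: ('m, 'k) series)}" for p
    by (rule finite_subset[of _ "{p}"]) (auto simp: supp_monomial)
qed (simp add: supp_monomial)

text \<open>A strongly linear map is determined by its values on monomials, a series being the sum of the
summable family of its terms.\<close>

lemma supp_app: "supp (app f v) \<subseteq> (\<Union>p\<in>supp v. supp (app f (monomial p)))"
proof -
  let ?t = "\<lambda>p. scale (coeff v p) (monomial p)"
  have s: "summable_family (supp v) ?t"
    by (rule summable_family_dominated[OF summable_monomials[OF noetherian_supp[of v]]])
      (auto dest: subsetD[OF supp_scale])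
  have "coeff (family_sum (supp v) ?t) q = coeff v q" for q
  proof -
    have "coeff (family_sum (supp v) ?t) q = (\<Sum>p\<in>{q} \<inter> supp v. coeff (?t p) q)"
      by (rule coeff_family_sum[OF s]) (auto dest!: subsetD[OF supp_scale] simp: supp_monomial)
    also have "\<dots> = coeff v q"
      by (cases "q \<in> supp v") (auto simp: scale.rep_eq monomial.rep_eq coeff_eq_0_iff[symmetric])
    finally show ?thesis .
  qed
  then have "family_sum (supp v) ?t = v" by (rule series_eqI)
  then have "app f v = family_sum (supp v) (\<lambda>p. app f (?t p))" using app_family_sum[OF s, of f] by simp
  then show ?thesis
    using supp_family_sum[of "supp v" "\<lambda>p. app f (?t p)"]
    by (auto simp: app_scale dest!: subsetD subsetD[OF supp_scale])
qed

text \<open>The zero map and zero arguments need no special treatment in this form.\<close>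

definition contr :: "('m::order, 'k::field) endo \<Rightarrow> bool" where
  "contr f \<longleftrightarrow> (\<forall>v. \<forall>q\<in>supp (app f v). \<exists>p\<in>supp v. p < q)"

lemma contracting_app: "contracting (app f) \<longleftrightarrow> contr f"
proof -
  have "(\<forall>q\<in>supp (app f v). \<exists>p\<in>supp v. p < q) \<longleftrightarrow> (v \<noteq> 0 \<longrightarrow> app f v \<prec> v)" for v
    by (cases "v = 0") (auto simp: prec_def)
  then show ?thesis by (simp add: contracting_def contr_def)
qed

lemma contr_0 [simp]: "contr 0"
  by (simp add: contr_def app_zero_endo)

lemma contr_add: "contr f \<Longrightarrow> contr g \<Longrightarrow> contr (f + g)"
  unfolding contr_def app_plus using supp_add by blast

lemma contr_mult: "contr f \<Longrightarrow> contr g \<Longrightarrow> contr (f * g)"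
  unfolding contr_def app_times by (meson order.strict_trans)

lemma contr_scalar: "contr f \<Longrightarrow> contr (scalar c * f)"
  unfolding contr_def app_times app_scalar using supp_scale by blast

lemma contr_uminus: "contr f \<Longrightarrow> contr (- f)"
  unfolding uminus_endo_def by (rule contr_scalar)

lemma contr_diff: "contr f \<Longrightarrow> contr g \<Longrightarrow> contr (f - g)"
  using contr_add[of f "- g"] contr_uminus[of g] by simp

lemma contr_sum: "(\<And>i. i \<in> I \<Longrightarrow> contr (f i)) \<Longrightarrow> contr (sum f I)"
  by (induction I rule: infinite_finite_induct) (simp_all add: contr_add)

lemma contr_power: "contr f \<Longrightarrow> contr (f ^ Suc n)"
  by (induction n) (simp_all add: contr_mult)

lemma contr_esum:
  assumes "esummable J f" "\<And>j. j \<in> J \<Longrightarrow> contr (f j)"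
  shows "contr (esum J f)"
  unfolding contr_def app_esum[OF assms(1)]
  using assms(2) supp_family_sum unfolding contr_def by blast

text \<open>The \<open>n\<close>-th coefficient of \<open>U ^ k\<close> is the sum of the products \<open>U $ i\<^sub>1 * \<dots> * U $ i\<^sub>k\<close> with
\<open>i\<^sub>1 + \<dots> + i\<^sub>k = n\<close>, and each product moves exponents along walks labelled by its indices.\<close>

lemma supp_fps_power:
  fixes U :: "('m::order, 'k::field) endo fps"
  shows "supp (app ((U ^ k) $ n) v) \<subseteq>
    (\<Union>p\<in>supp v. \<Union>w\<in>{w. length w = k \<and> sum_list w = n}. walk (\<lambda>i r. supp (app (U $ i) (monomial r))) w p)"
proof (induction k arbitrary: n)
  case 0
  then show ?case by (auto simp: fps_one_nth app_one app_zero_endo)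
next
  case (Suc k)
  show ?case
  proof
    fix q assume "q \<in> supp (app ((U ^ Suc k) $ n) v)"
    then have "q \<in> supp (\<Sum>i=0..n. app (U $ i) (app ((U ^ k) $ (n - i)) v))"
      by (simp add: fps_mult_nth app_sum app_times)
    then obtain i where i: "i \<le> n" "q \<in> supp (app (U $ i) (app ((U ^ k) $ (n - i)) v))"
      using supp_sum by fastforce
    then obtain r where r: "r \<in> supp (app ((U ^ k) $ (n - i)) v)" "q \<in> supp (app (U $ i) (monomial r))"
      using supp_app by blast
    obtain p w where "p \<in> supp v" "length w = k" "sum_list w = n - i"
      "r \<in> walk (\<lambda>i r. supp (app (U $ i) (monomial r))) w p" using r(1) Suc by blast
    then show "q \<in> (\<Union>p\<in>supp v. \<Union>w\<in>{w. length w = Suc k \<and> sum_list w = n}.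
        walk (\<lambda>i r. supp (app (U $ i) (monomial r))) w p)"
      using r(2) i(1) by (intro UN_I[of p] UN_I[of "i # w"]) auto
  qed
qed

text \<open>This is what makes substitution into arbitrary power series converge: the powers of a summable
family of contracting maps are summable jointly, not only each by itself. The steps from a monomial
\<open>p\<close> to the members of the support of \<open>U $ j\<close> at \<open>p\<close> satisfy the hypotheses on walks: increasing because
\<open>U $ j\<close> is contracting, with Noetherian images and finite fibres because \<open>U\<close> is summable.\<close>

lemma esummable_fps_powers:
  fixes U :: "('m::order, 'k::field) endo fps"
  assumes U: "esummable UNIV (fps_nth U)" and contr: "\<And>n. contr (U $ n)"
  shows "esummable UNIV (\<lambda>(k, n). (U ^ k) $ n)"
proof (rule esummableI)
  fix I :: "(('m, 'k) series \<times> nat) set" and v :: "_ \<Rightarrow> ('m, 'k) series"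
  assume v: "summable_family I v"
  let ?S = "\<lambda>i r. supp (app (U $ i) (monomial r))"
  define P where "P = (\<Union>i\<in>I. supp (v i))"
  have P: "noetherian P" using v by (simp add: P_def summable_family_def)
  have incr: "p < q" if "q \<in> ?S j p" for j p q
    using contr[of j] that unfolding contr_def by (fastforce simp: supp_monomial)
  have sq: "summable_family (Q \<times> UNIV) (\<lambda>(p, j). app (U $ j) (monomial p))" if "noetherian Q" for Q
    by (rule esummable_family[OF U summable_monomials[OF that]])
  have img: "noetherian (\<Union>p\<in>Q. \<Union>j. ?S j p)" if "noetherian Q" for Q
    using sq[OF that] unfolding summable_family_def by (auto elim!: noetherian_subset)
  have fin: "finite {(p, j). p \<in> Q \<and> q \<in> ?S j p}" if "noetherian Q" for Q q
    using summable_family_finite_at[OF sq[OF that], of q] by (auto elim!: finite_subset[rotated])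
  note W = noetherian_walks[of P ?S, OF P incr img fin] finite_walks[of P ?S, OF P incr img fin]
  have sub: "supp (app ((U ^ k) $ n) (v i)) \<subseteq> (\<Union>p\<in>P. \<Union>w. walk ?S w p)" if "i \<in> I" for i k n
    using supp_fps_power[of U k n "v i"] that by (fastforce simp: P_def)
  show "summable_family (I \<times> UNIV) (\<lambda>(i, kn). app (case kn of (k, n) \<Rightarrow> (U ^ k) $ n) (v i))"
  proof (rule summable_familyI[OF W(1)])
    show "supp (case ikn of (i, kn) \<Rightarrow> app (case kn of (k, n) \<Rightarrow> (U ^ k) $ n) (v i))
        \<subseteq> (\<Union>p\<in>P. \<Union>w. walk ?S w p)" if ikn: "ikn \<in> I \<times> UNIV" for ikn
    proof -
      obtain i k n where "ikn = (i, k, n)" "i \<in> I" using ikn by (cases ikn) auto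
      then show ?thesis using sub[of i k n] by simp
    qed
  next
    fix q
    let ?N = "{(p, w). p \<in> P \<and> q \<in> walk ?S w p}"
    have "{ikn \<in> I \<times> UNIV. q \<in> supp (case ikn of (i, kn) \<Rightarrow> app (case kn of (k, n) \<Rightarrow> (U ^ k) $ n) (v i))}
        \<subseteq> (\<Union>(p, w)\<in>?N. (\<lambda>i. (i, length w, sum_list w)) ` {i \<in> I. p \<in> supp (v i)})"
    proof clarify
      fix i k n assume i: "i \<in> I" and q: "q \<in> supp (app ((U ^ k) $ n) (v i))"
      obtain p w where "p \<in> supp (v i)" "length w = k" "sum_list w = n" "q \<in> walk ?S w p"
        using subsetD[OF supp_fps_power q] by blast
      then show "(i, k, n) \<in> (\<Union>(p, w)\<in>?N. (\<lambda>i. (i, length w, sum_list w)) ` {i \<in> I. p \<in> supp (v i)})"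
        using i by (force simp: P_def)
    qed
    moreover have "finite (\<Union>(p, w)\<in>?N. (\<lambda>i. (i, length w, sum_list w)) ` {i \<in> I. p \<in> supp (v i)})"
      using W(2) summable_family_finite_at[OF v] by auto
    ultimately show "finite {ikn \<in> I \<times> UNIV. q \<in> supp (case ikn of (i, kn) \<Rightarrow>
        app (case kn of (k, n) \<Rightarrow> (U ^ k) $ n) (v i))}" by (rule finite_subset)
  qed
qed

section \<open>Substitution into power series over a noncommutative ring\<close>

text \<open>The condition for the sum of the family to converge in the \<open>t\<close>-adic topology such that its \<open>n\<close>-th
coefficient involves the members up to index \<open>n\<close> only.\<close>

definition locally_finite :: "(nat \<Rightarrow> 'r::ring_1 fps) \<Rightarrow> bool" where
  "locally_finite a \<longleftrightarrow> (\<forall>k n. n < k \<longrightarrow> a k $ n = 0)"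

definition lsum :: "(nat \<Rightarrow> 'r::ring_1 fps) \<Rightarrow> 'r fps" where
  "lsum a = Abs_fps (\<lambda>n. \<Sum>k\<le>n. a k $ n)"

lemma lsum_nth:
  assumes "locally_finite a" "n \<le> N"
  shows "lsum a $ n = (\<Sum>k\<le>N. a k $ n)"
  unfolding lsum_def fps_nth_Abs_fps
  by (rule sum.mono_neutral_left) (use assms in \<open>auto simp: locally_finite_def\<close>)

lemma fps_mult_nth_vanish:
  assumes "\<And>i. i < k \<Longrightarrow> a $ i = 0" "\<And>j. j < l \<Longrightarrow> b $ j = 0" "n < k + l"
  shows "(a * b) $ n = (0 :: 'r::ring_1)"
  unfolding fps_mult_nth
proof (rule sum.neutral, rule ballI)
  fix i assume "i \<in> {0..n}"
  then have "i < k \<or> n - i < l" using assms(3) by auto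
  then show "a $ i * b $ (n - i) = 0" using assms(1,2) by auto
qed

lemma locally_finite_const_mult: "locally_finite a \<Longrightarrow> locally_finite (\<lambda>k. fps_const (c k) * a k)"
  by (simp add: locally_finite_def)

lemma locally_finite_power: "U $ 0 = 0 \<Longrightarrow> locally_finite (\<lambda>k. U ^ k)"
  unfolding locally_finite_def
proof (intro allI impI)
  fix k n :: nat assume U: "U $ 0 = 0"
  show "n < k \<Longrightarrow> (U ^ k) $ n = 0"
  proof (induction k arbitrary: n)
    case (Suc k)
    then show ?case using fps_mult_nth_vanish[of 1 U k "U ^ k" n] U by simp
  qed simp
qed

lemma lsum_mult:
  assumes "locally_finite a" "locally_finite b"
  shows "lsum a * lsum b = lsum (\<lambda>n. \<Sum>i\<le>n. a i * b (n - i))"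
proof (rule fps_ext)
  fix N
  have "(lsum a * lsum b) $ N = (\<Sum>p=0..N. (\<Sum>i\<le>N. a i $ p) * (\<Sum>j\<le>N. b j $ (N - p)))"
    by (simp add: fps_mult_nth lsum_nth[OF assms(1), of _ N] lsum_nth[OF assms(2), of _ N])
  also have "\<dots> = (\<Sum>p=0..N. \<Sum>(i, j)\<in>{..N} \<times> {..N}. a i $ p * b j $ (N - p))"
    by (simp add: sum_product sum.cartesian_product)
  also have "\<dots> = (\<Sum>(i, j)\<in>{..N} \<times> {..N}. (a i * b j) $ N)"
    unfolding case_prod_unfold by (subst sum.swap) (simp add: fps_mult_nth)
  also have "\<dots> = (\<Sum>(i, j)\<in>{(i, j). i + j \<le> N}. (a i * b j) $ N)"
  proof (rule sum.mono_neutral_right)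
    show "\<forall>x\<in>{..N} \<times> {..N} - {(i, j). i + j \<le> N}. (case x of (i, j) \<Rightarrow> (a i * b j) $ N) = 0"
    proof
      fix x assume "x \<in> {..N} \<times> {..N} - {(i, j). i + j \<le> N}"
      then obtain i j where "x = (i, j)" "N < i + j" by auto
      then show "(case x of (i, j) \<Rightarrow> (a i * b j) $ N) = 0"
        using assms fps_mult_nth_vanish[of i "a i" j "b j" N] by (simp add: locally_finite_def)
    qed
  qed auto
  also have "\<dots> = (\<Sum>n\<le>N. \<Sum>i\<le>n. (a i * b (n - i)) $ N)"
    by (rule sum.triangle_reindex_eq)
  also have "\<dots> = lsum (\<lambda>n. \<Sum>i\<le>n. a i * b (n - i)) $ N"
    by (simp add: lsum_def fps_sum_nth)
  finally show "(lsum a * lsum b) $ N = lsum (\<lambda>n. \<Sum>i\<le>n. a i * b (n - i)) $ N" .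
qed

lemma lsum_mult_right:
  assumes "locally_finite a"
  shows "lsum a * V = lsum (\<lambda>k. a k * V)"
proof (rule fps_ext)
  fix N
  have "(lsum a * V) $ N = (\<Sum>p=0..N. \<Sum>k\<le>N. a k $ p * V $ (N - p))"
    by (simp add: fps_mult_nth lsum_nth[OF assms, of _ N] sum_distrib_right)
  also have "\<dots> = lsum (\<lambda>k. a k * V) $ N"
    by (subst sum.swap) (simp add: lsum_def fps_mult_nth)
  finally show "(lsum a * V) $ N = lsum (\<lambda>k. a k * V) $ N" .
qed

lemma lsum_deriv:
  assumes "locally_finite a"
  shows "fps_deriv (lsum a) = fps_deriv (a 0) + lsum (\<lambda>k. fps_deriv (a (Suc k)))"
proof (rule fps_ext)
  fix n
  have "fps_deriv (lsum a) $ n = (\<Sum>k\<le>Suc n. fps_deriv (a k) $ n)"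
    by (simp add: lsum_nth[OF assms, of "Suc n" "Suc n"] sum_distrib_left del: of_nat_Suc sum.atMost_Suc)
  also have "\<dots> = (fps_deriv (a 0) + lsum (\<lambda>k. fps_deriv (a (Suc k)))) $ n"
    by (subst sum.atMost_Suc_shift) (simp add: lsum_def)
  finally show "fps_deriv (lsum a) $ n = (fps_deriv (a 0) + lsum (\<lambda>k. fps_deriv (a (Suc k)))) $ n" .
qed

text \<open>An algebra over a field of characteristic zero, given by its structure map, so that the same
statements apply to a ring of endomorphisms and to the power series over it.\<close>

locale central_scalars =
  fixes \<iota> :: "'k::field_char_0 \<Rightarrow> 'r::ring_1"
  assumes hom_1: "\<iota> 1 = 1" and hom_add: "\<iota> (c + d) = \<iota> c + \<iota> d" and hom_mult: "\<iota> (c * d) = \<iota> c * \<iota> d"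
    and central: "\<iota> c * r = r * \<iota> c"
begin

lemma hom_0: "\<iota> 0 = 0"
  using hom_add[of 0 0] by simp

lemma hom_of_nat: "\<iota> (of_nat n) = of_nat n"
  by (induction n) (simp_all add: hom_0 hom_1 hom_add)

lemma hom_sum: "\<iota> (sum f A) = (\<Sum>i\<in>A. \<iota> (f i))"
  by (induction A rule: infinite_finite_induct) (simp_all add: hom_0 hom_add)

lemma hom_cancel: "c \<noteq> 0 \<Longrightarrow> \<iota> (inverse c) * (\<iota> c * r) = r"
  by (simp flip: mult.assoc hom_mult add: hom_1)

lemma central_left: "r * (\<iota> c * s) = \<iota> c * (r * s)"
  by (metis central mult.assoc)

lemma central_scalars_fps: "central_scalars (\<lambda>c. fps_const (\<iota> c))"
proof
  show "fps_const (\<iota> c) * r = r * fps_const (\<iota> c)" for c r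
    by (rule fps_ext) (simp add: central[of c "r $ _"])
qed (simp_all add: hom_1 hom_add hom_mult)

end

definition subst :: "('k::field_char_0 \<Rightarrow> 'r::ring_1) \<Rightarrow> 'k fps \<Rightarrow> 'r fps \<Rightarrow> 'r fps" where
  "subst \<iota> c U = lsum (\<lambda>k. fps_const (\<iota> (c $ k)) * U ^ k)"

lemma subst_nth: "subst \<iota> c U $ n = (\<Sum>k\<le>n. \<iota> (c $ k) * (U ^ k) $ n)"
  by (simp add: subst_def lsum_def)

lemma subst_nth_0: "subst \<iota> c U $ 0 = \<iota> (c $ 0)"
  by (simp add: subst_nth)

context central_scalars
begin

interpretation F: central_scalars "\<lambda>c. fps_const (\<iota> c)"
  by (rule central_scalars_fps)

lemma subst_1: "subst \<iota> 1 U = 1"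
  by (rule fps_ext) (simp add: subst_nth fps_one_nth hom_0 hom_1 if_distrib if_distribR sum.delta cong: if_cong)

lemma subst_X: "U $ 0 = 0 \<Longrightarrow> subst \<iota> fps_X U = U"
proof (rule fps_ext)
  fix n assume "U $ 0 = 0"
  then show "subst \<iota> fps_X U $ n = U $ n"
    by (cases n) (simp_all add: subst_nth fps_X_def hom_0 hom_1 if_distrib if_distribR sum.delta cong: if_cong)
qed

lemma subst_add: "subst \<iota> (c + d) U = subst \<iota> c U + subst \<iota> d U"
  by (rule fps_ext) (simp add: subst_nth hom_add distrib_right sum.distrib)

lemma subst_mult:
  assumes "U $ 0 = 0"
  shows "subst \<iota> (c * d) U = subst \<iota> c U * subst \<iota> d U"
proof -
  note lf = locally_finite_const_mult[OF locally_finite_power[OF assms]]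
  have "fps_const (\<iota> ((c * d) $ n)) * U ^ n =
      (\<Sum>i\<le>n. (fps_const (\<iota> (c $ i)) * U ^ i) * (fps_const (\<iota> (d $ (n - i))) * U ^ (n - i)))" for n
  proof -
    have "(fps_const (\<iota> (c $ i)) * U ^ i) * (fps_const (\<iota> (d $ (n - i))) * U ^ (n - i)) =
        fps_const (\<iota> (c $ i * d $ (n - i))) * U ^ n" if "i \<le> n" for i
      using that by (simp add: mult.assoc F.central_left[of "U ^ i"] F.hom_mult fps_const_mult[symmetric]
          flip: power_add del: fps_const_mult)
    then show ?thesis
      by (simp add: fps_mult_nth F.hom_sum sum_distrib_right atLeast0AtMost)
  qed
  then show ?thesis unfolding subst_def lsum_mult[OF lf lf] by simp
qed

lemma subst_power: "U $ 0 = 0 \<Longrightarrow> subst \<iota> (d ^ k) U = subst \<iota> d U ^ k"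
  by (induction k) (simp_all add: subst_1 subst_mult)

text \<open>Both sides expand to the double sum of \<open>c\<^sub>k (d\<^sup>k)\<^sub>n U\<^sup>n\<close>, summed in different orders; by multiplicativity
\<open>(d\<^sup>k)(U) = d(U)\<^sup>k\<close>.\<close>

lemma subst_compose:
  assumes "U $ 0 = 0" "d $ 0 = 0"
  shows "subst \<iota> c (subst \<iota> d U) = subst \<iota> (c oo d) U"
proof (rule fps_ext)
  fix N
  have "subst \<iota> c (subst \<iota> d U) $ N = (\<Sum>k\<le>N. \<iota> (c $ k) * (\<Sum>n\<le>N. \<iota> ((d ^ k) $ n) * (U ^ n) $ N))"
    by (subst subst_nth) (simp add: subst_power[OF assms(1), symmetric] subst_nth)
  also have "\<dots> = (\<Sum>n\<le>N. (\<Sum>k\<le>N. \<iota> (c $ k * (d ^ k) $ n)) * (U ^ n) $ N)"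
    unfolding sum_distrib_left sum_distrib_right
    by (subst sum.swap) (simp add: hom_mult mult.assoc)
  also have "\<dots> = (\<Sum>n\<le>N. \<iota> ((c oo d) $ n) * (U ^ n) $ N)"
  proof (intro sum.cong refl)
    fix n assume "n \<in> {..N}"
    then have "(\<Sum>k\<le>N. c $ k * (d ^ k) $ n) = (c oo d) $ n"
      unfolding fps_compose_nth atLeast0AtMost
      using locally_finite_power[OF assms(2)]
      by (intro sum.mono_neutral_right) (auto simp: locally_finite_def)
    then show "(\<Sum>k\<le>N. \<iota> (c $ k * (d ^ k) $ n)) * (U ^ n) $ N = \<iota> ((c oo d) $ n) * (U ^ n) $ N"
      by (simp flip: hom_sum)
  qed
  finally show "subst \<iota> c (subst \<iota> d U) $ N = subst \<iota> (c oo d) U $ N" by (simp add: subst_nth)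
qed

end

section \<open>The Baker-Campbell-Hausdorff series\<close>

definition ad :: "'r::ring \<Rightarrow> 'r \<Rightarrow> 'r" where
  "ad Z V = Z * V - V * Z"

lemma Pascal_sum:
  fixes f :: "nat \<Rightarrow> 'r::ring_1"
  shows "(\<Sum>k\<le>n. of_nat (n choose k) * (f (Suc k) + f k)) = (\<Sum>k\<le>Suc n. of_nat (Suc n choose k) * f k)"
proof -
  have "(\<Sum>k\<le>Suc n. of_nat (Suc n choose k) * f k) =
      (\<Sum>k\<le>n. of_nat (n choose k) * f (Suc k)) + (f 0 + (\<Sum>k\<le>n. of_nat (n choose Suc k) * f (Suc k)))"
    by (subst sum.atMost_Suc_shift) (simp add: distrib_right sum.distrib add_ac)
  also have "f 0 + (\<Sum>k\<le>n. of_nat (n choose Suc k) * f (Suc k)) = (\<Sum>k\<le>Suc n. of_nat (n choose k) * f k)"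
    by (subst sum.atMost_Suc_shift) simp
  also have "\<dots> = (\<Sum>k\<le>n. of_nat (n choose k) * f k)" by (simp add: binomial_eq_0)
  finally show ?thesis by (simp add: distrib_left sum.distrib)
qed

text \<open>The binomial theorem for the commuting operators \<open>ad Z\<close> and right multiplication by \<open>Z\<close>, whose sum
is left multiplication by \<open>Z\<close>.\<close>

lemma power_mult_ad:
  fixes Z V :: "'r::ring_1"
  shows "Z ^ n * V = (\<Sum>k\<le>n. of_nat (n choose k) * ((ad Z ^^ k) V * Z ^ (n - k)))"
proof (induction n)
  case (Suc n)
  let ?f = "\<lambda>k. (ad Z ^^ k) V * Z ^ (Suc n - k)"
  have "Z ^ Suc n * V = (\<Sum>k\<le>n. of_nat (n choose k) * (Z * ((ad Z ^^ k) V * Z ^ (n - k))))"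
    by (simp add: mult.assoc Suc sum_distrib_left mult_of_nat_commute)
  also have "\<dots> = (\<Sum>k\<le>n. of_nat (n choose k) * (?f (Suc k) + ?f k))"
    by (intro sum.cong refl) (simp add: ad_def algebra_simps Suc_diff_le)
  also have "\<dots> = (\<Sum>k\<le>Suc n. of_nat (Suc n choose k) * ?f k)"
    by (rule Pascal_sum)
  finally show ?case .
qed simp

text \<open>The Leibniz rule gives \<open>\<Sum> Z\<^sup>i Z' Z\<^sup>n\<^sup>-\<^sup>i\<close>. Writing \<open>L\<close>, \<open>R\<close> for left and right multiplication by
\<open>Z\<close>, this is \<open>(L\<^sup>n\<^sup>+\<^sup>1 - R\<^sup>n\<^sup>+\<^sup>1) / (L - R)\<close> applied to \<open>Z'\<close>, and \<open>L = ad Z + R\<close>.\<close>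

lemma deriv_power_ad:
  fixes Z :: "'r::ring_1 fps"
  shows "fps_deriv (Z ^ Suc n) =
    (\<Sum>k\<le>n. of_nat (Suc n choose Suc k) * ((ad Z ^^ k) (fps_deriv Z) * Z ^ (n - k)))"
proof (induction n)
  case (Suc n)
  let ?f = "\<lambda>k. (ad Z ^^ k) (fps_deriv Z) * Z ^ (Suc n - k)"
  define g where "g k = (case k of 0 \<Rightarrow> 0 | Suc j \<Rightarrow> ?f j)" for k
  have "fps_deriv (Z ^ Suc (Suc n)) = Z * fps_deriv (Z ^ Suc n) + fps_deriv Z * Z ^ Suc n"
    unfolding power_Suc[of Z "Suc n"] fps_deriv_mult ..
  also have "Z * fps_deriv (Z ^ Suc n) =
      (\<Sum>k\<le>n. of_nat (Suc n choose Suc k) * (Z * ((ad Z ^^ k) (fps_deriv Z) * Z ^ (n - k))))"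
    unfolding Suc sum_distrib_left
    by (intro sum.cong refl) (metis mult.assoc mult_of_nat_commute)
  also have "\<dots> = (\<Sum>k\<le>n. of_nat (Suc n choose Suc k) * (?f (Suc k) + ?f k))"
    by (intro sum.cong refl) (simp add: ad_def algebra_simps Suc_diff_le)
  also have "\<dots> + fps_deriv Z * Z ^ Suc n = (\<Sum>k\<le>Suc n. of_nat (Suc n choose k) * (g (Suc k) + g k))"
    by (subst sum.atMost_Suc_shift) (simp add: g_def add.commute)
  also have "\<dots> = (\<Sum>k\<le>Suc n. of_nat (Suc (Suc n) choose Suc k) * ?f k)"
    unfolding Pascal_sum by (subst sum.atMost_Suc_shift) (simp add: g_def)
  finally show ?case .
qed simp

lemma locally_finite_ad:
  assumes "Z $ 0 = 0"
  shows "locally_finite (\<lambda>k. (ad Z ^^ k) V)"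
  unfolding locally_finite_def
proof (intro allI impI)
  fix k n :: nat
  show "n < k \<Longrightarrow> (ad Z ^^ k) V $ n = 0"
  proof (induction k arbitrary: n)
    case (Suc k)
    then show ?case
      using fps_mult_nth_vanish[of 1 Z k "(ad Z ^^ k) V" n] fps_mult_nth_vanish[of k "(ad Z ^^ k) V" 1 Z n] assms
      by (simp add: ad_def[of Z "(ad Z ^^ k) V"])
  qed simp
qed

text \<open>In degree \<open>n\<close> the product \<open>G * F\<close> is \<open>G $ n\<close> plus terms with earlier coefficients of \<open>G\<close>.\<close>

lemma fps_right_cancel:
  fixes F G H :: "'r::ring_1 fps"
  assumes "F $ 0 = 1" "G * F = H * F"
  shows "G = H"
proof (rule fps_ext)
  fix n show "G $ n = H $ n"
  proof (induction n rule: less_induct)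
    case (less n)
    have split: "(A * F) $ n = A $ n + (\<Sum>i<n. A $ i * F $ (n - i))" for A
      by (simp add: fps_mult_nth atLeast0AtMost assms(1) flip: lessThan_Suc_atMost)
    show ?case using assms(2) split[of G] split[of H] less by simp
  qed
qed

text \<open>The series \<open>exp (t X)\<close>.\<close>

definition expX :: "('k::field_char_0 \<Rightarrow> 'r::ring_1) \<Rightarrow> 'r \<Rightarrow> 'r fps" where
  "expX \<iota> X = subst \<iota> (fps_exp 1) (fps_const X * fps_X)"

text \<open>The Baker-Campbell-Hausdorff series \<open>log (exp (t X) exp (t Y))\<close>, graded by powers of \<open>t\<close>.\<close>

definition bch :: "('k::field_char_0 \<Rightarrow> 'r::ring_1) \<Rightarrow> 'r \<Rightarrow> 'r \<Rightarrow> 'r fps" where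
  "bch \<iota> X Y = subst \<iota> (fps_ln 1) (expX \<iota> X * expX \<iota> Y - 1)"

lemma fps_const_times_X_power: "(fps_const X * fps_X) ^ k $ n = (if k = n then X ^ k else (0 :: 'r::ring_1))"
proof (induction k arbitrary: n)
  case (Suc k)
  have "((fps_const X * fps_X) * V) $ n = (if n = 0 then 0 else X * V $ (n - 1))" for V
    by (simp add: mult.assoc)
  then show ?case by (cases n) (simp_all add: mult.assoc Suc)
qed (simp add: fps_one_nth)

lemma subst_const_times_X: "central_scalars \<iota> \<Longrightarrow> subst \<iota> c (fps_const X * fps_X) $ n = \<iota> (c $ n) * X ^ n"
  by (simp add: subst_nth fps_const_times_X_power if_distrib cong: if_cong)

lemma fps_exp_oo_ln: "fps_exp 1 oo fps_ln 1 = 1 + (fps_X :: 'k::field_char_0 fps)"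
proof -
  have "(fps_exp 1 - 1 :: 'k fps) oo fps_inv (fps_exp 1 - 1) = fps_X"
    by (rule fps_inv_right) simp_all
  then show ?thesis by (simp add: fps_ln_fps_exp_inv fps_compose_sub_distrib algebra_simps)
qed

lemma fps_ln_oo_exp: "fps_ln 1 oo (fps_exp 1 - 1) = (fps_X :: 'k::field_char_0 fps)"
proof -
  have "fps_inv (fps_exp 1 - 1) oo (fps_exp 1 - 1 :: 'k fps) = fps_X"
    by (rule fps_inv) simp_all
  then show ?thesis by (simp add: fps_ln_fps_exp_inv)
qed

context central_scalars
begin

interpretation F: central_scalars "\<lambda>c. fps_const (\<iota> c)"
  by (rule central_scalars_fps)

lemma fact_binomial:
  assumes "k \<le> n"
  shows "fps_const (\<iota> (1 / fact n)) * of_nat (n choose k) =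
    fps_const (\<iota> (1 / fact k)) * fps_const (\<iota> (1 / fact (n - k)))"
proof -
  have "1 / fact n * of_nat (n choose k) = (1 / fact k * (1 / fact (n - k)) :: 'k)"
    using binomial_fact[OF assms, where ?'a = 'k] by (simp add: field_simps)
  then show ?thesis by (simp only: F.hom_of_nat[symmetric] F.hom_mult[symmetric])
qed

lemma rescale_product:
  assumes "fps_const (\<iota> a) * N = fps_const (\<iota> b) * fps_const (\<iota> c)"
  shows "fps_const (\<iota> a) * (N * (V * W)) = fps_const (\<iota> b) * V * (fps_const (\<iota> c) * W)"
proof -
  have "fps_const (\<iota> b) * V * (fps_const (\<iota> c) * W) = fps_const (\<iota> b) * fps_const (\<iota> c) * (V * W)"
    by (simp only: mult.assoc F.central_left[of V])
  then show ?thesis by (simp only: assms[symmetric] mult.assoc)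
qed

text \<open>Conjugation by \<open>exp Z\<close> is \<open>exp (ad Z)\<close>: divide the expansion of \<open>Z ^ n * V\<close> by \<open>n!\<close>
and sum over \<open>n\<close>.\<close>

lemma exp_conjugate:
  assumes "Z $ 0 = 0"
  shows "subst \<iota> (fps_exp 1) Z * V = lsum (\<lambda>k. fps_const (\<iota> (1 / fact k)) * (ad Z ^^ k) V) * subst \<iota> (fps_exp 1) Z"
proof -
  note lf = locally_finite_const_mult[OF locally_finite_power[OF assms]]
    locally_finite_const_mult[OF locally_finite_ad[OF assms]]
  have "fps_const (\<iota> (1 / fact n)) * Z ^ n * V = (\<Sum>k\<le>n. fps_const (\<iota> (1 / fact k)) * (ad Z ^^ k) V *
      (fps_const (\<iota> (1 / fact (n - k))) * Z ^ (n - k)))" for n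
    unfolding mult.assoc[of _ "Z ^ n"] power_mult_ad sum_distrib_left
    by (intro sum.cong refl rescale_product fact_binomial) simp
  then show ?thesis
    unfolding subst_def fps_exp_nth lsum_mult_right[OF lf(1)] lsum_mult[OF lf(2) lf(1)] by simp
qed

text \<open>Since \<open>Z\<close> and its derivative do not commute, the derivative of \<open>exp Z\<close> is \<open>((exp x - 1) / x)(ad Z)\<close>
applied to the derivative of \<open>Z\<close>, times \<open>exp Z\<close>.\<close>

lemma deriv_exp:
  assumes "Z $ 0 = 0"
  shows "fps_deriv (subst \<iota> (fps_exp 1) Z) =
    lsum (\<lambda>k. fps_const (\<iota> (1 / fact (Suc k))) * (ad Z ^^ k) (fps_deriv Z)) * subst \<iota> (fps_exp 1) Z"
proof -
  note lf = locally_finite_const_mult[OF locally_finite_power[OF assms]]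
    locally_finite_const_mult[OF locally_finite_ad[OF assms]]
  have "fps_deriv (fps_const (\<iota> (1 / fact (Suc n))) * Z ^ Suc n) =
      (\<Sum>k\<le>n. fps_const (\<iota> (1 / fact (Suc k))) * (ad Z ^^ k) (fps_deriv Z) *
        (fps_const (\<iota> (1 / fact (n - k))) * Z ^ (n - k)))" for n
  proof -
    have "fps_const (\<iota> (1 / fact (Suc n))) * of_nat (Suc n choose Suc k) =
      fps_const (\<iota> (1 / fact (Suc k))) * fps_const (\<iota> (1 / fact (n - k)))" if "k \<le> n" for k
      using fact_binomial[of "Suc k" "Suc n"] that by simp
    then show ?thesis
      unfolding fps_deriv_mult_const_left deriv_power_ad sum_distrib_left
      by (intro sum.cong refl rescale_product) simp
  qed
  then show ?thesis
    unfolding subst_def fps_exp_nth lsum_deriv[OF lf(1)] lsum_mult[OF lf(2) lf(1)]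
    by (simp del: fact_Suc power_Suc fps_deriv_mult)
qed

lemma expX_nth: "expX \<iota> X $ n = \<iota> (1 / fact n) * X ^ n"
  unfolding expX_def by (subst subst_const_times_X) (simp_all add: central_scalars_axioms)

lemma deriv_expX: "fps_deriv (expX \<iota> X) = fps_const X * expX \<iota> X"
proof (rule fps_ext)
  fix n
  have "fps_deriv (expX \<iota> X) $ n = \<iota> (of_nat (Suc n) * (1 / fact (Suc n))) * X ^ Suc n"
    by (simp only: fps_deriv_nth expX_nth hom_mult hom_of_nat mult.assoc Suc_eq_plus1)
  also have "of_nat (Suc n) * (1 / fact (Suc n)) = (1 / fact n :: 'k)"
    by (simp add: field_simps del: of_nat_Suc)
  finally show "fps_deriv (expX \<iota> X) $ n = (fps_const X * expX \<iota> X) $ n"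
    by (simp add: expX_nth central_left)
qed

lemma expX_commute: "fps_const X * expX \<iota> X = expX \<iota> X * fps_const X"
  by (rule fps_ext) (simp add: expX_nth central_left mult.assoc power_commutes)

lemma expX_product_nth_0: "(expX \<iota> X * expX \<iota> Y) $ 0 = 1"
  by (simp add: expX_nth hom_1)

lemma bch_nth_0: "bch \<iota> X Y $ 0 = 0"
  by (simp add: bch_def subst_nth_0 hom_0)

lemma exp_bch: "subst \<iota> (fps_exp 1) (bch \<iota> X Y) = expX \<iota> X * expX \<iota> Y"
  unfolding bch_def using expX_product_nth_0[of X Y]
  by (simp add: subst_compose fps_exp_oo_ln subst_add subst_1 subst_X)

text \<open>With \<open>E = exp Z = exp (t X) exp (t Y)\<close> one has \<open>E' = X E + E Y\<close>. The formulas for the derivative and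
for conjugation turn both sides into multiples of \<open>E\<close>, which can be cancelled.\<close>

lemma bch_ode:
  fixes X Y :: 'r
  defines "Z \<equiv> bch \<iota> X Y"
  shows "lsum (\<lambda>k. fps_const (\<iota> (1 / fact (Suc k))) * (ad Z ^^ k) (fps_deriv Z)) =
    fps_const X + lsum (\<lambda>k. fps_const (\<iota> (1 / fact k)) * (ad Z ^^ k) (fps_const Y))" (is "?B = _ + ?A")
proof (rule fps_right_cancel)
  let ?E = "subst \<iota> (fps_exp 1) Z"
  note Z0 = bch_nth_0[of X Y, folded Z_def]
  have E: "?E = expX \<iota> X * expX \<iota> Y" by (simp add: Z_def exp_bch)
  show "?E $ 0 = 1" by (simp add: subst_nth_0 hom_1)
  have "?B * ?E = fps_deriv ?E" by (rule deriv_exp[OF Z0, symmetric])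
  also have "\<dots> = fps_const X * ?E + ?E * fps_const Y"
    unfolding E fps_deriv_mult deriv_expX expX_commute[of Y] by (simp only: mult.assoc add.commute)
  also have "\<dots> = (fps_const X + ?A) * ?E"
    by (simp add: exp_conjugate[OF Z0] distrib_right)
  finally show "?B * ?E = (fps_const X + ?A) * ?E" .
qed

text \<open>The coefficient of \<open>t\<^sup>n\<close> in the differential equation, solved for the summand \<open>k = 0\<close> on the left,
which is \<open>(n + 1) Z\<^sub>n\<^sub>+\<^sub>1\<close>. The right-hand side involves only \<open>Z\<^sub>1, \<dots>, Z\<^sub>n\<close>, because \<open>ad Z\<close> raises the
degree in \<open>t\<close>.\<close>

lemma bch_recursion:
  fixes X Y :: 'r
  defines "Z \<equiv> bch \<iota> X Y"
  shows "Z $ Suc n = \<iota> (inverse (of_nat (Suc n))) *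
    ((fps_const X $ n + (\<Sum>k\<le>n. \<iota> (1 / fact k) * (ad Z ^^ k) (fps_const Y) $ n)) -
      (\<Sum>k<n. \<iota> (1 / fact (Suc (Suc k))) * (ad Z ^^ Suc k) (fps_deriv Z) $ n))"
proof -
  have "lsum (\<lambda>k. fps_const (\<iota> (1 / fact (Suc k))) * (ad Z ^^ k) (fps_deriv Z)) $ n =
      (\<Sum>k<Suc n. \<iota> (1 / fact (Suc k)) * (ad Z ^^ k) (fps_deriv Z) $ n)"
    by (simp add: lsum_def lessThan_Suc_atMost)
  also have "\<dots> = \<iota> (of_nat (Suc n)) * Z $ Suc n +
      (\<Sum>k<n. \<iota> (1 / fact (Suc (Suc k))) * (ad Z ^^ Suc k) (fps_deriv Z) $ n)"
    by (subst sum.lessThan_Suc_shift) (simp add: hom_1 of_nat_Suc[of 0] flip: hom_of_nat del: of_nat_Suc)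
  finally have "\<iota> (of_nat (Suc n)) * Z $ Suc n =
      (fps_const X $ n + (\<Sum>k\<le>n. \<iota> (1 / fact k) * (ad Z ^^ k) (fps_const Y) $ n)) -
      (\<Sum>k<n. \<iota> (1 / fact (Suc (Suc k))) * (ad Z ^^ Suc k) (fps_deriv Z) $ n)"
    unfolding bch_ode[of X Y, folded Z_def] by (simp add: lsum_def algebra_simps)
  then show ?thesis using hom_cancel[of "of_nat (Suc n)" "Z $ Suc n"] by (simp del: of_nat_Suc)
qed

end

text \<open>A Lie subalgebra of the product of two algebras, for example the graph of a morphism from a Lie
subalgebra of the first to the second.\<close>

locale lie_relation = R: central_scalars \<iota> + S: central_scalars \<kappa>
  for \<iota> :: "'k::field_char_0 \<Rightarrow> 'r::ring_1" and \<kappa> :: "'k \<Rightarrow> 's::ring_1" +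
  fixes C :: "'r \<Rightarrow> 's \<Rightarrow> bool"
  assumes add: "C a a' \<Longrightarrow> C b b' \<Longrightarrow> C (a + b) (a' + b')"
    and scale: "C a a' \<Longrightarrow> C (\<iota> c * a) (\<kappa> c * a')"
    and bracket: "C a a' \<Longrightarrow> C b b' \<Longrightarrow> C (ad a b) (ad a' b')"
    and zero: "C 0 0"
begin

lemma diff: "C a a' \<Longrightarrow> C b b' \<Longrightarrow> C (a - b) (a' - b')"
proof -
  assume *: "C a a'" "C b b'"
  have "\<iota> (- 1) + 1 = \<iota> (- 1 + 1)" "\<kappa> (- 1) + 1 = \<kappa> (- 1 + 1)"
    by (simp_all only: R.hom_add S.hom_add R.hom_1 S.hom_1)
  then have "\<iota> (- 1) = - 1" "\<kappa> (- 1) = - 1" by (simp_all add: R.hom_0 S.hom_0 eq_neg_iff_add_eq_0)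
  then show ?thesis using add[OF *(1) scale[OF *(2), of "- 1"]] by simp
qed

lemma sum: "(\<And>i. i \<in> I \<Longrightarrow> C (f i) (g i)) \<Longrightarrow> C (sum f I) (sum g I)"
  by (induction I rule: infinite_finite_induct) (simp_all add: zero add)

text \<open>As \<open>Z\<close> has no constant term, the coefficients of \<open>ad Z V\<close> up to degree \<open>n\<close> depend only on those of \<open>V\<close>
below degree \<open>n\<close>. This gap of one is what the recursion needs: \<open>Z\<^sub>n\<^sub>+\<^sub>1\<close> is the \<open>n\<close>-th coefficient of
the derivative of \<open>Z\<close> and must not occur on the right-hand side.\<close>

lemma ad_power_nth:
  assumes Z: "\<And>i. i \<le> n \<Longrightarrow> C (Z $ i) (Z' $ i)" "Z $ 0 = 0" "Z' $ 0 = 0"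
    and V: "\<And>i. i < n \<Longrightarrow> C (V $ i) (V' $ i)"
  shows "j \<le> n \<Longrightarrow> C ((ad Z ^^ Suc k) V $ j) ((ad Z' ^^ Suc k) V' $ j)"
proof -
  have ad_nth: "ad A B $ j = (\<Sum>i\<in>{0<..j}. ad (A $ i) (B $ (j - i)))" if "A $ 0 = 0"
    for A B :: "'a::ring_1 fps" and j
  proof -
    have "(B * A) $ j = (\<Sum>i=0..j. B $ (j - i) * A $ i)"
      unfolding fps_mult_nth by (rule sum.reindex_bij_witness[of _ "\<lambda>i. j - i" "\<lambda>i. j - i"]) auto
    then have "ad A B $ j = (\<Sum>i=0..j. ad (A $ i) (B $ (j - i)))"
      by (simp add: ad_def fps_mult_nth sum_subtractf)
    also have "\<dots> = (\<Sum>i\<in>{0<..j}. ad (A $ i) (B $ (j - i)))"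
      by (rule sum.mono_neutral_right) (use that in \<open>auto simp: ad_def\<close>)
    finally show ?thesis .
  qed
  show "j \<le> n \<Longrightarrow> C ((ad Z ^^ Suc k) V $ j) ((ad Z' ^^ Suc k) V' $ j)"
  proof (induction k arbitrary: j)
    case 0
    then show ?case by (auto simp: ad_nth Z(2,3) intro!: sum bracket Z(1) V)
  next
    case (Suc k)
    have *: "(ad Z ^^ Suc (Suc k)) V = ad Z ((ad Z ^^ Suc k) V)"
      "(ad Z' ^^ Suc (Suc k)) V' = ad Z' ((ad Z' ^^ Suc k) V')" by simp_all
    show ?case unfolding * ad_nth[OF Z(2)] ad_nth[OF Z(3)]
      using Suc.prems by (intro sum bracket Z(1) Suc.IH) auto
  qed
qed

theorem bch_nth:
  assumes X: "C X X'" and Y: "C Y Y'"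
  shows "C (bch \<iota> X Y $ n) (bch \<kappa> X' Y' $ n)"
proof (induction n rule: less_induct)
  case (less n)
  show ?case
  proof (cases n)
    case 0
    then show ?thesis by (simp add: R.bch_nth_0 S.bch_nth_0 zero)
  next
    case (Suc m)
    have const: "C (fps_const a $ i) (fps_const b $ i)" if "C a b" for a b i
      using that zero by (cases i) simp_all
    have Z: "C (bch \<iota> X Y $ i) (bch \<kappa> X' Y' $ i)" if "i \<le> m" for i
      using less[of i] that Suc by simp
    have deriv: "C (fps_deriv (bch \<iota> X Y) $ i) (fps_deriv (bch \<kappa> X' Y') $ i)" if "i < m" for i
      using scale[OF Z[of "Suc i"], of "of_nat (Suc i)"] that
      by (simp add: R.hom_of_nat S.hom_of_nat del: of_nat_Suc)
    have "C ((ad (bch \<iota> X Y) ^^ k) (fps_const Y) $ m) ((ad (bch \<kappa> X' Y') ^^ k) (fps_const Y') $ m)" for k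
      by (cases k) (use const[OF Y] ad_power_nth[OF Z R.bch_nth_0 S.bch_nth_0 const[OF Y]] in auto)
    moreover note ad_power_nth[OF Z R.bch_nth_0 S.bch_nth_0 deriv order_refl]
    ultimately show ?thesis
      unfolding Suc R.bch_recursion S.bch_recursion
      by (intro scale diff add sum const[OF X]) auto
  qed
qed

end

section \<open>Evaluation of operator power series\<close>

interpretation scalar: central_scalars "scalar :: 'k::field_char_0 \<Rightarrow> ('m::order, 'k) endo"
proof
  show "scalar c * f = f * scalar c" for c and f :: "('m, 'k) endo" by (rule scalar_commute)
qed (rule endo_eqI; simp add: app_scalar app_one app_plus app_times series.scale_left_distrib)+

definition summable_at_1 :: "('m::order, 'k::field) endo fps \<Rightarrow> bool" where
  "summable_at_1 F \<longleftrightarrow> esummable UNIV (fps_nth F)"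

definition eval_at_1 :: "('m::order, 'k::field) endo fps \<Rightarrow> ('m, 'k) endo" where
  "eval_at_1 F = esum UNIV (fps_nth F)"

lemma eval_mult:
  assumes "summable_at_1 F" "summable_at_1 G"
  shows "summable_at_1 (F * G)" and "eval_at_1 (F * G) = eval_at_1 F * eval_at_1 G"
proof -
  let ?H = "\<lambda>(i, j). F $ i * G $ j"
  have eq: "esum {ij \<in> UNIV \<times> UNIV. (case ij of (i, j) \<Rightarrow> i + j) = n} ?H = (F * G) $ n" for n
  proof -
    let ?K = "{ij \<in> UNIV \<times> UNIV. (case ij of (i, j) \<Rightarrow> i + j) = n}"
    have "?K \<subseteq> {..n} \<times> {..n}" by auto
    then have "finite ?K" by (rule finite_subset) simp
    then have "esum ?K ?H = sum ?H ?K" by (rule esummable_finite_support) auto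
    also have "\<dots> = (\<Sum>i=0..n. F $ i * G $ (n - i))"
      by (rule sum.reindex_bij_witness[of _ "\<lambda>i. (i, n - i)" fst]) auto
    finally show ?thesis by (simp add: fps_mult_nth)
  qed
  note m = esum_mult[OF assms[unfolded summable_at_1_def]]
  note g = esum_group[OF m(1), of "\<lambda>(i, j). i + j" UNIV, OF subset_UNIV, unfolded eq]
  show "summable_at_1 (F * G)" "eval_at_1 (F * G) = eval_at_1 F * eval_at_1 G"
    using g m(2) by (simp_all add: summable_at_1_def eval_at_1_def)
qed

lemma eval_1:
  shows "summable_at_1 (1 :: ('m::order, 'k::field) endo fps)" and "eval_at_1 (1 :: ('m, 'k) endo fps) = 1"
  using esummable_finite_support[of "{0}" UNIV "fps_nth (1 :: ('m, 'k) endo fps)"]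
  by (simp_all add: summable_at_1_def eval_at_1_def fps_one_nth)

lemma eval_power:
  assumes "summable_at_1 U"
  shows "summable_at_1 (U ^ k)" and "eval_at_1 (U ^ k) = eval_at_1 U ^ k"
  by (induction k) (simp_all add: eval_1 eval_mult assms)

lemma eval_diff_1:
  fixes F :: "('m::order, 'k::field) endo fps"
  assumes "summable_at_1 F"
  shows "summable_at_1 (F - 1)" and "eval_at_1 (F - 1) = eval_at_1 F - 1"
proof -
  note m = esummable_finite_support[of "{0}" UNIV "fps_nth (- 1 :: ('m, 'k) endo fps)"]
  have "esummable UNIV (fps_nth (- 1 :: ('m, 'k) endo fps))" "esum UNIV (fps_nth (- 1 :: ('m, 'k) endo fps)) = - 1"
    using m by (simp_all add: fps_one_nth)
  note esummable_add[OF assms[unfolded summable_at_1_def] this(1)] this(2)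
  moreover have "fps_nth (F - 1) = (\<lambda>n. F $ n + (- 1) $ n)" by (rule ext) simp
  ultimately show "summable_at_1 (F - 1)" "eval_at_1 (F - 1) = eval_at_1 F - 1"
    by (simp_all add: summable_at_1_def eval_at_1_def)
qed

definition opser :: "'k::field_char_0 fps \<Rightarrow> ('m::order, 'k) endo \<Rightarrow> ('m, 'k) endo" where
  "opser c D = esum UNIV (\<lambda>k. scalar (c $ k) * D ^ k)"

text \<open>By joint summability the double family \<open>c\<^sub>k (U\<^sup>k)\<^sub>n\<close> may be summed by rows or by columns. Summing over \<open>k\<close>
first gives the coefficients of \<open>c(U)\<close>; summing over \<open>n\<close> first gives \<open>c\<^sub>k\<close> times the \<open>k\<close>-th power of the
value of \<open>U\<close>.\<close>

lemma eval_subst: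
  fixes U :: "('m::order, 'k::field_char_0) endo fps"
  assumes U: "summable_at_1 U" "\<And>n. contr (U $ n)" "U $ 0 = 0"
  shows "summable_at_1 (subst scalar c U)"
    and "eval_at_1 (subst scalar c U) = opser c (eval_at_1 U)"
    and "esummable UNIV (\<lambda>k. scalar (c $ k) * eval_at_1 U ^ k)"
proof -
  let ?H = "\<lambda>(k, n). scalar (c $ k) * (U ^ k) $ n"
  have H: "esummable UNIV ?H"
    using esummable_scalar[OF esummable_fps_powers[OF U(1)[unfolded summable_at_1_def] U(2)], of "\<lambda>(k, n). c $ k"]
    by (simp add: case_prod_unfold)
  have "esum {kn \<in> UNIV. snd kn = n} ?H = subst scalar c U $ n" for n
  proof -
    let ?K = "(\<lambda>k. (k, n)) ` {..n}"
    have "esum {kn \<in> UNIV. snd kn = n} ?H = sum ?H ?K"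
      by (rule esummable_finite_support)
        (use locally_finite_power[OF U(3)] in \<open>auto simp: locally_finite_def image_iff,
          metis atMost_iff linorder_not_le mult_zero_right\<close>)
    also have "\<dots> = subst scalar c U $ n"
      by (subst sum.reindex) (auto simp: inj_on_def subst_nth)
    finally show ?thesis .
  qed
  note rows = esum_group[OF H, of snd UNIV, OF subset_UNIV, unfolded this]
  have "esum {kn \<in> UNIV. fst kn = k} ?H = scalar (c $ k) * eval_at_1 U ^ k" for k
  proof -
    have "{kn \<in> UNIV. fst kn = k} = Pair k ` (UNIV :: nat set)" by auto
    then have "esum {kn \<in> UNIV. fst kn = k} ?H = esum UNIV (\<lambda>n. scalar (c $ k) * (U ^ k) $ n)"
      by (simp add: esum_reindex(2) inj_on_def)
    also have "\<dots> = scalar (c $ k) * eval_at_1 (U ^ k)"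
      using eval_power(1)[OF U(1), of k] by (simp add: esum_scalar summable_at_1_def eval_at_1_def)
    finally show ?thesis by (simp add: eval_power(2)[OF U(1)])
  qed
  note columns = esum_group[OF H, of fst UNIV, OF subset_UNIV, unfolded this]
  show "summable_at_1 (subst scalar c U)" "eval_at_1 (subst scalar c U) = opser c (eval_at_1 U)"
    "esummable UNIV (\<lambda>k. scalar (c $ k) * eval_at_1 U ^ k)"
    using rows columns by (simp_all add: summable_at_1_def eval_at_1_def opser_def)
qed

lemma contr_subst_nth:
  assumes U: "\<And>n. contr (U $ n)" and d: "d $ 0 = 0"
  shows "contr (subst scalar d U $ n)"
proof -
  have pow: "contr ((U ^ Suc k) $ n)" for k n
  proof (induction k arbitrary: n)
    case (Suc k)
    show ?case unfolding power_Suc[of U "Suc k"] fps_mult_nth by (intro contr_sum contr_mult U Suc)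
  qed (simp add: U)
  have "contr (scalar (d $ k) * (U ^ k) $ n)" for k
  proof (cases k)
    case 0
    then show ?thesis by (simp add: d scalar.hom_0)
  qed (simp only: contr_scalar pow)
  then show ?thesis unfolding subst_nth by (intro contr_sum)
qed

text \<open>The series \<open>t D\<close>, which reduces evaluation of power series at \<open>D\<close> to substitution followed by \<open>t = 1\<close>.\<close>

abbreviation line :: "('m::order, 'k::field) endo \<Rightarrow> ('m, 'k) endo fps" where
  "line D \<equiv> fps_const D * fps_X"

lemma line_nth: "line D $ n = (if n = 1 then D else 0)"
  using fps_const_times_X_power[of D 1 n] by auto

lemma eval_line: "summable_at_1 (line D)" "eval_at_1 (line D) = D"
  using esummable_finite_support[of "{1}" UNIV "fps_nth (line D)"]
  by (simp_all add: summable_at_1_def eval_at_1_def line_nth)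

lemma line_nth_0: "line D $ 0 = 0"
  by (simp add: line_nth)

lemma contr_line_nth: "contr D \<Longrightarrow> contr (line D $ n)"
  by (simp add: line_nth)

lemma opser_line:
  assumes "contr D"
  shows "summable_at_1 (subst scalar c (line D))" and "opser c D = eval_at_1 (subst scalar c (line D))"
    and "esummable UNIV (\<lambda>k. scalar (c $ k) * D ^ k)"
  using eval_subst[OF eval_line(1) contr_line_nth[OF assms] line_nth_0] by (simp_all add: eval_line(2))

lemma opser_mult: "contr D \<Longrightarrow> opser (c * d) D = opser c D * opser d D"
  by (simp add: opser_line scalar.subst_mult line_nth_0 eval_mult(2))

lemma opser_1: "contr D \<Longrightarrow> opser 1 D = 1"
  by (simp add: opser_line scalar.subst_1 eval_1)

lemma opser_X: "contr D \<Longrightarrow> opser fps_X D = D"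
  by (simp add: opser_line scalar.subst_X line_nth_0 eval_line)

lemma opser_power: "contr D \<Longrightarrow> opser (c ^ n) D = opser c D ^ n"
  by (induction n) (simp_all add: opser_1 opser_mult)

lemma opser_add: "contr D \<Longrightarrow> opser (c + d) D = opser c D + opser d D"
  using opser_line(3)[of D c] opser_line(3)[of D d]
  by (simp add: opser_def scalar.hom_add distrib_right esummable_add(2))

lemma opser_diff_1: "contr D \<Longrightarrow> opser (c - 1) D = opser c D - 1"
  using opser_add[of D "c - 1" 1] by (simp add: opser_1)

lemma contr_opser: "contr D \<Longrightarrow> d $ 0 = 0 \<Longrightarrow> contr (opser d D)"
  using contr_esum[OF opser_line(1)[unfolded summable_at_1_def, of D d]]
    contr_subst_nth[of "line D" d] contr_line_nth[of D]
  by (simp add: opser_line eval_at_1_def)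

lemma opser_compose:
  assumes "contr D" "d $ 0 = 0"
  shows "opser c (opser d D) = opser (c oo d) D"
proof -
  let ?U = "subst scalar d (line D)"
  have "opser c (opser d D) = opser c (eval_at_1 ?U)"
    using assms(1) by (simp add: opser_line(2))
  also have "\<dots> = eval_at_1 (subst scalar c ?U)"
    using assms
    by (intro eval_subst(2)[symmetric] opser_line(1) contr_subst_nth contr_line_nth)
      (simp_all add: subst_nth_0 scalar.hom_0)
  also have "\<dots> = opser (c oo d) D"
    using assms by (simp add: scalar.subst_compose line_nth_0 opser_line(2))
  finally show ?thesis .
qed

definition exp_op :: "('m::order, 'k::field_char_0) endo \<Rightarrow> ('m, 'k) endo" where
  "exp_op D = opser (fps_exp 1) D"

definition log_op :: "('m::order, 'k::field_char_0) endo \<Rightarrow> ('m, 'k) endo" where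
  "log_op s = opser (fps_ln 1) (s - 1)"

lemma exp_op_diff_1: "contr D \<Longrightarrow> exp_op D - 1 = opser (fps_exp 1 - 1) D"
  by (simp add: exp_op_def opser_diff_1)

lemma contr_exp_op: "contr D \<Longrightarrow> contr (exp_op D - 1)"
  by (simp add: exp_op_diff_1 contr_opser)

lemma contr_log_op: "contr (s - 1) \<Longrightarrow> contr (log_op s)"
  by (simp add: log_op_def contr_opser)

lemma log_exp_op: "contr D \<Longrightarrow> log_op (exp_op D) = D"
  by (simp add: log_op_def exp_op_diff_1 opser_compose fps_ln_oo_exp opser_X)

lemma exp_log_op: "contr (s - 1) \<Longrightarrow> exp_op (log_op s) = s"
  by (simp add: log_op_def exp_op_def opser_compose fps_exp_oo_ln opser_add opser_1 opser_X)

lemma exp_op_inverse: "contr D \<Longrightarrow> exp_op D * opser (fps_exp (- 1)) D = 1"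
  "contr D \<Longrightarrow> opser (fps_exp (- 1)) D * exp_op D = 1"
  by (simp_all add: exp_op_def opser_1 flip: opser_mult fps_exp_add_mult)

text \<open>The formal identity \<open>exp (bch X Y) = exp (t X) exp (t Y)\<close> holds at \<open>t = 1\<close>: the series
\<open>exp (t X) exp (t Y) - 1\<close> is summable at \<open>1\<close> with contracting coefficients, hence so is its logarithm.\<close>

theorem exp_op_bch:
  fixes X Y :: "('m::order, 'k::field_char_0) endo"
  assumes "contr X" "contr Y"
  shows "summable_at_1 (bch scalar X Y)" and "contr (eval_at_1 (bch scalar X Y))"
    and "exp_op X * exp_op Y = exp_op (eval_at_1 (bch scalar X Y))"
proof -
  define F where "F = expX scalar X * expX scalar Y"
  have F: "summable_at_1 F" "eval_at_1 F = exp_op X * exp_op Y"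
    using assms by (simp_all add: F_def expX_def exp_op_def opser_line eval_mult)
  have "contr ((F - 1) $ n)" for n
  proof (cases n)
    case 0
    then show ?thesis using scalar.expX_product_nth_0[of X Y] by (simp add: F_def)
  next
    case (Suc m)
    have e: "contr (expX scalar Z $ Suc i)" if "contr Z" for Z :: "('m, 'k) endo" and i
      unfolding scalar.expX_nth by (intro contr_scalar contr_power that)
    have p: "contr (expX scalar X $ i * expX scalar Y $ (Suc m - i))" if "i \<le> Suc m" for i
    proof (cases i)
      case 0
      then show ?thesis by (simp add: scalar.expX_nth[of X 0] scalar.hom_1 e[OF assms(2)])
    next
      case i: (Suc l)
      show ?thesis
      proof (cases "Suc m - i")
        case 0
        then show ?thesis by (simp add: scalar.expX_nth[of Y 0] scalar.hom_1 i e[OF assms(1)])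
      qed (simp only: i contr_mult e assms)
    qed
    have "(F - 1) $ n = (\<Sum>i=0..Suc m. expX scalar X $ i * expX scalar Y $ (Suc m - i))"
      unfolding Suc fps_sub_nth by (simp add: F_def fps_mult_nth fps_one_nth)
    then show ?thesis by (simp only:) (rule contr_sum, rule p, simp)
  qed
  moreover have "(F - 1) $ 0 = 0" using scalar.expX_product_nth_0[of X Y] by (simp add: F_def)
  moreover note F1 = eval_diff_1[OF F(1)]
  ultimately have U: "summable_at_1 (F - 1)" "\<And>n. contr ((F - 1) $ n)" "(F - 1) $ 0 = 0" by blast+
  have Z: "bch scalar X Y = subst scalar (fps_ln 1) (F - 1)" by (simp add: bch_def F_def)
  show s: "summable_at_1 (bch scalar X Y)" unfolding Z by (rule eval_subst(1)[OF U])
  have c: "contr (bch scalar X Y $ n)" for n unfolding Z by (rule contr_subst_nth[OF U(2)]) simp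
  show "contr (eval_at_1 (bch scalar X Y))"
    using contr_esum[OF s[unfolded summable_at_1_def] c] by (simp add: eval_at_1_def)
  have "exp_op (eval_at_1 (bch scalar X Y)) = eval_at_1 (subst scalar (fps_exp 1) (bch scalar X Y))"
    unfolding exp_op_def by (rule eval_subst(2)[symmetric, OF s c scalar.bch_nth_0])
  then show "exp_op X * exp_op Y = exp_op (eval_at_1 (bch scalar X Y))"
    by (simp add: scalar.exp_bch F(2) flip: F_def)
qed

section \<open>Derivations and automorphisms\<close>

definition derivation :: "('m::po_monoid, 'k::field) endo \<Rightarrow> bool" where
  "derivation D \<longleftrightarrow> (\<forall>a b. app D (a * b) = app D a * b + a * app D b)"

definition multiplicative :: "('m::po_monoid, 'k::field) endo \<Rightarrow> bool" where
  "multiplicative s \<longleftrightarrow> (\<forall>a b. app s (a * b) = app s a * app s b)"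

lemma app_opser:
  assumes "contr D"
  shows "app (opser c D) v = family_sum UNIV (\<lambda>k. scale (c $ k) (app (D ^ k) v))"
    and "summable_family UNIV (\<lambda>k. scale (c $ k) (app (D ^ k) v))"
  using app_esum[OF opser_line(3)[OF assms], of c v] esummable_pointwise[OF opser_line(3)[OF assms], of c v]
  by (simp_all add: opser_def app_times app_scalar)

lemma of_nat_mult_series: "of_nat n * v = scale (of_nat n) (v :: ('m::po_monoid, 'k::field) series)"
  by (induction n) (simp_all add: algebra_simps series.scale_left_distrib)

lemma Leibniz_formula:
  assumes "derivation D"
  shows "app (D ^ n) (a * b) = (\<Sum>k\<le>n. of_nat (n choose k) * (app (D ^ k) a * app (D ^ (n - k)) b))"
proof (induction n)
  case 0
  then show ?case by (simp add: app_one)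
next
  case (Suc n)
  let ?f = "\<lambda>k. app (D ^ k) a * app (D ^ (Suc n - k)) b"
  have sum: "app D (sum g A) = (\<Sum>i\<in>A. app D (g i))" for g and A :: "nat set"
    by (induction A rule: infinite_finite_induct) (simp_all add: app_add)
  have "app (D ^ Suc n) (a * b) =
      (\<Sum>k\<le>n. of_nat (n choose k) * app D (app (D ^ k) a * app (D ^ (n - k)) b))"
    by (simp add: app_times Suc sum of_nat_mult_series app_scale)
  also have "\<dots> = (\<Sum>k\<le>n. of_nat (n choose k) * (?f (Suc k) + ?f k))"
    using assms by (intro sum.cong refl) (simp add: derivation_def app_times Suc_diff_le)
  also have "\<dots> = (\<Sum>k\<le>Suc n. of_nat (Suc n choose k) * ?f k)"
    by (rule Pascal_sum)
  finally show ?case .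
qed

text \<open>The Cauchy product of \<open>exp D a\<close> and \<open>exp D b\<close>, collected by total degree, is \<open>exp D (a * b)\<close> by
Leibniz' formula.\<close>

lemma multiplicative_exp_op:
  assumes D: "contr D" "derivation D"
  shows "multiplicative (exp_op D)"
  unfolding multiplicative_def
proof (intro allI)
  fix a b
  let ?t = "\<lambda>v k. scale (1 / fact k) (app (D ^ k) v)"
  have exp: "app (exp_op D) v = family_sum UNIV (?t v)" and sum: "summable_family UNIV (?t v)" for v
    using app_opser[OF D(1), of "fps_exp 1" v] by (simp_all add: exp_op_def)
  note m = summable_family_mult[OF sum[of a] sum[of b]]
  have "family_sum {ij \<in> UNIV \<times> UNIV. (case ij of (i, j) \<Rightarrow> i + j) = n} (\<lambda>(i, j). ?t a i * ?t b j)
      = ?t (a * b) n" for n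
  proof -
    let ?K = "{ij \<in> UNIV \<times> UNIV. (case ij of (i, j) \<Rightarrow> i + j) = n}"
    have "?K \<subseteq> {..n} \<times> {..n}" by auto
    then have fin: "finite ?K" by (rule finite_subset) simp
    have "(\<Sum>(i, j)\<in>?K. ?t a i * ?t b j) = (\<Sum>k\<le>n. ?t a k * ?t b (n - k))"
      by (rule sum.reindex_bij_witness[of _ "\<lambda>i. (i, n - i)" fst]) auto
    also have "\<dots> = (\<Sum>k\<le>n. scale (1 / fact n) (of_nat (n choose k) * (app (D ^ k) a * app (D ^ (n - k)) b)))"
    proof (intro sum.cong refl)
      fix k assume "k \<in> {..n}"
      then have "1 / fact k * (1 / fact (n - k)) = (1 / fact n * of_nat (n choose k) :: 'b)"
        using binomial_fact[of k n, where ?'a = 'b] by (simp add: field_simps)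
      then show "?t a k * ?t b (n - k) =
          scale (1 / fact n) (of_nat (n choose k) * (app (D ^ k) a * app (D ^ (n - k)) b))"
        by (simp add: scale_mult_left scale_mult_right of_nat_mult_series mult.commute[of "fact (n - k)"])
    qed
    also have "\<dots> = ?t (a * b) n"
      by (simp add: Leibniz_formula[OF D(2)] series.scale_sum_right)
    finally show ?thesis unfolding family_sum_finite[OF fin] .
  qed
  with family_sum_group(3)[OF m(1), of "\<lambda>(i, j). i + j" UNIV, OF subset_UNIV] m(2)
  show "app (exp_op D) (a * b) = app (exp_op D) a * app (exp_op D) b"
    by (simp add: exp)
qed

text \<open>The polynomial \<open>x (x - 1) \<dots> (x - k + 1) / k!\<close>. Its value at \<open>n\<close> is a coefficient of \<open>(1 + x)\<^sup>n\<close>, and its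
linear coefficient is a coefficient of \<open>log (1 + x)\<close>: the logarithm is the derivative of
\<open>(1 + x)\<^sup>n\<close> with respect to \<open>n\<close> at \<open>n = 0\<close>.\<close>

definition binomial_poly :: "nat \<Rightarrow> 'k::field_char_0 poly" where
  "binomial_poly k = Polynomial.smult (1 / fact k) (\<Prod>i<k. [:- of_nat i, 1:])"

lemma poly_binomial_poly: "poly (binomial_poly k) (of_nat n) = ((1 + fps_X) ^ n) $ k"
  by (simp add: binomial_poly_def poly_prod gbinomial_prod_rev atLeast0LessThan flip: fps_binomial_of_nat)

lemma coeff_binomial_poly:
  "poly.coeff (binomial_poly k) 0 = (1 :: 'k::field_char_0 fps) $ k"
  "poly.coeff (binomial_poly k) (Suc 0) = (fps_ln 1 :: 'k::field_char_0 fps) $ k"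
proof -
  let ?q = "\<lambda>k. \<Prod>i<k. [:- of_nat i, 1:] :: 'k poly"
  have q0: "poly.coeff (?q k) 0 = (if k = 0 then 1 else 0)" for k
    by (induction k) (simp_all add: coeff_mult_0)
  have q1: "poly.coeff (?q (Suc k)) (Suc 0) = (- 1) ^ k * fact k" for k
  proof (induction k)
    case (Suc k)
    have "?q (Suc (Suc k)) = ?q (Suc k) * [:- of_nat (Suc k), 1:]" by (rule prod.lessThan_Suc)
    then show ?case using Suc by (simp add: coeff_mult q0 del: prod.lessThan_Suc of_nat_Suc)
  qed simp
  show "poly.coeff (binomial_poly k) 0 = (1 :: 'k fps) $ k"
    by (simp add: binomial_poly_def q0 fps_one_nth)
  show "poly.coeff (binomial_poly k) (Suc 0) = (fps_ln 1 :: 'k fps) $ k"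
  proof (cases k)
    case (Suc l)
    have "(- 1) ^ l * fact l / fact (Suc l) = ((- 1) ^ l / of_nat (Suc l) :: 'k)"
      by (simp add: field_simps del: of_nat_Suc)
    then show ?thesis unfolding Suc by (simp add: binomial_poly_def q1 fps_ln_nth del: prod.lessThan_Suc fact_Suc of_nat_Suc)
  qed (simp add: binomial_poly_def fps_ln_nth)
qed

lemma poly_zero_on_nat:
  fixes P :: "'k::field_char_0 poly"
  assumes "\<And>n. poly P (of_nat n) = 0"
  shows "P = 0"
proof (rule ccontr)
  assume "P \<noteq> 0"
  then have "finite {x. poly P x = 0}" by (rule poly_roots_finite)
  moreover have "range (of_nat :: nat \<Rightarrow> 'k) \<subseteq> {x. poly P x = 0}" using assms by auto
  ultimately have "finite (range (of_nat :: nat \<Rightarrow> 'k))" by (rule finite_subset[rotated])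
  then show False using range_inj_infinite[of "of_nat :: nat \<Rightarrow> 'k"] by (simp add: inj_on_def)
qed

text \<open>All powers of \<open>s\<close> are multiplicative. Expanding \<open>s\<^sup>n = (1 + (s - 1))\<^sup>n\<close>, a fixed coefficient of
\<open>s\<^sup>n (a b) = s\<^sup>n a \<cdot> s\<^sup>n b\<close> becomes an equation between values at \<open>n\<close> of two polynomials, since only
finitely many terms contribute to it. The polynomials agree at all natural numbers, hence coincide,
and the equality of their linear coefficients is the product rule for \<open>log s\<close>.\<close>

lemma derivation_log_op:
  fixes s :: "('m::po_monoid, 'k::field_char_0) endo"
  assumes s: "contr (s - 1)" "multiplicative s"
  shows "derivation (log_op s)"
  unfolding derivation_def
proof (intro allI series_eqI)
  fix a b :: "('m, 'k) series" and p :: 'm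
  define \<alpha> \<beta> \<gamma> where "\<alpha> k = app ((s - 1) ^ k) a" and "\<beta> k = app ((s - 1) ^ k) b"
    and "\<gamma> k = app ((s - 1) ^ k) (a * b)" for k
  have sum: "summable_family UNIV (\<lambda>k. app ((s - 1) ^ k) v)" for v
    using app_opser(2)[OF s(1), of "Abs_fps (\<lambda>_. 1)" v] by simp
  define K where "K = {k. p \<in> supp (\<gamma> k)}"
  define J where "J = {(j, k). p \<in> supp (\<alpha> j * \<beta> k)}"
  have finK: "finite K" using summable_family_finite_at[OF sum[of "a * b"], of p] by (simp add: K_def \<gamma>_def)
  have finJ: "finite J"
    using summable_family_finite_at[OF summable_family_mult(1)[OF sum[of a] sum[of b]], of p]
    by (simp add: J_def \<alpha>_def \<beta>_def case_prod_unfold)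
  have left: "coeff (app (opser e (s - 1)) (a * b)) p = (\<Sum>k\<in>K. e $ k * coeff (\<gamma> k) p)" for e
    unfolding app_opser(1)[OF s(1)]
    by (subst coeff_family_sum[OF app_opser(2)[OF s(1)] finK])
      (auto simp: K_def \<gamma>_def scale.rep_eq dest: subsetD[OF supp_scale])
  have right: "coeff (app (opser e (s - 1)) a * app (opser f (s - 1)) b) p =
      (\<Sum>(j, k)\<in>J. e $ j * f $ k * coeff (\<alpha> j * \<beta> k) p)" for e f
  proof -
    note m = summable_family_mult[OF app_opser(2)[OF s(1), of e a] app_opser(2)[OF s(1), of f b]]
    have prod: "scale (e $ j) (app ((s - 1) ^ j) a) * scale (f $ k) (app ((s - 1) ^ k) b) =
        scale (e $ j * f $ k) (\<alpha> j * \<beta> k)" for j k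
      by (simp add: \<alpha>_def \<beta>_def scale_mult_left scale_mult_right mult.commute)
    show ?thesis
      unfolding app_opser(1)[OF s(1)] m(2)[symmetric]
      by (subst coeff_family_sum[OF m(1) finJ])
        (auto simp: J_def prod scale.rep_eq case_prod_unfold dest: subsetD[OF supp_scale])
  qed
  \<comment> \<open>The difference of the two sides as a polynomial in the exponent of \<open>s\<close>.\<close>
  define P where "P = (\<Sum>k\<in>K. Polynomial.smult (coeff (\<gamma> k) p) (binomial_poly k)) -
    (\<Sum>(j, k)\<in>J. Polynomial.smult (coeff (\<alpha> j * \<beta> k) p) (binomial_poly j * binomial_poly k))"
  have "poly P (of_nat n) = 0" for n
  proof -
    have pow: "opser ((1 + fps_X) ^ n) (s - 1) = s ^ n"
      using s(1) by (simp add: opser_power opser_add opser_1 opser_X)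
    have "app (s ^ n) (a * b) = app (s ^ n) a * app (s ^ n) b"
      using s(2) by (induction n) (simp_all add: multiplicative_def app_one app_times)
    with left[of "(1 + fps_X) ^ n"] right[of "(1 + fps_X) ^ n" "(1 + fps_X) ^ n"]
    show ?thesis
      by (simp add: P_def poly_sum pow poly_binomial_poly mult_ac case_prod_unfold)
  qed
  then have "P = 0" by (rule poly_zero_on_nat)
  then have "poly.coeff P (Suc 0) = 0" by simp
  then have "(\<Sum>k\<in>K. fps_ln 1 $ k * coeff (\<gamma> k) p) =
      (\<Sum>(j, k)\<in>J. fps_ln 1 $ j * 1 $ k * coeff (\<alpha> j * \<beta> k) p) +
      (\<Sum>(j, k)\<in>J. 1 $ j * fps_ln 1 $ k * coeff (\<alpha> j * \<beta> k) p)"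
    by (simp add: P_def Polynomial.coeff_sum coeff_mult coeff_binomial_poly case_prod_unfold algebra_simps
      flip: sum.distrib)
  then show "coeff (app (log_op s) (a * b)) p = coeff (app (log_op s) a * b + a * app (log_op s) b) p"
    using left[of "fps_ln 1"] right[of "fps_ln 1" 1] right[of 1 "fps_ln 1"]
    by (simp add: log_op_def opser_1[OF s(1)] app_one plus_series.rep_eq)
qed

lemma Der_iff: "\<delta> \<in> Der \<longleftrightarrow> (\<exists>D. \<delta> = app D \<and> contr D \<and> derivation D)"
proof
  assume \<delta>: "\<delta> \<in> Der"
  then have app: "app (Endo \<delta>) = \<delta>" by (intro Endo_inverse) (simp add: Der_def)
  then show "\<exists>D. \<delta> = app D \<and> contr D \<and> derivation D"
    using \<delta> by (intro exI[of _ "Endo \<delta>"]) (simp add: Der_def derivation_def flip: contracting_app)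
qed (auto simp: Der_def derivation_def contracting_app strongly_linear_app)

lemma carrier_one_Aut_iff:
  "\<sigma> \<in> carrier one_Aut \<longleftrightarrow>
    (\<exists>s. \<sigma> = app s \<and> bij (app s) \<and> app s 1 = 1 \<and> multiplicative s \<and> contr (s - 1))"
proof -
  have *: "app s \<in> carrier one_Aut \<longleftrightarrow> bij (app s) \<and> app s 1 = 1 \<and> multiplicative s \<and> contr (s - 1)"
    for s :: "('a, 'b) endo"
    by (simp add: one_Aut_def multiplicative_def strongly_linear_app contracting_def app_minus_endo app_one
      flip: contracting_app)
  show ?thesis
  proof
    assume \<sigma>: "\<sigma> \<in> carrier one_Aut"
    then have "app (Endo \<sigma>) = \<sigma>" by (intro Endo_inverse) (simp add: one_Aut_def)
    then show "\<exists>s. \<sigma> = app s \<and> bij (app s) \<and> app s 1 = 1 \<and> multiplicative s \<and> contr (s - 1)"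
      using \<sigma> *[of "Endo \<sigma>"] by metis
  qed (use * in blast)
qed

lemma mult_one_Aut: "\<sigma> \<otimes>\<^bsub>one_Aut\<^esub> \<tau> = \<sigma> \<circ> \<tau>"
  by (simp add: one_Aut_def)

lemma exp_der_app: "contr D \<Longrightarrow> exp_der (app D) = app (exp_op D)"
proof -
  assume D: "contr D"
  show ?thesis
    by (rule ext) (simp add: exp_der_def lin_sum_def exp_op_def app_opser(1)[OF D] app_power)
qed

lemma exp_op_in_one_Aut:
  assumes D: "contr D" "derivation D"
  shows "app (exp_op D) \<in> carrier one_Aut"
proof -
  let ?E = "opser (fps_exp (- 1)) D"
  have "app (exp_op D) (app ?E v) = v" "app ?E (app (exp_op D) v) = v" for v
    using exp_op_inverse[OF D(1)] by (metis app_one app_times)+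
  then have bij: "bij (app (exp_op D))" by (intro o_bij[of "app ?E"]) auto
  have "app D 1 = app D 1 + app D 1"
    using D(2)[unfolded derivation_def, rule_format, of 1 1] by simp
  then have D1: "app D 1 = 0" by simp
  have one: "app (D ^ Suc k) 1 = 0" for k
    by (simp add: app_times D1 flip: power_commutes del: power_Suc add: power_Suc2)
  have "app (exp_op D) 1 = (\<Sum>k\<in>{0}. scale (fps_exp 1 $ k) (app (D ^ k) 1))"
  proof -
    have z: "scale (fps_exp 1 $ k) (app (D ^ k) 1) = 0" if "k \<in> UNIV - {0}" for k
      using that one[of "k - 1"] by simp
    show ?thesis unfolding exp_op_def app_opser(1)[OF D(1)]
      by (subst summable_family_drop_zero(2)[of "{0}" UNIV, OF _ z]) (simp_all add: family_sum_finite)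
  qed
  then have "app (exp_op D) 1 = 1" by (simp add: app_one)
  then show ?thesis
    using bij multiplicative_exp_op[OF D] contr_exp_op[OF D(1)] by (auto simp: carrier_one_Aut_iff)
qed

lemma exp_der_in_one_Aut: "\<delta> \<in> Der \<Longrightarrow> exp_der \<delta> \<in> carrier one_Aut"
  by (auto simp: Der_iff exp_der_app exp_op_in_one_Aut)

lemma one_Aut_is_exp:
  assumes "\<sigma> \<in> carrier one_Aut"
  obtains D where "contr D" "derivation D" "\<sigma> = app (exp_op D)"
proof -
  obtain s where s: "\<sigma> = app s" "multiplicative s" "contr (s - 1)"
    using assms by (auto simp: carrier_one_Aut_iff)
  show thesis
    by (rule that[of "log_op s"]) (simp_all add: s contr_log_op derivation_log_op exp_log_op)
qed

lemma one_Aut_mult_closed: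
  assumes "\<sigma> \<in> carrier one_Aut" "\<tau> \<in> carrier one_Aut"
  shows "\<sigma> \<circ> \<tau> \<in> carrier one_Aut"
proof -
  obtain s t where s: "\<sigma> = app s" "bij (app s)" "app s 1 = 1" "multiplicative s" "contr (s - 1)"
    and t: "\<tau> = app t" "bij (app t)" "app t 1 = 1" "multiplicative t" "contr (t - 1)"
    using assms unfolding carrier_one_Aut_iff by blast
  have "\<sigma> \<circ> \<tau> = app (s * t)" by (simp add: s(1) t(1) fun_eq_iff app_times)
  moreover have "bij (app (s * t))"
    using bij_comp[OF t(2) s(2)] by (simp add: comp_def app_times[abs_def])
  moreover have "s * t - 1 = (s - 1) * (t - 1) + ((s - 1) + (t - 1))" by (simp add: algebra_simps)
  then have "contr (s * t - 1)" by (simp only: contr_add contr_mult s(5) t(5))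
  ultimately show ?thesis
    using s(3,4) t(3,4) by (auto simp: carrier_one_Aut_iff multiplicative_def app_times)
qed

text \<open>The pairs \<open>(D, D')\<close> of a contracting derivation and its image form a Lie relation, so \<open>\<Phi>\<close> maps the
Baker-Campbell-Hausdorff series coefficientwise; strong linearity passes to the sums.\<close>

lemma Lie_morphism_bch:
  fixes \<Phi> :: "(('m::po_monoid, 'k::field_char_0) series \<Rightarrow> ('m, 'k) series)
              \<Rightarrow> (('n::po_monoid, 'k) series \<Rightarrow> ('n, 'k) series)"
  assumes \<Phi>: "strongly_linear_lie_morphism \<Phi>"
    and X: "app X \<in> Der" "\<Phi> (app X) = app X'" and Y: "app Y \<in> Der" "\<Phi> (app Y) = app Y'"
  shows "\<Phi> (app (eval_at_1 (bch scalar X Y))) = app (eval_at_1 (bch scalar X' Y'))"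
proof -
  define C where "C D D' \<longleftrightarrow> app D \<in> Der \<and> \<Phi> (app D) = app D'"
    for D :: "('m, 'k) endo" and D' :: "('n, 'k) endo"
  note \<Phi>' = \<Phi>[unfolded strongly_linear_lie_morphism_def]
  have C_scale: "C (scalar c * D) (scalar c * D')" if "C D D'" for c D D'
  proof -
    have "app (scalar c * D) \<in> Der"
      using that by (auto simp: C_def Der_def contracting_app
        strongly_linear_app contr_scalar app_times app_scalar series.scale_right_distrib
        scale_mult_left scale_mult_right)
    moreover have "app (scalar c * D) = (\<lambda>v. scale c (app D v))"
      "app (scalar c * D') = (\<lambda>v. scale c (app D' v))" by (simp_all add: fun_eq_iff app_times app_scalar)
    ultimately show ?thesis using that \<Phi>' by (simp add: C_def)
  qed
  interpret lie_relation "scalar :: 'k \<Rightarrow> ('m, 'k) endo" "scalar :: 'k \<Rightarrow> ('n, 'k) endo" C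
  proof
    fix D E :: "('m, 'k) endo" and D' E' :: "('n, 'k) endo"
    assume *: "C D D'" "C E E'"
    have "app (D + E) \<in> Der"
      using * by (auto simp: C_def Der_def contracting_app
        strongly_linear_app contr_add app_plus algebra_simps)
    moreover have "app (D + E) = (\<lambda>v. app D v + app E v)" "app (D' + E') = (\<lambda>v. app D' v + app E' v)"
      by (simp_all add: fun_eq_iff app_plus)
    ultimately show "C (D + E) (D' + E')" using * \<Phi>' by (simp add: C_def)
    have "app (ad D E) \<in> Der"
      using * by (auto simp: C_def Der_def contracting_app ad_def
        strongly_linear_app contr_diff contr_mult app_times app_minus_endo app_add algebra_simps)
    moreover have "app (ad D E) = lie_bracket (app D) (app E)" "app (ad D' E') = lie_bracket (app D') (app E')"
      by (simp_all add: fun_eq_iff lie_bracket_def ad_def app_times app_minus_endo)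
    ultimately show "C (ad D E) (ad D' E')" using * \<Phi>' by (simp add: C_def)
  next
    have "C X X'" using X by (simp add: C_def)
    from C_scale[OF this, of 0] show "C 0 0" by (simp add: scalar.hom_0)
  qed (rule C_scale)
  have bch: "C (bch scalar X Y $ n) (bch scalar X' Y' $ n)" for n
    by (rule bch_nth) (simp_all add: C_def X Y)
  have c: "contr X" "contr Y" using X(1) Y(1) by (simp_all add: Der_def contracting_app)
  have "\<Phi> (app X) \<in> Der" "\<Phi> (app Y) \<in> Der" using \<Phi>' X(1) Y(1) by blast+
  then have "app X' \<in> Der" "app Y' \<in> Der" by (simp_all only: X(2) Y(2))
  then have c': "contr X'" "contr Y'" by (simp_all add: Der_def contracting_app)
  note s = exp_op_bch(1)[OF c, unfolded summable_at_1_def] exp_op_bch(1)[OF c', unfolded summable_at_1_def]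
  have "\<Phi> (lin_sum UNIV (\<lambda>n. app (bch scalar X Y $ n))) = lin_sum UNIV (\<lambda>n. \<Phi> (app (bch scalar X Y $ n)))"
    by (rule strongly_linear_lie_morphism_any_index(2)[OF \<Phi>])
      (use bch s(1) in \<open>auto simp: C_def esummable_def\<close>)
  also have "\<dots> = lin_sum UNIV (\<lambda>n. app (bch scalar X' Y' $ n))"
    using bch by (simp add: C_def)
  finally show ?thesis by (simp add: eval_at_1_def app_esum_fun s)
qed

theorem theorem3p15:
  fixes \<Phi> :: "(('m::po_monoid, 'k::field_char_0) series \<Rightarrow> ('m, 'k) series)
              \<Rightarrow> (('n::po_monoid, 'k) series \<Rightarrow> ('n, 'k) series)"
  assumes "strongly_linear_lie_morphism \<Phi>"
  shows "\<exists>!\<Psi>. \<Psi> \<in> hom one_Aut one_Aut \<and> \<Psi> \<in> extensional (carrier one_Aut) \<and>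
           (\<forall>\<delta> \<in> Der. \<Psi> (exp_der \<delta>) = exp_der (\<Phi> \<delta>))"
proof -
  have \<Phi>_Der: "\<Phi> \<delta> \<in> Der" if "\<delta> \<in> Der" for \<delta>
    using assms that by (auto simp: strongly_linear_lie_morphism_def)
  define \<Psi> where "\<Psi> = (\<lambda>\<sigma> \<in> carrier one_Aut. exp_der (\<Phi> (app (log_op (Endo \<sigma>)))))"
  have exp: "\<Psi> (exp_der \<delta>) = exp_der (\<Phi> \<delta>)" if \<delta>: "\<delta> \<in> Der" for \<delta>
  proof -
    obtain D where "\<delta> = app D" "contr D" using \<delta> by (auto simp: Der_iff)
    then show ?thesis
      using exp_der_in_one_Aut[OF \<delta>] by (simp add: \<Psi>_def exp_der_app app_inverse log_exp_op)
  qed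
  have onto: "\<exists>\<delta>\<in>Der. \<sigma> = exp_der \<delta>" if \<sigma>: "\<sigma> \<in> carrier one_Aut" for \<sigma> :: "('m, 'k) series \<Rightarrow> _"
  proof -
    obtain D where "contr D" "derivation D" "\<sigma> = app (exp_op D)" by (rule one_Aut_is_exp[OF \<sigma>])
    then show ?thesis by (intro bexI[of _ "app D"]) (auto simp: exp_der_app Der_iff)
  qed
  have hom: "\<Psi> (\<sigma> \<circ> \<tau>) = \<Psi> \<sigma> \<circ> \<Psi> \<tau>" if \<sigma>: "\<sigma> \<in> carrier one_Aut" and \<tau>: "\<tau> \<in> carrier one_Aut"
    for \<sigma> \<tau>
  proof -
    obtain X where X: "contr X" "derivation X" "\<sigma> = app (exp_op X)" by (rule one_Aut_is_exp[OF \<sigma>])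
    obtain Y where Y: "contr Y" "derivation Y" "\<tau> = app (exp_op Y)" by (rule one_Aut_is_exp[OF \<tau>])
    have Der: "app X \<in> Der" "app Y \<in> Der" using X Y by (auto simp: Der_iff)
    obtain X' where X': "\<Phi> (app X) = app X'" "contr X'" using \<Phi>_Der[OF Der(1)] by (auto simp: Der_iff)
    obtain Y' where Y': "\<Phi> (app Y) = app Y'" "contr Y'" using \<Phi>_Der[OF Der(2)] by (auto simp: Der_iff)
    let ?Z = "eval_at_1 (bch scalar X Y)" and ?Z' = "eval_at_1 (bch scalar X' Y')"
    note bch = exp_op_bch[OF X(1) Y(1)] and bch' = exp_op_bch[OF X'(2) Y'(2)]
    have st: "\<sigma> \<circ> \<tau> = app (exp_op ?Z)"
      by (simp add: X(3) Y(3) fun_eq_iff flip: bch(3) app_times)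
    \<comment> \<open>The value of the Baker-Campbell-Hausdorff series is a derivation, being the logarithm of an
      automorphism.\<close>
    obtain D where D: "contr D" "derivation D" "\<sigma> \<circ> \<tau> = app (exp_op D)"
      by (rule one_Aut_is_exp[OF one_Aut_mult_closed[OF \<sigma> \<tau>]])
    have "exp_op D = exp_op ?Z" using D(3) st by (simp add: app_inject)
    then have "log_op (exp_op D) = log_op (exp_op ?Z)" by (rule arg_cong)
    then have "D = ?Z" unfolding log_exp_op[OF D(1)] log_exp_op[OF bch(2)] .
    then have "app ?Z \<in> Der" using D(1,2) unfolding Der_iff by blast
    from exp[OF this] have "\<Psi> (\<sigma> \<circ> \<tau>) = exp_der (\<Phi> (app ?Z))"
      by (simp add: st exp_der_app bch(2))
    also have "\<dots> = app (exp_op X' * exp_op Y')"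
      by (simp add: Lie_morphism_bch[OF assms Der(1) X'(1) Der(2) Y'(1)] exp_der_app bch')
    also have "\<dots> = \<Psi> \<sigma> \<circ> \<Psi> \<tau>"
    proof -
      have "\<Psi> \<sigma> = app (exp_op X')" "\<Psi> \<tau> = app (exp_op Y')"
        using exp[OF Der(1)] exp[OF Der(2)] by (simp_all add: exp_der_app X Y X' Y')
      then show ?thesis by (simp add: fun_eq_iff app_times)
    qed
    finally show ?thesis .
  qed
  show ?thesis
  proof (rule ex1I[of _ \<Psi>])
    have "\<Psi> \<sigma> \<in> carrier one_Aut" if "\<sigma> \<in> carrier one_Aut" for \<sigma>
      using onto[OF that] exp exp_der_in_one_Aut[OF \<Phi>_Der] by auto
    moreover have "\<Psi> \<in> extensional (carrier one_Aut)" by (simp add: \<Psi>_def)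
    ultimately show "\<Psi> \<in> hom one_Aut one_Aut \<and> \<Psi> \<in> extensional (carrier one_Aut) \<and>
        (\<forall>\<delta> \<in> Der. \<Psi> (exp_der \<delta>) = exp_der (\<Phi> \<delta>))"
      using exp hom by (auto simp: hom_def mult_one_Aut)
  next
    fix \<Psi>' assume \<Psi>': "\<Psi>' \<in> hom one_Aut one_Aut \<and> \<Psi>' \<in> extensional (carrier one_Aut) \<and>
        (\<forall>\<delta> \<in> Der. \<Psi>' (exp_der \<delta>) = exp_der (\<Phi> \<delta>))"
    show "\<Psi>' = \<Psi>"
    proof (rule extensionalityI[of _ "carrier one_Aut"])
      show "\<Psi>' \<sigma> = \<Psi> \<sigma>" if "\<sigma> \<in> carrier one_Aut" for \<sigma>
        using onto[OF that] \<Psi>' exp by auto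
    qed (use \<Psi>' in \<open>simp_all add: \<Psi>_def\<close>)
  qed
qed

end
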